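(* Let $x\in\mathbb R$, $E\ge 0$ and $\theta\in[0,2\pi)$, and let $\hat\rho\in\mathcal S^E$ be a state whose quadrature distribution $p_{\hat\rho,\theta}(q)=\langle q|\hat\rho|q\rangle_{\hat q_\theta}$ satisfies $p_{\hat\rho,\theta}(x)=0$. Then there exists $\delta>0$ such that for all $0<\eta\le\delta$, $$\operatorname{Tr}(\hat\rho\,\hat W_{\theta,x,\eta})<w^E_{\theta,x,\eta},\qquad\text{where } w^E_{\theta,x,\eta}:=\inf_{\hat\sigma\in\mathcal S_0^E}\operatorname{Tr}(\hat\sigma\,\hat W_{\theta,x,\eta}).$$
   Context: Setting: $\mathcal H=L^2(\mathbb R)$ (one bosonic mode), with position and momentum operators $\hat x,\hat p$ satisfying $[\hat x,\hat p]=i$, annihilation operator $\hat a=(\hat x+i\hat p)/\sqrt2$, number operator $\hat n=\hat a^\dagger\hat a$, and Fock basis $\{|n\rangle\}_{n\ge0}$ of eigenvectors of $\hat n$. States are density operators on $\mathcal H$; a pure state is identified with its rank-one projector $|\psi\rangle\langle\psi|$. For $\theta\in[0,2\pi)$ the quadrature operator is $\hat q_\theta=e^{-i\theta\hat n}\hat x e^{i\theta\hat n}=\hat x\cos\theta+\hat p\sin\theta$, with generalized eigenvectors $|q\rangle_{\hat q_\theta}$, $q\in\mathbb R$. For a state $\hat\rho$, $p_{\hat\rho,\theta}$ is the probability density of the outcome of measuring $\hat q_\theta$ on $\hat\rho$; for the energy-bounded states considered here, it denotes the continuous representative of this density. Witness: for $x\in\mathbb R$, $\eta>0$, $\hat W_{\theta,x,\eta}=\int_{x-\eta/2}^{x+\eta/2}|q\rangle\langle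 q|_{\hat q_\theta}\,dq$, i.e. the spectral projector of the self-adjoint operator $\hat q_\theta$ for the interval $[x-\eta/2,x+\eta/2]$, so that $\operatorname{Tr}(\hat\rho\hat W_{\theta,x,\eta})=\int_{x-\eta/2}^{x+\eta/2}p_{\hat\rho,\theta}(q)\,dq$. Stellar rank: for a pure state $|\psi\rangle=\sum_n\psi_n|n\rangle$, $r^\star(\psi)\in\mathbb N_0\cup\{\infty\}$ is the number of zeros in $\mathbb C$, counted with multiplicity, of the entire function $F^\star_\psi(\alpha)=\sum_n\psi_n\alpha^n/\sqrt{n!}$. A pure state has stellar rank $0$ if and only if it is Gaussian, i.e. of the form $\hat D(\alpha)\hat S(\chi)|0\rangle$ with $\alpha,\chi\in\mathbb C$, where $\hat D(\alpha)=e^{\alpha\hat a^\dagger-\alpha^*\hat a}$ and $\hat S(\chi)=e^{\frac12(\chi^*\hat a^2-\chi\hat a^{\dagger2})}$. Energy-bounded sets: for a set $S$ of states, $\mathrm{cch}(S)$ is its closed convex hull in trace norm. For $E\ge0$ and $r\in\mathbb N_0$, $\mathcal S^E=\mathrm{cch}\{|\psi\rangle\langle\psi| : \|\psi\|=1,\ \langle\psi|\hat n|\psi\rangle\le E\}$ and $\mathcal S_r^E=\mathrm{cch}\{|\psi\rangle\langle\psi| : \|\psi\|=1,\ \langle\psi|\hat n|\psi\rangle\le E,\ r^\star(\psi)\le r\}$. In particular $\mathcal S_0^E$ is the set of mixtures of pure Gaussian states of energy at most $E$. *)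

theory Defs
  imports
    "HOL-Probability.Probability"
    "HOL-Complex_Analysis.Complex_Analysis"
begin

section \<open>The Hilbert space of one bosonic mode\<close>

definition square_integrable :: "(real \<Rightarrow> complex) \<Rightarrow> bool" where
  "square_integrable f \<longleftrightarrow>
     f \<in> borel_measurable lborel \<and> integrable lborel (\<lambda>x. (cmod (f x))\<^sup>2)"

definition l2_eq :: "(real \<Rightarrow> complex) \<Rightarrow> (real \<Rightarrow> complex) \<Rightarrow> bool" where
  "l2_eq f g \<longleftrightarrow> square_integrable f \<and> square_integrable g \<and> (AE x in lborel. f x = g x)"

lemma square_integrable_zero: "square_integrable (\<lambda>_. 0)"
  by (simp add: square_integrable_def)

lemma square_integrable_mult:
  assumes "square_integrable f" "square_integrable g"
  shows "integrable lborel (\<lambda>x. cnj (f x) * g x)"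
proof (rule Bochner_Integration.integrable_bound)
  show "integrable lborel (\<lambda>x. (cmod (f x))\<^sup>2 + (cmod (g x))\<^sup>2)"
    using assms by (simp add: square_integrable_def)
  have "(\<lambda>x. cnj (f x)) \<in> borel_measurable lborel"
    using assms unfolding square_integrable_def
    by (intro borel_measurable_continuous_on[where f = cnj] continuous_intros) auto
  then show "(\<lambda>x. cnj (f x) * g x) \<in> borel_measurable lborel"
    using assms unfolding square_integrable_def by (intro borel_measurable_times) auto
  have "a * b \<le> a\<^sup>2 + b\<^sup>2" if "0 \<le> a" "0 \<le> b" for a b :: real
    using sum_squares_bound[of a b] mult_nonneg_nonneg[OF that] by linarith
  then show "AE x in lborel. norm (cnj (f x) * g x) \<le> norm ((cmod (f x))\<^sup>2 + (cmod (g x))\<^sup>2)"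
    by (simp add: norm_mult)
qed

lemma square_integrable_bound:
  assumes "f \<in> borel_measurable lborel" "integrable lborel h"
    and "\<And>x. (cmod (f x))\<^sup>2 \<le> h x"
  shows "square_integrable f"
  unfolding square_integrable_def
proof (intro conjI Bochner_Integration.integrable_bound[OF assms(2)] AE_I2)
  show "(\<lambda>x. (cmod (f x))\<^sup>2) \<in> borel_measurable lborel"
    by (intro borel_measurable_power measurable_compose[OF assms(1) borel_measurable_norm])
  show "norm ((cmod (f x))\<^sup>2) \<le> norm (h x)" for x
    using order_trans[OF assms(3) abs_ge_self] by simp
qed (fact assms(1))

lemma square_integrable_add:
  assumes "square_integrable f" "square_integrable g"
  shows "square_integrable (\<lambda>x. f x + g x)"
proof (rule square_integrable_bound)
  show "(\<lambda>x. f x + g x) \<in> borel_measurable lborel"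
    using assms unfolding square_integrable_def by (intro borel_measurable_add) simp_all
  show "integrable lborel (\<lambda>x. 2 * (cmod (f x))\<^sup>2 + 2 * (cmod (g x))\<^sup>2)"
    using assms unfolding square_integrable_def
    by (intro Bochner_Integration.integrable_add integrable_mult_right) simp_all
  fix x
  have "(cmod (f x + g x))\<^sup>2 \<le> (cmod (f x) + cmod (g x))\<^sup>2"
    by (intro power_mono norm_triangle_ineq norm_ge_zero)
  also have "\<dots> \<le> 2 * (cmod (f x))\<^sup>2 + 2 * (cmod (g x))\<^sup>2"
    using sum_squares_bound[of "cmod (f x)" "cmod (g x)"] by (simp add: power2_sum)
  finally show "(cmod (f x + g x))\<^sup>2 \<le> 2 * (cmod (f x))\<^sup>2 + 2 * (cmod (g x))\<^sup>2" .
qed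

lemma square_integrable_cmult:
  assumes "square_integrable f"
  shows "square_integrable (\<lambda>x. c * f x)"
proof (rule square_integrable_bound)
  show "(\<lambda>x. c * f x) \<in> borel_measurable lborel"
    using assms unfolding square_integrable_def
    by (intro borel_measurable_times borel_measurable_const) simp_all
  show "integrable lborel (\<lambda>x. (cmod c)\<^sup>2 * (cmod (f x))\<^sup>2)"
    using assms unfolding square_integrable_def by (intro integrable_mult_right) simp_all
qed (simp add: norm_mult power_mult_distrib)

lemma square_integrable_indicator:
  assumes "square_integrable f" "B \<in> sets borel"
  shows "square_integrable (\<lambda>x. indicator B x * f x)"
proof (rule square_integrable_bound)
  show "(\<lambda>x. indicator B x * f x) \<in> borel_measurable lborel"
    using assms unfolding square_integrable_def
    by (intro borel_measurable_times borel_measurable_indicator) simp_all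
  show "integrable lborel (\<lambda>x. (cmod (f x))\<^sup>2)"
    using assms unfolding square_integrable_def by simp
qed (simp add: indicator_def)

lemma l2_eqI:
  assumes "square_integrable f" "\<And>x. f x = g x"
  shows "l2_eq f g"
proof -
  have "f = g"
    using assms by blast
  then show ?thesis
    using assms by (simp add: l2_eq_def)
qed

lemma l2_eqD: "l2_eq f f \<Longrightarrow> square_integrable f"
  by (simp add: l2_eq_def)

lemmas l2_intros = square_integrable_add square_integrable_cmult l2_eqD

lemma LINT_cnj_mult_commute:
  "(LINT x|lborel. cnj (f x) * g x) = cnj (LINT x|lborel. cnj (g x) * f x)"
proof -
  have "(LINT x|lborel. cnj (f x) * g x) = (LINT x|lborel. cnj (cnj (g x) * f x))"
    by (simp add: mult.commute)
  also have "\<dots> = cnj (LINT x|lborel. cnj (g x) * f x)"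
    by (rule Bochner_Integration.integral_cnj)
  finally show ?thesis .
qed

lemma LINT_cnj_mult_add:
  assumes "square_integrable f" "square_integrable g" "square_integrable h"
  shows "(LINT x|lborel. cnj (f x) * (g x + h x)) =
    (LINT x|lborel. cnj (f x) * g x) + (LINT x|lborel. cnj (f x) * h x)"
  unfolding distrib_left
  by (intro Bochner_Integration.integral_add square_integrable_mult assms)

lemma LINT_cnj_mult_cmult:
  "(LINT x|lborel. cnj (f x) * (c * g x)) = c * (LINT x|lborel. cnj (f x) * g x)"
  by (simp only: mult.left_commute[of _ c] integral_mult_right_zero)

lemma LINT_cnj_mult_self:
  "(LINT x|lborel. cnj (f x) * f x) = complex_of_real (LINT x|lborel. (cmod (f x))\<^sup>2)"
proof -
  have "cnj z * z = complex_of_real ((cmod z)\<^sup>2)" for z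
    by (simp only: complex_norm_square mult.commute)
  then show ?thesis
    by (simp only: integral_complex_of_real)
qed

text \<open>
  \<open>wavefun\<close> is $L^2(\mathbb R)$: square integrable functions modulo equality almost everywhere.
\<close>

quotient_type wavefun = "real \<Rightarrow> complex" / partial: l2_eq
proof (rule part_equivpI)
  show "\<exists>x. l2_eq x x"
    using square_integrable_zero by (auto simp: l2_eq_def)
  show "symp l2_eq"
    by (auto simp: l2_eq_def symp_def)
  show "transp l2_eq"
    by (auto simp: l2_eq_def transp_def)
qed

lift_definition scaleC :: "complex \<Rightarrow> wavefun \<Rightarrow> wavefun" (infixr "*\<^sub>C" 75)
  is "\<lambda>c f x. c * f x"
  by (auto simp: l2_eq_def square_integrable_cmult)

lift_definition cinner :: "wavefun \<Rightarrow> wavefun \<Rightarrow> complex"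
  is "\<lambda>f g. LINT x|lborel. cnj (f x) * g x"
proof -
  fix f f' g g' assume *: "l2_eq f f'" "l2_eq g g'"
  have "AE x in lborel. cnj (f x) * g x = cnj (f' x) * g' x"
    using * by (auto simp: l2_eq_def)
  then show "(LINT x|lborel. cnj (f x) * g x) = (LINT x|lborel. cnj (f' x) * g' x)"
    using * by (intro integral_cong_AE borel_measurable_integrable square_integrable_mult)
      (simp_all add: l2_eq_def)
qed

instantiation wavefun :: real_inner
begin

lift_definition zero_wavefun :: wavefun is "\<lambda>_. 0"
  by (simp add: l2_eq_def square_integrable_zero)

lift_definition plus_wavefun :: "wavefun \<Rightarrow> wavefun \<Rightarrow> wavefun" is "\<lambda>f g x. f x + g x"
  by (auto simp: l2_eq_def square_integrable_add)

definition uminus_wavefun :: "wavefun \<Rightarrow> wavefun" where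
  "uminus_wavefun f = (- 1) *\<^sub>C f"

definition minus_wavefun :: "wavefun \<Rightarrow> wavefun \<Rightarrow> wavefun" where
  "minus_wavefun f g = f + - g"

definition scaleR_wavefun :: "real \<Rightarrow> wavefun \<Rightarrow> wavefun" where
  "scaleR_wavefun r f = complex_of_real r *\<^sub>C f"

definition inner_wavefun :: "wavefun \<Rightarrow> wavefun \<Rightarrow> real" where
  "inner_wavefun f g = Re (cinner f g)"

definition norm_wavefun :: "wavefun \<Rightarrow> real" where
  "norm_wavefun f = sqrt (f \<bullet> f)"

definition sgn_wavefun :: "wavefun \<Rightarrow> wavefun" where
  "sgn_wavefun f = inverse (norm f) *\<^sub>R f"

definition dist_wavefun :: "wavefun \<Rightarrow> wavefun \<Rightarrow> real" where
  "dist_wavefun f g = norm (f - g)"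

definition uniformity_wavefun :: "(wavefun \<times> wavefun) filter" where
  "uniformity_wavefun = (INF e\<in>{0<..}. principal {(f, g). dist f g < e})"

definition open_wavefun :: "wavefun set \<Rightarrow> bool" where
  "open_wavefun U \<longleftrightarrow>
     (\<forall>f\<in>U. eventually (\<lambda>(f', g). f' = f \<longrightarrow> g \<in> U) uniformity)"

instance
proof
  fix f g h :: wavefun and a b r s :: real
  show "f + g + h = f + (g + h)"
    by transfer (rule l2_eqI, (intro l2_intros; assumption), simp add: add.assoc)
  show "f + g = g + f"
    by transfer (rule l2_eqI, (intro l2_intros; assumption), simp add: add.commute)
  show "0 + f = f"
    by transfer simp
  show "- f + f = 0"
    unfolding uminus_wavefun_def
    by transfer (simp add: l2_eq_def square_integrable_zero)
  show "f - g = f + - g"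
    by (simp add: minus_wavefun_def)
  show "r *\<^sub>R (f + g) = r *\<^sub>R f + r *\<^sub>R g"
    unfolding scaleR_wavefun_def
    by transfer (rule l2_eqI, (intro l2_intros; assumption), simp add: ring_distribs)
  show "(r + s) *\<^sub>R f = r *\<^sub>R f + s *\<^sub>R f"
    unfolding scaleR_wavefun_def
    by transfer (rule l2_eqI, (intro l2_intros; assumption), simp add: ring_distribs)
  show "r *\<^sub>R s *\<^sub>R f = (r * s) *\<^sub>R f"
    unfolding scaleR_wavefun_def
    by transfer (rule l2_eqI, (intro l2_intros; assumption), simp)
  show "1 *\<^sub>R f = f"
    unfolding scaleR_wavefun_def
    by transfer simp
  show "dist f g = norm (f - g)"
    by (simp add: dist_wavefun_def)
  show "sgn f = inverse (norm f) *\<^sub>R f"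
    by (simp add: sgn_wavefun_def)
  show "uniformity = (INF e\<in>{0<..}. principal {(f, g :: wavefun). dist f g < e})"
    by (simp add: uniformity_wavefun_def)
  show "open U \<longleftrightarrow> (\<forall>f\<in>U. eventually (\<lambda>(f', g). f' = f \<longrightarrow> g \<in> U) uniformity)"
    for U :: "wavefun set"
    by (simp add: open_wavefun_def)
  show "norm f = sqrt (f \<bullet> f)"
    by (simp add: norm_wavefun_def)
  have comm: "cinner f g = cnj (cinner g f)" for f g
    by transfer (rule LINT_cnj_mult_commute)
  have add: "cinner f (g + h) = cinner f g + cinner f h" for f g h
    by transfer (intro LINT_cnj_mult_add l2_eqD)
  have scale: "cinner f (c *\<^sub>C g) = c * cinner f g" for f g c
    by transfer (rule LINT_cnj_mult_cmult)
  show "f \<bullet> g = g \<bullet> f"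
    unfolding inner_wavefun_def by (subst comm) simp
  show "(f + g) \<bullet> h = f \<bullet> h + g \<bullet> h"
    unfolding inner_wavefun_def by (simp add: comm[of _ h] add)
  show "(r *\<^sub>R f) \<bullet> g = r * (f \<bullet> g)"
    unfolding inner_wavefun_def scaleR_wavefun_def by (simp add: comm[of _ g] scale)
  show "0 \<le> f \<bullet> f"
    unfolding inner_wavefun_def by transfer (simp add: LINT_cnj_mult_self)
  show "f \<bullet> f = 0 \<longleftrightarrow> f = 0"
    unfolding inner_wavefun_def
  proof transfer
    fix f assume *: "l2_eq f f"
    then have "integrable lborel (\<lambda>x. (cmod (f x))\<^sup>2)"
      by (simp add: l2_eq_def square_integrable_def)
    then have "(LINT x|lborel. (cmod (f x))\<^sup>2) = 0 \<longleftrightarrow> (AE x in lborel. (cmod (f x))\<^sup>2 = 0)"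
      by (intro integral_nonneg_eq_0_iff_AE) auto
    then show "Re (LINT x|lborel. cnj (f x) * f x) = 0 \<longleftrightarrow> l2_eq f (\<lambda>_. 0)"
      using * by (simp add: LINT_cnj_mult_self l2_eq_def square_integrable_zero)
  qed
qed

end

lemma cinner_commute: "cinner f g = cnj (cinner g f)"
  by transfer (rule LINT_cnj_mult_commute)

lemma cinner_add_right: "cinner f (g + h) = cinner f g + cinner f h"
  by transfer (intro LINT_cnj_mult_add l2_eqD)

lemma cinner_scaleC_right: "cinner f (c *\<^sub>C g) = c * cinner f g"
  by transfer (rule LINT_cnj_mult_cmult)

lemma cinner_scaleC_left: "cinner (c *\<^sub>C f) g = cnj c * cinner f g"
  by (simp add: cinner_commute[of _ g] cinner_scaleC_right)

lemma scaleC_add_left: "(a + b) *\<^sub>C f = a *\<^sub>C f + b *\<^sub>C f"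
  by transfer (rule l2_eqI, (intro l2_intros; assumption), simp add: ring_distribs)

lemma scaleC_scaleC: "a *\<^sub>C b *\<^sub>C f = (a * b) *\<^sub>C f"
  by transfer (rule l2_eqI, (intro l2_intros; assumption), simp)

lemma norm_scaleC: "norm (c *\<^sub>C f) = cmod c * norm f"
proof -
  have "(c *\<^sub>C f) \<bullet> (c *\<^sub>C f) = Re (cnj c * c * cinner f f)"
    by (simp only: inner_wavefun_def cinner_scaleC_left cinner_scaleC_right mult_ac)
  also have "cnj c * c = complex_of_real ((cmod c)\<^sup>2)"
    by (simp only: complex_norm_square mult.commute)
  finally show ?thesis
    by (simp add: norm_wavefun_def inner_wavefun_def real_sqrt_mult flip: of_real_power)
qed

lemma cinner_Cauchy_Schwarz: "cmod (cinner f g) \<le> norm f * norm g"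
proof -
  define u where "u = cnj (sgn (cinner f g))"
  have "cmod u \<le> 1"
    by (simp add: u_def norm_sgn)
  have "u * cinner f g = complex_of_real (cmod (cinner f g))"
    by (simp add: u_def sgn_eq mult.commute[of "cnj _"] flip: complex_norm_square)
      (simp add: power2_eq_square)
  then have "cmod (cinner f g) = f \<bullet> (u *\<^sub>C g)"
    by (simp add: inner_wavefun_def cinner_scaleC_right)
  also have "\<dots> \<le> norm f * norm (u *\<^sub>C g)"
    by (rule norm_cauchy_schwarz)
  also have "\<dots> \<le> norm f * norm g"
    using \<open>cmod u \<le> 1\<close> by (auto simp: norm_scaleC intro!: mult_left_mono mult_left_le_one_le)
  finally show ?thesis .
qed

section \<open>Fock basis\<close>

text \<open>
  The Schroedinger representation: $\hat x$ multiplies by $x$ and $\hat p = -i\,d/dx$, so that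
  $\hat a^\dagger = (x - d/dx)/\sqrt 2$, and $|n+1\rangle = \hat a^\dagger|n\rangle/\sqrt{n+1}$.
\<close>

fun fock_fun :: "nat \<Rightarrow> real \<Rightarrow> real" where
  "fock_fun 0 = (\<lambda>x. pi powr (- 1 / 4) * exp (- (x\<^sup>2) / 2))"
| "fock_fun (Suc n) =
     (\<lambda>x. (x * fock_fun n x - deriv (fock_fun n) x) / sqrt (2 * real (Suc n)))"

lemma fock_fun_poly: "\<exists>p. fock_fun n = (\<lambda>x. poly p x * exp (- (x\<^sup>2) / 2))"
proof (induction n)
  case 0
  have "fock_fun 0 = (\<lambda>x. poly [:pi powr (- 1 / 4):] x * exp (- (x\<^sup>2) / 2))"
    by simp
  then show ?case
    by blast
next
  case (Suc n)
  then obtain p where p: "fock_fun n = (\<lambda>x. poly p x * exp (- (x\<^sup>2) / 2))"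
    by blast
  have d: "deriv (fock_fun n) x = (poly (pderiv p) x - x * poly p x) * exp (- (x\<^sup>2) / 2)" for x
    unfolding p by (rule DERIV_imp_deriv)
      (auto intro!: derivative_eq_intros simp: algebra_simps)
  define q where
    "q = smult (1 / sqrt (2 * real (Suc n))) ([:0, 2:] * p - pderiv p)"
  have "fock_fun (Suc n) = (\<lambda>x. poly q x * exp (- (x\<^sup>2) / 2))"
    unfolding fock_fun.simps d unfolding p q_def
    by (rule ext) (simp add: field_simps)
  then show ?case
    by blast
qed

lemma integrable_poly_gauss: "integrable lborel (\<lambda>x. poly p x * exp (- (x\<^sup>2)))" for p :: "real poly"
proof -
  have *: "normal_density 0 (1 / sqrt 2) x * (x - 0) ^ k = (1 / sqrt pi) * (x ^ k * exp (- (x\<^sup>2)))"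
    for x :: real and k
    by (simp add: normal_density_def power_divide)
  have "integrable lborel (\<lambda>x::real. x ^ k * exp (- (x\<^sup>2)))" for k
    using integrable_mult_right[OF integrable_normal_moment[of "1 / sqrt 2" 0 k], of "sqrt pi"]
    unfolding * by simp
  then have "integrable lborel (\<lambda>x. \<Sum>i\<le>degree p. coeff p i * (x ^ i * exp (- (x\<^sup>2))))"
    by auto
  then show ?thesis
    by (simp add: poly_altdef sum_distrib_right mult.assoc)
qed

lemma square_integrable_fock_fun: "square_integrable (\<lambda>x. complex_of_real (fock_fun n x))"
proof -
  obtain p where p: "fock_fun n = (\<lambda>x. poly p x * exp (- (x\<^sup>2) / 2))"
    using fock_fun_poly by blast
  have "(cmod (complex_of_real (fock_fun n x)))\<^sup>2 = poly (p * p) x * exp (- (x\<^sup>2))" for x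
  proof -
    have "(exp (- (x\<^sup>2) / 2))\<^sup>2 = exp (- (x\<^sup>2))"
      by (simp flip: exp_double)
    then show ?thesis
      by (simp add: p norm_mult power_mult_distrib power2_eq_square[of "poly p x"])
  qed
  moreover have "(\<lambda>x. complex_of_real (fock_fun n x)) \<in> borel_measurable lborel"
    unfolding p measurable_lborel2
    by (intro borel_measurable_continuous_onI continuous_intros) auto
  ultimately show ?thesis
    using integrable_poly_gauss[of "p * p"] by (simp add: square_integrable_def)
qed

lift_definition fock :: "nat \<Rightarrow> wavefun" is "\<lambda>n x. complex_of_real (fock_fun n x)"
  by (simp add: l2_eq_def square_integrable_fock_fun)

section \<open>States, trace and trace norm\<close>

type_synonym qop = "wavefun \<Rightarrow>\<^sub>L wavefun"

text \<open>
  \<open>qop\<close> contains all bounded real-linear operators; complex linearity is part of \<open>positive_op\<close>.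
\<close>

definition positive_op :: "qop \<Rightarrow> bool" where
  "positive_op A \<longleftrightarrow>
     (\<forall>c f. A (c *\<^sub>C f) = c *\<^sub>C A f) \<and> (\<forall>f. cinner f (A f) \<in> \<real>\<^sub>\<ge>\<^sub>0)"

definition op_trace :: "(wavefun \<Rightarrow> wavefun) \<Rightarrow> complex" where
  "op_trace A = (\<Sum>n. cinner (fock n) (A (fock n)))"

definition density_operator :: "qop \<Rightarrow> bool" where
  "density_operator \<rho> \<longleftrightarrow>
     positive_op \<rho> \<and> (\<lambda>n. cinner (fock n) (\<rho> (fock n))) sums 1"

text \<open>
  The trace norm of $A$ is the trace of $|A| = \sqrt{A^\dagger A}$, the positive operator $P$ with
  $P^2 = A^\dagger A$. There is exactly one such $P$, so the infimum is over a singleton.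
\<close>

definition is_abs_op :: "qop \<Rightarrow> qop \<Rightarrow> bool" where
  "is_abs_op A P \<longleftrightarrow>
     positive_op P \<and> (\<forall>f g. cinner f (P (P g)) = cinner (A f) (A g))"

definition trace_norm :: "qop \<Rightarrow> ennreal" where
  "trace_norm A =
     (INF P \<in> {P. is_abs_op A P}. \<Sum>n. ennreal (Re (cinner (fock n) (blinfun_apply P (fock n)))))"

text \<open>
  The density operators are closed in trace norm, so taking the closure inside them gives the
  full closure.
\<close>

definition cch :: "qop set \<Rightarrow> qop set" where
  "cch S = {\<sigma>. density_operator \<sigma> \<and>
     (\<forall>\<epsilon>>0. \<exists>\<tau> \<in> convex hull S. trace_norm (\<sigma> - \<tau>) < ennreal \<epsilon>)}"

lift_definition pure_state :: "wavefun \<Rightarrow> qop" is "\<lambda>\<psi> f. cinner \<psi> f *\<^sub>C \<psi>"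
proof
  fix \<psi> f g :: wavefun and r :: real
  show "cinner \<psi> (f + g) *\<^sub>C \<psi> = cinner \<psi> f *\<^sub>C \<psi> + cinner \<psi> g *\<^sub>C \<psi>"
    by (simp add: cinner_add_right scaleC_add_left)
  show "cinner \<psi> (r *\<^sub>R f) *\<^sub>C \<psi> = r *\<^sub>R (cinner \<psi> f *\<^sub>C \<psi>)"
    by (simp add: scaleR_wavefun_def cinner_scaleC_right scaleC_scaleC)
  have "norm (cinner \<psi> f *\<^sub>C \<psi>) \<le> norm f * (norm \<psi> * norm \<psi>)" for f
    using mult_right_mono[OF cinner_Cauchy_Schwarz[of \<psi> f], of "norm \<psi>"]
    by (simp add: norm_scaleC mult_ac)
  then show "\<exists>K. \<forall>f. norm (cinner \<psi> f *\<^sub>C \<psi>) \<le> norm f * K"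
    by blast
qed

section \<open>Energy and stellar rank\<close>

text \<open>
  $\langle\psi|\hat n|\psi\rangle$ as a quadratic form, infinite outside the form domain of
  $\hat n$.
\<close>

definition energy :: "wavefun \<Rightarrow> ennreal" where
  "energy \<psi> = (\<Sum>n. ennreal (real n * (cmod (cinner (fock n) \<psi>))\<^sup>2))"

definition stellar_function :: "wavefun \<Rightarrow> complex \<Rightarrow> complex" where
  "stellar_function \<psi> \<alpha> = (\<Sum>n. cinner (fock n) \<psi> * \<alpha> ^ n / complex_of_real (sqrt (fact n)))"

definition stellar_rank :: "wavefun \<Rightarrow> enat" where
  "stellar_rank \<psi> =
     (let Z = {\<alpha>. stellar_function \<psi> \<alpha> = 0} in
      if finite Z then enat (\<Sum>\<alpha>\<in>Z. nat (zorder (stellar_function \<psi>) \<alpha>)) else \<infinity>)"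

definition energy_bounded_states :: "real \<Rightarrow> qop set" where
  "energy_bounded_states E =
     cch {pure_state \<psi> | \<psi>. norm \<psi> = 1 \<and> energy \<psi> \<le> ennreal E}"

definition rank_bounded_states :: "nat \<Rightarrow> real \<Rightarrow> qop set" where
  "rank_bounded_states r E =
     cch {pure_state \<psi> | \<psi>.
       norm \<psi> = 1 \<and> energy \<psi> \<le> ennreal E \<and> stellar_rank \<psi> \<le> enat r}"

section \<open>Quadrature measurements\<close>

definition phase_rotation :: "real \<Rightarrow> wavefun \<Rightarrow> wavefun" where
  \<comment> \<open>the unitary $e^{it\hat n}$\<close>
  "phase_rotation t \<psi> = (\<Sum>n. (cis (t * real n) * cinner (fock n) \<psi>) *\<^sub>C fock n)"

lift_definition position_projector :: "real set \<Rightarrow> wavefun \<Rightarrow> wavefun"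
  is "\<lambda>B f. if B \<in> sets borel then (\<lambda>x. indicator B x * f x) else (\<lambda>_. 0)"
  by (auto simp: l2_eq_def square_integrable_zero square_integrable_indicator)

text \<open>
  The spectral measure of $\hat q_\theta = e^{-i\theta\hat n}\hat x e^{i\theta\hat n}$.
  With $[\hat x,\hat p] = i$ this operator is $\hat x\cos\theta - \hat p\sin\theta$; the other
  sign convention amounts to replacing $\theta$ by $2\pi-\theta$.
\<close>

definition quadrature_projector :: "real \<Rightarrow> real set \<Rightarrow> wavefun \<Rightarrow> wavefun" where
  "quadrature_projector \<theta> B =
     phase_rotation (- \<theta>) \<circ> position_projector B \<circ> phase_rotation \<theta>"

definition expval :: "qop \<Rightarrow> (wavefun \<Rightarrow> wavefun) \<Rightarrow> real" where
  "expval \<rho> W = Re (op_trace (blinfun_apply \<rho> \<circ> W))"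

definition is_quadrature_density :: "qop \<Rightarrow> real \<Rightarrow> (real \<Rightarrow> real) \<Rightarrow> bool" where
  "is_quadrature_density \<rho> \<theta> p \<longleftrightarrow>
     continuous_on UNIV p \<and> (\<forall>q. 0 \<le> p q) \<and> integrable lborel p \<and>
     (\<forall>B\<in>sets borel. expval \<rho> (quadrature_projector \<theta> B) = (LINT q:B|lborel. p q))"

definition quadrature_density :: "qop \<Rightarrow> real \<Rightarrow> real \<Rightarrow> real" where
  "quadrature_density \<rho> \<theta> = (THE p. is_quadrature_density \<rho> \<theta> p)"

definition witness :: "real \<Rightarrow> real \<Rightarrow> real \<Rightarrow> wavefun \<Rightarrow> wavefun" where
  "witness \<theta> x \<eta> = quadrature_projector \<theta> {x - \<eta> / 2 .. x + \<eta> / 2}"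

definition witness_threshold :: "real \<Rightarrow> real \<Rightarrow> real \<Rightarrow> real \<Rightarrow> real" where
  "witness_threshold E \<theta> x \<eta> = (INF \<sigma> \<in> rank_bounded_states 0 E. expval \<sigma> (witness \<theta> x \<eta>))"

end

theory Submission
  imports Defs
begin

text \<open>
  If $\|\phi\| = 1$ and $\langle\phi|\hat n|\phi\rangle \le E$, then $\|\hat x\phi\|^2$ and
  $\|\phi'\|^2$ are at most $2E+1$, so $|\phi|^2$ is bounded, Hoelder continuous of exponent $1/2$
  and has bounded second moment, all with a constant $K(E)$. These bounds pass to mixtures and to
  trace norm limits, so $\hat\rho$ has a Hoelder continuous density $p$, and $p(x) = 0$ gives
  $\mathrm{Tr}(\hat\rho\hat W_\eta) \le K \sqrt\eta\,\eta$.

  A pure state of stellar rank $0$ has a zero-free stellar function of quadratic exponential growth,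
  which is therefore the exponential of a quadratic polynomial. Hence the quadrature density is a
  normal density; its second moment and its supremum are bounded by $K(E)$, which bounds the mean and
  bounds the variance from both sides. So it is at least some $c > 0$ near $x$, the threshold is at
  least $c\,\eta$, and it suffices to take $\eta$ with $K \sqrt\eta < c$.
\<close>

section \<open>The Hilbert space\<close>

text \<open>Constants must be uniform over all pure states of energy at most \<open>E\<close>,
  because mixtures and trace norm limits inherit only uniform bounds. The energy controls a
  wavefunction just in the first Sobolev norm, whence the exponent 1/2. Truncated Fock expansions
  keep all functions smooth and rapidly decaying; general states are reached through closedness of
  the class \<open>regular_density\<close>. Bounded energy limits squeezing: a normal density at its
  mean is inversely proportional to its standard deviation, so an upper bound on the density is a
  lower bound on the variance. The trace norm is given by an operator \<open>P\<close> whose square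
  is the adjoint of \<open>A\<close> times \<open>A\<close>; a rank-one decomposition of
  \<open>P\<close> leads from it to traces against projectors. A state with zero-free stellar
  function is recognized as Gaussian by its Fock coefficients: the differential equation of the
  stellar function is a recurrence for them, which an explicit Gaussian also satisfies. The angle
  enters only through \<open>phase_rotation\<close>, which preserves energy and
  zero-freeness.\<close>

lemma cinner_add_left: "cinner (f + g) h = cinner f h + cinner g h"
  by (simp add: cinner_commute[of _ h] cinner_add_right)

lemma scaleC_one [simp]: "1 *\<^sub>C f = f"
  by transfer simp

lemma scaleC_zero_left [simp]: "0 *\<^sub>C f = 0"
  using scaleC_add_left[of 0 0 f] by simp

lemma uminus_eq_scaleC: "- f = (- 1) *\<^sub>C f" for f :: wavefun
  by (simp add: uminus_wavefun_def)

lemma scaleR_eq_scaleC: "r *\<^sub>R f = complex_of_real r *\<^sub>C f"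
  by (simp add: scaleR_wavefun_def)

lemma cinner_zero_right [simp]: "cinner f 0 = 0"
  using cinner_add_right[of f 0 0] by simp

lemma cinner_zero_left [simp]: "cinner 0 f = 0"
  using cinner_add_left[of 0 0 f] by simp

lemma cinner_minus_right [simp]: "cinner f (- g) = - cinner f g"
  by (simp add: uminus_eq_scaleC cinner_scaleC_right)

lemma cinner_minus_left [simp]: "cinner (- f) g = - cinner f g"
  by (simp add: uminus_eq_scaleC cinner_scaleC_left)

lemma cinner_diff_right: "cinner f (g - h) = cinner f g - cinner f h"
  using cinner_add_right[of f g "- h"] by simp

lemma cinner_diff_left: "cinner (f - g) h = cinner f h - cinner g h"
  using cinner_add_left[of f "- g" h] by simp

lemma cinner_scaleR_right: "cinner f (r *\<^sub>R g) = complex_of_real r * cinner f g"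
  by (simp add: scaleR_eq_scaleC cinner_scaleC_right)

lemma scaleC_add_right: "c *\<^sub>C (f + g) = c *\<^sub>C f + c *\<^sub>C g"
  by transfer (rule l2_eqI, (intro l2_intros; assumption), simp add: ring_distribs)

lemma scaleC_zero_right [simp]: "c *\<^sub>C (0 :: wavefun) = 0"
  using scaleC_add_right[of c 0 0] by simp

lemma scaleC_minus_right [simp]: "c *\<^sub>C (- f) = - (c *\<^sub>C f)"
  by (simp add: uminus_eq_scaleC scaleC_scaleC)

lemma scaleC_diff_right: "c *\<^sub>C (f - g) = c *\<^sub>C f - c *\<^sub>C g"
  using scaleC_add_right[of c f "- g"] by simp

lemma cinner_sum_right: "cinner f (\<Sum>i\<in>A. g i) = (\<Sum>i\<in>A. cinner f (g i))"
  by (induction A rule: infinite_finite_induct) (simp_all add: cinner_add_right)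

lemma cinner_sum_left: "cinner (\<Sum>i\<in>A. f i) g = (\<Sum>i\<in>A. cinner (f i) g)"
  by (induction A rule: infinite_finite_induct) (simp_all add: cinner_add_left)

lemma Im_cinner_self [simp]: "Im (cinner f f) = 0"
  using cinner_commute[of f f] by (simp add: complex_eq_iff)

lemma cinner_self: "cinner f f = complex_of_real ((norm f)\<^sup>2)"
  by (rule complex_eqI) (simp_all add: power2_norm_eq_inner inner_wavefun_def)

lemma bounded_linear_cinner_right: "bounded_linear (cinner f)"
proof (rule bounded_linear_intro[where K = "norm f"])
  show "norm (cinner f g) \<le> norm g * norm f" for g
    using cinner_Cauchy_Schwarz[of f g] by (simp add: mult.commute)
qed (simp_all add: cinner_add_right cinner_scaleR_right scaleR_conv_of_real)

lemmas tendsto_cinner_right = bounded_linear.tendsto[OF bounded_linear_cinner_right]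

lemma l2_eq_rep_wavefun: "l2_eq (rep_wavefun \<psi>) (rep_wavefun \<psi>)"
  using Quotient_rep_reflp[OF Quotient_wavefun] .

lemma square_integrable_rep_wavefun: "square_integrable (rep_wavefun \<psi>)"
  using l2_eq_rep_wavefun by (simp add: l2_eq_def)

lemma abs_rep_wavefun: "abs_wavefun (rep_wavefun \<psi>) = \<psi>"
  using Quotient_abs_rep[OF Quotient_wavefun] .

lemma l2_eq_refl: "square_integrable f \<Longrightarrow> l2_eq f f"
  by (simp add: l2_eq_def)

lemma wavefun_cases:
  obtains f where "square_integrable f" "\<psi> = abs_wavefun f"
  using square_integrable_rep_wavefun abs_rep_wavefun by metis

lemma abs_wavefun_eq_iff:
  assumes "square_integrable f" "square_integrable g"
  shows "abs_wavefun f = abs_wavefun g \<longleftrightarrow> (AE x in lborel. f x = g x)"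
  using Quotient_rel_abs2[OF Quotient_wavefun] Quotient_rel[OF Quotient_wavefun, of f g] assms
  by (auto simp: l2_eq_def)

lemma cinner_abs_wavefun:
  assumes "square_integrable f" "square_integrable g"
  shows "cinner (abs_wavefun f) (abs_wavefun g) = (LINT x|lborel. cnj (f x) * g x)"
  using assms by (simp add: cinner.abs_eq l2_eq_refl)

lemma norm_abs_wavefun:
  assumes "square_integrable f"
  shows "(norm (abs_wavefun f))\<^sup>2 = (LINT x|lborel. (cmod (f x))\<^sup>2)"
  using cinner_abs_wavefun[OF assms assms] unfolding LINT_cnj_mult_self cinner_self
  by (simp only: of_real_eq_iff)

lemma plus_abs_wavefun:
  assumes "square_integrable f" "square_integrable g"
  shows "abs_wavefun f + abs_wavefun g = abs_wavefun (\<lambda>x. f x + g x)"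
  using assms by (simp add: plus_wavefun.abs_eq l2_eq_refl)

lemma scaleC_abs_wavefun:
  assumes "square_integrable f"
  shows "c *\<^sub>C abs_wavefun f = abs_wavefun (\<lambda>x. c * f x)"
  using assms by (simp add: scaleC.abs_eq l2_eq_refl)

lemma minus_abs_wavefun:
  assumes "square_integrable f" "square_integrable g"
  shows "abs_wavefun f - abs_wavefun g = abs_wavefun (\<lambda>x. f x - g x)"
  using assms square_integrable_cmult[OF assms(2), of "- 1"]
  by (simp add: minus_wavefun_def uminus_wavefun_def scaleC_abs_wavefun plus_abs_wavefun)

lemma square_integrable_diff:
  assumes "square_integrable f" "square_integrable g"
  shows "square_integrable (\<lambda>x. f x - g x)"
  using square_integrable_add[OF assms(1) square_integrable_cmult[OF assms(2), of "- 1"]] by simp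

lemma sum_abs_wavefun:
  assumes "\<And>i. i \<in> A \<Longrightarrow> square_integrable (f i)"
  shows "square_integrable (\<lambda>x. \<Sum>i\<in>A. f i x)"
    and "(\<Sum>i\<in>A. abs_wavefun (f i)) = abs_wavefun (\<lambda>x. \<Sum>i\<in>A. f i x)"
  using assms
  by (induction A rule: infinite_finite_induct)
    (simp_all add: square_integrable_zero zero_wavefun.abs_eq square_integrable_add plus_abs_wavefun zero_wavefun_def)

lemma square_integrable_nn_integral:
  assumes "square_integrable f"
  shows "(\<integral>\<^sup>+x. ennreal ((cmod (f x))\<^sup>2) \<partial>lborel) = ennreal ((norm (abs_wavefun f))\<^sup>2)"
  using assms unfolding norm_abs_wavefun[OF assms]
  by (intro nn_integral_eq_integral) (auto simp: square_integrable_def)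

lemma square_integrable_nn_integralI:
  assumes "f \<in> borel_measurable lborel" "(\<integral>\<^sup>+x. ennreal ((cmod (f x))\<^sup>2) \<partial>lborel) < \<infinity>"
  shows "square_integrable f"
  using assms unfolding square_integrable_def by (intro conjI integrableI_nonneg) auto

subsection \<open>Completeness\<close>

text \<open>Riesz-Fischer argument. The increments \<open>d n\<close> have squared norm at most
  \<open>(1/4)^n\<close>, so the sum of \<open>2^n * |d n|^2\<close> is still integrable and hence
  finite almost everywhere. Since \<open>|d n| <= 2^n * |d n|^2 + (1/2)^n\<close>, the increments
  are absolutely summable pointwise, and Fatou bounds the distance to the pointwise limit.\<close>

lemma L2_Cauchy_limit:
  fixes f :: "nat \<Rightarrow> real \<Rightarrow> complex"
  assumes f: "\<And>n. square_integrable (f n)"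
    and fast: "\<And>m n. n \<le> m \<Longrightarrow> norm (abs_wavefun (f m) - abs_wavefun (f n)) \<le> (1 / 2) ^ n"
  obtains g where "square_integrable g"
    "\<And>n. norm (abs_wavefun g - abs_wavefun (f n)) \<le> (1 / 2) ^ n"
proof -
  have [measurable]: "f n \<in> borel_measurable lborel" for n
    using f by (simp add: square_integrable_def)
  define d where "d n x = f (Suc n) x - f n x" for n x
  have [measurable]: "d n \<in> borel_measurable lborel" for n
    unfolding d_def by measurable
  have dnorm: "(\<integral>\<^sup>+x. ennreal ((cmod (f m x - f n x))\<^sup>2) \<partial>lborel) \<le> ennreal ((1 / 4) ^ n)"
    if "n \<le> m" for m n
  proof -
    have "(norm (abs_wavefun (f m) - abs_wavefun (f n)))\<^sup>2 \<le> ((1 / 2) ^ n)\<^sup>2"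
      by (intro power_mono fast that norm_ge_zero)
    also have "((1 / 2) ^ n)\<^sup>2 = (1 / 4 :: real) ^ n"
      by (simp add: power_divide power2_eq_square flip: power_mult_distrib)
    finally show ?thesis
      unfolding minus_abs_wavefun[OF f f] square_integrable_nn_integral[OF square_integrable_diff[OF f f]]
      by (rule ennreal_leI)
  qed
  have "(\<integral>\<^sup>+x. (\<Sum>n. ennreal (2 ^ n * (cmod (d n x))\<^sup>2)) \<partial>lborel)
      = (\<Sum>n. \<integral>\<^sup>+x. ennreal (2 ^ n * (cmod (d n x))\<^sup>2) \<partial>lborel)"
    by (rule nn_integral_suminf) measurable
  also have "\<dots> \<le> (\<Sum>n. ennreal ((1 / 2) ^ n))"
  proof (rule suminf_le)
    fix n
    have "(\<integral>\<^sup>+x. ennreal (2 ^ n * (cmod (d n x))\<^sup>2) \<partial>lborel) =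
        ennreal (2 ^ n) * (\<integral>\<^sup>+x. ennreal ((cmod (d n x))\<^sup>2) \<partial>lborel)"
      by (simp add: ennreal_mult nn_integral_cmult)
    also have "\<dots> \<le> ennreal (2 ^ n) * ennreal ((1 / 4) ^ n)"
      unfolding d_def by (intro mult_left_mono dnorm) auto
    also have "\<dots> = ennreal ((1 / 2) ^ n)"
      by (simp flip: ennreal_mult power_mult_distrib)
    finally show "(\<integral>\<^sup>+x. ennreal (2 ^ n * (cmod (d n x))\<^sup>2) \<partial>lborel) \<le> ennreal ((1 / 2) ^ n)" .
  qed auto
  also have "\<dots> = ennreal 2"
    by (subst suminf_ennreal2) (simp_all add: suminf_geometric)
  finally have "AE x in lborel. (\<Sum>n. ennreal (2 ^ n * (cmod (d n x))\<^sup>2)) \<noteq> \<infinity>"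
    by (intro nn_integral_noteq_infinite) (auto simp: top_unique)
  then have conv: "AE x in lborel. convergent (\<lambda>n. f n x)"
  proof eventually_elim
    fix x assume "(\<Sum>n. ennreal (2 ^ n * (cmod (d n x))\<^sup>2)) \<noteq> \<infinity>"
    then have "summable (\<lambda>n. 2 ^ n * (cmod (d n x))\<^sup>2)"
      by (intro summable_suminf_not_top) auto
    then have "summable (\<lambda>n. 2 ^ n * (cmod (d n x))\<^sup>2 + (1 / 2) ^ n)"
      by (intro summable_add summable_geometric) auto
    moreover have "norm (d n x) \<le> 2 ^ n * (cmod (d n x))\<^sup>2 + (1 / 2) ^ n" for n
    proof -
      define a where "a = cmod (d n x)"
      have "0 \<le> (2 ^ n * a - 1)\<^sup>2 + 2 ^ n * a"
        by (simp add: a_def)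
      also have "\<dots> = 2 ^ n * (2 ^ n * a\<^sup>2 + (1 / 2) ^ n - a)"
        by (simp add: power2_eq_square algebra_simps power_divide)
      finally show ?thesis
        using zero_le_mult_iff[of "2 ^ n" "2 ^ n * a\<^sup>2 + (1 / 2) ^ n - a"] zero_less_power[of "2 :: real" n]
        unfolding a_def by linarith
    qed
    ultimately have "summable (\<lambda>n. d n x)"
      by (rule summable_comparison_test'[of _ 0])
    then have "convergent (\<lambda>n. \<Sum>k<n. d k x)"
      by (simp only: summable_iff_convergent)
    moreover have "(\<Sum>k<n. d k x) = f n x - f 0 x" for n
      unfolding d_def by (rule sum_lessThan_telescope)
    ultimately have "convergent (\<lambda>n. (f n x - f 0 x) + f 0 x)"
      by (intro convergent_add convergent_const) simp
    then show "convergent (\<lambda>n. f n x)"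
      by simp
  qed
  define g where "g x = lim (\<lambda>n. f n x)" for x
  have [measurable]: "g \<in> borel_measurable lborel"
    unfolding g_def by (rule borel_measurable_lim_metric) measurable
  have est: "(\<integral>\<^sup>+x. ennreal ((cmod (g x - f n x))\<^sup>2) \<partial>lborel) \<le> ennreal ((1 / 4) ^ n)" for n
  proof -
    have "(\<integral>\<^sup>+x. ennreal ((cmod (g x - f n x))\<^sup>2) \<partial>lborel) =
       (\<integral>\<^sup>+x. liminf (\<lambda>m. ennreal ((cmod (f m x - f n x))\<^sup>2)) \<partial>lborel)"
    proof (rule nn_integral_cong_AE)
      show "AE x in lborel. ennreal ((cmod (g x - f n x))\<^sup>2) =
         liminf (\<lambda>m. ennreal ((cmod (f m x - f n x))\<^sup>2))"
        using conv
      proof eventually_elim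
        fix x assume "convergent (\<lambda>n. f n x)"
        then have "(\<lambda>n. f n x) \<longlonglongrightarrow> g x"
          by (simp add: g_def convergent_LIMSEQ_iff)
        then have "(\<lambda>m. ennreal ((cmod (f m x - f n x))\<^sup>2)) \<longlonglongrightarrow> ennreal ((cmod (g x - f n x))\<^sup>2)"
          by (intro tendsto_intros)
        then show "ennreal ((cmod (g x - f n x))\<^sup>2) = liminf (\<lambda>m. ennreal ((cmod (f m x - f n x))\<^sup>2))"
          by (metis lim_imp_Liminf sequentially_bot)
      qed
    qed
    also have "\<dots> \<le> liminf (\<lambda>m. \<integral>\<^sup>+x. ennreal ((cmod (f m x - f n x))\<^sup>2) \<partial>lborel)"
      by (intro nn_integral_liminf) measurable
    also have "\<dots> \<le> ennreal ((1 / 4) ^ n)"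
    proof -
      have "liminf (\<lambda>m. \<integral>\<^sup>+x. ennreal ((cmod (f m x - f n x))\<^sup>2) \<partial>lborel) \<le> liminf (\<lambda>m. ennreal ((1 / 4) ^ n))"
        by (intro Liminf_mono eventually_sequentiallyI[of n] dnorm)
      then show ?thesis
        by (simp add: Liminf_const)
    qed
    finally show ?thesis .
  qed
  have "square_integrable (\<lambda>x. g x - f 0 x)"
  proof (rule square_integrable_nn_integralI)
    show "(\<integral>\<^sup>+x. ennreal ((cmod (g x - f 0 x))\<^sup>2) \<partial>lborel) < \<infinity>"
      using est[of 0] by (rule le_less_trans) simp
  qed measurable
  from square_integrable_add[OF this f[of 0]] have g: "square_integrable g"
    by simp
  moreover have "norm (abs_wavefun g - abs_wavefun (f n)) \<le> (1 / 2) ^ n" for n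
  proof -
    have "ennreal ((norm (abs_wavefun g - abs_wavefun (f n)))\<^sup>2) \<le> ennreal ((1 / 4) ^ n)"
      using est[of n] unfolding minus_abs_wavefun[OF g f]
        square_integrable_nn_integral[OF square_integrable_diff[OF g f]] .
    then have "(norm (abs_wavefun g - abs_wavefun (f n)))\<^sup>2 \<le> (1 / 4) ^ n"
      by (simp add: ennreal_le_iff)
    also have "(1 / 4 :: real) ^ n = ((1 / 2) ^ n)\<^sup>2"
      by (simp add: power_divide power2_eq_square flip: power_mult_distrib)
    finally show ?thesis
      by (rule power2_le_imp_le) simp
  qed
  ultimately show thesis
    using that by blast
qed

instance wavefun :: banach
proof
  fix X :: "nat \<Rightarrow> wavefun" assume X: "Cauchy X"
  have "\<exists>M. \<forall>m\<ge>M. \<forall>n\<ge>M. norm (X m - X n) < (1 / 2) ^ k" for k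
    by (rule CauchyD[OF X]) simp
  then obtain M where M: "\<And>k m n. m \<ge> M k \<Longrightarrow> n \<ge> M k \<Longrightarrow> norm (X m - X n) < (1 / 2) ^ k"
    by metis
  \<comment> \<open>Partial sums make the indices monotone in \<open>k\<close> while still
    dominating \<open>M k\<close>, so \<open>X (r k)\<close> is a rapidly convergent
    subsequence.\<close>
  define r where "r k = (\<Sum>i\<le>k. M i)" for k
  have rM: "M k \<le> r k" for k
    unfolding r_def by (rule member_le_sum) auto
  have r_mono: "r k \<le> r l" if "k \<le> l" for k l
    unfolding r_def using that by (intro sum_mono2) auto
  have fast: "norm (X (r m) - X (r n)) \<le> (1 / 2) ^ n" if "n \<le> m" for m n
    using M[of n "r m" "r n"] rM[of n] r_mono[OF that] by force
  obtain g where g: "square_integrable g"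
      "\<And>n. norm (abs_wavefun g - abs_wavefun (rep_wavefun (X (r n)))) \<le> (1 / 2) ^ n"
    using L2_Cauchy_limit[of "\<lambda>n. rep_wavefun (X (r n))"] fast
    by (auto simp: square_integrable_rep_wavefun abs_rep_wavefun)
  have "X \<longlonglongrightarrow> abs_wavefun g"
  proof (rule LIMSEQ_I)
    fix e :: real assume "0 < e"
    then obtain n where n: "(1 / 2) ^ n < e / 2"
      using real_arch_pow_inv[of "e / 2" "1 / 2"] by auto
    have "norm (X m - abs_wavefun g) < e" if "m \<ge> M n" for m
    proof -
      have "norm (X m - X (r n)) < (1 / 2) ^ n"
        by (rule M[OF that rM])
      moreover have "norm (abs_wavefun g - X (r n)) \<le> (1 / 2) ^ n"
        using g(2)[of n] by (simp add: abs_rep_wavefun)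
      ultimately show ?thesis
        using n norm_triangle_ineq4[of "X m - X (r n)" "abs_wavefun g - X (r n)"] by simp
    qed
    then show "\<exists>no. \<forall>m\<ge>no. norm (X m - abs_wavefun g) < e"
      by blast
  qed
  then show "convergent X"
    by (rule convergentI)
qed

section \<open>The Fock basis\<close>

text \<open>A class closed under sums, products, conjugation and multiplication by \<open>x\<close>,
  on which all integrals converge and boundary terms vanish at infinity. It contains the Fock
  functions with their derivatives and also the Gaussians with complex parameters that come up
  later; these decay at different rates, which is why \<open>a\<close> is existentially
  quantified.\<close>

definition gauss_dominated :: "(real \<Rightarrow> complex) \<Rightarrow> bool" where
  "gauss_dominated f \<longleftrightarrow>
     continuous_on UNIV f \<and> (\<exists>a>0. \<exists>C. \<forall>x. cmod (f x) \<le> C * exp (- (a * x\<^sup>2)))"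

lemma gauss_dominatedE:
  assumes "gauss_dominated f"
  obtains a C where "0 < a" "0 \<le> C" "\<And>x. cmod (f x) \<le> C * exp (- (a * x\<^sup>2))"
proof -
  from assms obtain a C where *: "0 < a" "\<And>x. cmod (f x) \<le> C * exp (- (a * x\<^sup>2))"
    by (auto simp: gauss_dominated_def)
  from *(2)[of 0] have "0 \<le> C"
    using norm_ge_zero[of "f 0"] by (simp del: norm_ge_zero)
  with * that show thesis
    by blast
qed

lemma gauss_dominatedI:
  assumes "continuous_on UNIV f" "0 < a" "\<And>x. cmod (f x) \<le> C * exp (- (a * x\<^sup>2))"
  shows "gauss_dominated f"
  using assms by (auto simp: gauss_dominated_def)

lemma gauss_dominated_continuous: "gauss_dominated f \<Longrightarrow> continuous_on UNIV f"
  by (simp add: gauss_dominated_def)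

lemma gauss_dominated_measurable [measurable_dest]: "gauss_dominated f \<Longrightarrow> f \<in> borel_measurable borel"
  by (auto simp: gauss_dominated_def intro: borel_measurable_continuous_onI)

lemma gauss_dominated_add:
  assumes "gauss_dominated f" "gauss_dominated g"
  shows "gauss_dominated (\<lambda>x. f x + g x)"
proof -
  obtain a C where f: "0 < a" "0 \<le> C" "\<And>x. cmod (f x) \<le> C * exp (- (a * x\<^sup>2))"
    using gauss_dominatedE[OF assms(1)] by blast
  obtain b D where g: "0 < b" "0 \<le> D" "\<And>x. cmod (g x) \<le> D * exp (- (b * x\<^sup>2))"
    using gauss_dominatedE[OF assms(2)] by blast
  show ?thesis
  proof (rule gauss_dominatedI)
    show "continuous_on UNIV (\<lambda>x. f x + g x)"
      using assms by (intro continuous_on_add gauss_dominated_continuous)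
    show "0 < min a b"
      using f g by simp
    fix x
    have "cmod (f x + g x) \<le> C * exp (- (a * x\<^sup>2)) + D * exp (- (b * x\<^sup>2))"
      using norm_triangle_ineq[of "f x" "g x"] f(3)[of x] g(3)[of x] by linarith
    also have "\<dots> \<le> C * exp (- (min a b * x\<^sup>2)) + D * exp (- (min a b * x\<^sup>2))"
      using f(2) g(2) by (intro add_mono mult_left_mono) (auto intro!: mult_right_mono)
    finally show "cmod (f x + g x) \<le> (C + D) * exp (- (min a b * x\<^sup>2))"
      by (simp add: algebra_simps)
  qed
qed

lemma gauss_dominated_mult:
  assumes "gauss_dominated f" "gauss_dominated g"
  shows "gauss_dominated (\<lambda>x. f x * g x)"
proof -
  obtain a C where f: "0 < a" "0 \<le> C" "\<And>x. cmod (f x) \<le> C * exp (- (a * x\<^sup>2))"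
    using gauss_dominatedE[OF assms(1)] by blast
  obtain b D where g: "0 < b" "0 \<le> D" "\<And>x. cmod (g x) \<le> D * exp (- (b * x\<^sup>2))"
    using gauss_dominatedE[OF assms(2)] by blast
  show ?thesis
  proof (rule gauss_dominatedI)
    show "continuous_on UNIV (\<lambda>x. f x * g x)"
      using assms by (intro continuous_on_mult gauss_dominated_continuous)
    show "0 < a + b"
      using f g by simp
    fix x
    have "cmod (f x * g x) \<le> (C * exp (- (a * x\<^sup>2))) * (D * exp (- (b * x\<^sup>2)))"
      unfolding norm_mult using f g by (intro mult_mono) auto
    also have "\<dots> = (C * D) * exp (- ((a + b) * x\<^sup>2))"
      by (simp add: distrib_right exp_diff exp_minus divide_inverse)
    finally show "cmod (f x * g x) \<le> (C * D) * exp (- ((a + b) * x\<^sup>2))" .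
  qed
qed

lemma gauss_dominated_cmult:
  assumes "gauss_dominated f"
  shows "gauss_dominated (\<lambda>x. c * f x)"
proof -
  obtain a C where f: "0 < a" "0 \<le> C" "\<And>x. cmod (f x) \<le> C * exp (- (a * x\<^sup>2))"
    using gauss_dominatedE[OF assms] by blast
  show ?thesis
  proof (rule gauss_dominatedI)
    show "continuous_on UNIV (\<lambda>x. c * f x)"
      using assms by (intro continuous_intros gauss_dominated_continuous)
    show "cmod (c * f x) \<le> (cmod c * C) * exp (- (a * x\<^sup>2))" for x
      using mult_left_mono[OF f(3)[of x], of "cmod c"] by (simp add: norm_mult mult.assoc)
  qed (fact f(1))
qed

lemma gauss_dominated_diff:
  assumes "gauss_dominated f" "gauss_dominated g"
  shows "gauss_dominated (\<lambda>x. f x - g x)"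
  using gauss_dominated_add[OF assms(1) gauss_dominated_cmult[OF assms(2), of "- 1"]] by simp

text \<open>Half of the decay rate is spent on the factor: \<open>|x| <= 1 + x^2\<close>, and
  \<open>x^2\<close> is at most a multiple of \<open>exp (a/2 * x^2)\<close>.\<close>

lemma gauss_dominated_of_real_mult:
  assumes "gauss_dominated f"
  shows "gauss_dominated (\<lambda>x. complex_of_real x * f x)"
proof -
  obtain a C where f: "0 < a" "0 \<le> C" "\<And>x. cmod (f x) \<le> C * exp (- (a * x\<^sup>2))"
    using gauss_dominatedE[OF assms] by blast
  show ?thesis
  proof (rule gauss_dominatedI)
    show "continuous_on UNIV (\<lambda>x. complex_of_real x * f x)"
      using assms by (intro continuous_intros gauss_dominated_continuous)
    show "0 < a / 2"
      using f by simp
    fix x :: real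
    have "a / 2 * x\<^sup>2 \<le> exp (a / 2 * x\<^sup>2)"
      using exp_ge_add_one_self[of "a / 2 * x\<^sup>2"] by linarith
    then have "x\<^sup>2 \<le> 2 / a * exp (a / 2 * x\<^sup>2)"
      using f(1) by (simp add: field_simps)
    moreover have "1 \<le> exp (a / 2 * x\<^sup>2)"
      using f(1) by simp
    moreover have "\<bar>x\<bar> \<le> 1 + x\<^sup>2"
      using zero_le_power2[of "\<bar>x\<bar> - 1"] zero_le_power2[of x] by (simp add: power2_eq_square algebra_simps)
    ultimately have "\<bar>x\<bar> \<le> (1 + 2 / a) * exp (a / 2 * x\<^sup>2)"
      unfolding distrib_right by linarith
    then have "\<bar>x\<bar> * cmod (f x) \<le> ((1 + 2 / a) * exp (a / 2 * x\<^sup>2)) * (C * exp (- (a * x\<^sup>2)))"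
      using f by (intro mult_mono) auto
    also have "\<dots> = ((1 + 2 / a) * C) * (exp (a / 2 * x\<^sup>2) * exp (- (a * x\<^sup>2)))"
      by simp
    also have "exp (a / 2 * x\<^sup>2) * exp (- (a * x\<^sup>2)) = exp (- (a / 2 * x\<^sup>2))"
      by (simp flip: exp_add)
    finally show "cmod (complex_of_real x * f x) \<le> ((1 + 2 / a) * C) * exp (- (a / 2 * x\<^sup>2))"
      by (simp add: norm_mult)
  qed
qed

lemma integrable_gauss:
  assumes "0 < a"
  shows "integrable lborel (\<lambda>x::real. exp (- (a * x\<^sup>2)))"
proof -
  have "normal_density 0 (1 / sqrt (2 * a)) x = sqrt (a / pi) * exp (- (a * x\<^sup>2))" for x
    using assms by (simp add: normal_density_def power_divide real_sqrt_divide mult.commute)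
  moreover have "integrable lborel (normal_density 0 (1 / sqrt (2 * a)))"
    using assms by (intro integrable_normal_density) simp
  ultimately have "integrable lborel (\<lambda>x. sqrt (a / pi) * exp (- (a * x\<^sup>2)))"
    by presburger
  from integrable_mult_right[OF this, of "sqrt (pi / a)"] show ?thesis
    using assms by (simp add: mult.assoc[symmetric] flip: real_sqrt_mult)
qed

lemma gauss_dominated_integrable:
  assumes "gauss_dominated f"
  shows "integrable lborel f"
proof -
  obtain a C where f: "0 < a" "0 \<le> C" "\<And>x. cmod (f x) \<le> C * exp (- (a * x\<^sup>2))"
    using gauss_dominatedE[OF assms] by blast
  show ?thesis
  proof (rule Bochner_Integration.integrable_bound)
    show "integrable lborel (\<lambda>x. C * exp (- (a * x\<^sup>2)))"
      using f by (intro integrable_mult_right integrable_gauss)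
    show "f \<in> borel_measurable lborel"
      using gauss_dominated_measurable[OF assms] by simp
  qed (use f in \<open>auto simp: abs_mult\<close>)
qed

lemma gauss_dominated_cnj:
  assumes "gauss_dominated f"
  shows "gauss_dominated (\<lambda>x. cnj (f x))"
  using assms by (auto simp: gauss_dominated_def intro!: continuous_intros)

lemma gauss_dominated_square_integrable:
  assumes "gauss_dominated f"
  shows "square_integrable f"
  unfolding square_integrable_def
proof
  show "f \<in> borel_measurable lborel"
    using gauss_dominated_measurable[OF assms] by simp
  have "integrable lborel (\<lambda>x. Re (f x * cnj (f x)))"
    by (intro integrable_Re gauss_dominated_integrable gauss_dominated_mult gauss_dominated_cnj assms)
  then show "integrable lborel (\<lambda>x. (cmod (f x))\<^sup>2)"
    by (simp flip: complex_norm_square)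
qed

lemma gauss_dominated_tendsto_zero:
  assumes "gauss_dominated f"
  shows "(f \<longlongrightarrow> 0) at_top" "(f \<longlongrightarrow> 0) at_bot"
proof -
  obtain a C where f: "0 < a" "0 \<le> C" "\<And>x. cmod (f x) \<le> C * exp (- (a * x\<^sup>2))"
    using gauss_dominatedE[OF assms] by blast
  have "((\<lambda>x::real. C * exp (- (a * x\<^sup>2))) \<longlongrightarrow> 0) at_top"
       "((\<lambda>x::real. C * exp (- (a * x\<^sup>2))) \<longlongrightarrow> 0) at_bot"
    using f(1) by real_asymp+
  then show "(f \<longlongrightarrow> 0) at_top" "(f \<longlongrightarrow> 0) at_bot"
    using f(3) by (auto intro!: Lim_null_comparison[where g = "\<lambda>x. C * exp (- (a * x\<^sup>2))"])
qed

lemma gauss_dominated_integral_deriv: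
  assumes "gauss_dominated f" "gauss_dominated f'"
    and "\<And>x. (f has_vector_derivative f' x) (at x)"
  shows "(LINT x|lborel. f' x) = 0"
proof -
  have "(LBINT x=-\<infinity>..\<infinity>. f' x) = 0 - 0"
  proof (rule interval_integral_FTC_integrable)
    show "isCont f' x" for x
      using gauss_dominated_continuous[OF assms(2)] by (simp add: continuous_on_eq_continuous_at)
    show "set_integrable lborel (einterval (- \<infinity>) \<infinity>) f'"
      using gauss_dominated_integrable[OF assms(2)] by (simp add: set_integrable_def)
    show "((f \<circ> real_of_ereal) \<longlongrightarrow> 0) (at_right (- \<infinity>))"
      using gauss_dominated_tendsto_zero(2)[OF assms(1)] by (simp add: ereal_tendsto_simps)
    show "((f \<circ> real_of_ereal) \<longlongrightarrow> 0) (at_left \<infinity>)"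
      using gauss_dominated_tendsto_zero(1)[OF assms(1)] by (simp add: ereal_tendsto_simps)
  qed (use assms(3) in auto)
  then show ?thesis
    by (simp add: interval_lebesgue_integral_def set_lebesgue_integral_def)
qed

lemma gauss_dominated_gauss: "gauss_dominated (\<lambda>x. complex_of_real (exp (- (x\<^sup>2) / 2)))"
  by (rule gauss_dominatedI[where a = "1 / 2" and C = 1]) (auto intro!: continuous_intros)

lemma gauss_dominated_poly:
  "gauss_dominated (\<lambda>x. complex_of_real (poly p x * exp (- (x\<^sup>2) / 2)))"
proof (induction p)
  case 0
  show ?case
    using gauss_dominated_cmult[OF gauss_dominated_gauss, of 0] by simp
next
  case (pCons c p)
  have "gauss_dominated (\<lambda>x. complex_of_real c * complex_of_real (exp (- (x\<^sup>2) / 2)) +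
      complex_of_real x * complex_of_real (poly p x * exp (- (x\<^sup>2) / 2)))"
    by (intro gauss_dominated_add gauss_dominated_cmult gauss_dominated_gauss
        gauss_dominated_of_real_mult pCons)
  then show ?case
    by (simp add: algebra_simps)
qed

lemma gauss_dominated_fock_fun: "gauss_dominated (\<lambda>x. complex_of_real (fock_fun n x))"
  using fock_fun_poly[of n] gauss_dominated_poly by auto

section \<open>Ladder relations and orthonormality of the Hermite functions\<close>

lemma fock_fun_has_real_derivative: "(fock_fun n has_real_derivative deriv (fock_fun n) x) (at x)"
proof -
  obtain p where p: "fock_fun n = (\<lambda>x. poly p x * exp (- (x\<^sup>2) / 2))"
    using fock_fun_poly by blast
  have "(fock_fun n has_real_derivative (poly (pderiv p) x - x * poly p x) * exp (- (x\<^sup>2) / 2)) (at x)"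
    unfolding p by (auto intro!: derivative_eq_intros simp: algebra_simps)
  then show ?thesis
    using DERIV_imp_deriv by force
qed

lemma fock_fun_raise: "x * fock_fun n x - deriv (fock_fun n) x = sqrt (2 * real (Suc n)) * fock_fun (Suc n) x"
  by (simp del: of_nat_Suc)

text \<open>Raising is the definition of \<open>fock_fun\<close>; lowering comes by induction from
  the commutation relation, here hidden in the differentiated three-term recurrence. For
  \<open>n = 0\<close> the index \<open>n - 1\<close> is again 0, but its coefficient vanishes; the
  later ladder lemmas rely on the same convention.\<close>

lemma fock_fun_lower: "x * fock_fun n x + deriv (fock_fun n) x = sqrt (2 * real n) * fock_fun (n - 1) x"
proof (induction n arbitrary: x)
  case 0
  have "(fock_fun 0 has_real_derivative - x * fock_fun 0 x) (at x)"
    by (auto intro!: derivative_eq_intros simp: algebra_simps)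
  then show ?case
    by (simp only: DERIV_imp_deriv) simp
next
  case (Suc n)
  define s where "s = sqrt (2 * real (Suc n))"
  define t where "t = sqrt (2 * real n)"
  have s: "s * s = 2 * real n + 2" "s > 0" and t: "t * t = 2 * real n"
    by (simp_all add: s_def t_def)
  \<comment> \<open>The induction hypothesis eliminates \<open>deriv (fock_fun n)\<close> from the
    definition of \<open>fock_fun (Suc n)\<close>. The resulting three-term recurrence can be
    differentiated without a second derivative of \<open>fock_fun n\<close>.\<close>
  have eq: "fock_fun (Suc n) = (\<lambda>y. (2 * y * fock_fun n y - t * fock_fun (n - 1) y) / s)"
    unfolding fock_fun.simps s_def[symmetric] using Suc by (intro ext) (simp add: t_def field_simps)
  have "(fock_fun (Suc n) has_real_derivative
      (2 * fock_fun n x + 2 * x * deriv (fock_fun n) x - t * deriv (fock_fun (n - 1)) x) / s) (at x)"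
    unfolding eq
    by (intro DERIV_cdivide) (auto intro!: derivative_eq_intros fock_fun_has_real_derivative)
  then have D: "s * deriv (fock_fun (Suc n)) x =
      2 * fock_fun n x + 2 * x * deriv (fock_fun n) x - t * deriv (fock_fun (n - 1)) x"
    using s by (simp only: DERIV_imp_deriv) simp
  have "t * deriv (fock_fun (n - 1)) x = t * x * fock_fun (n - 1) x - t * t * fock_fun n x"
  proof (cases n)
    case (Suc m)
    have "x * fock_fun m x - deriv (fock_fun m) x = t * fock_fun n x"
      using fock_fun_raise[of x m] by (simp only: Suc t_def)
    then show ?thesis
      unfolding Suc diff_Suc_1 by algebra
  qed (simp add: t_def)
  moreover have "t * fock_fun (n - 1) x = x * fock_fun n x + deriv (fock_fun n) x"
    using Suc[of x] by (simp add: t_def)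
  moreover have "s * fock_fun (Suc n) x = x * fock_fun n x - deriv (fock_fun n) x"
    using fock_fun_raise[of x n] by (simp add: s_def del: fock_fun.simps of_nat_Suc)
  ultimately have "s * (x * fock_fun (Suc n) x + deriv (fock_fun (Suc n)) x) = s * (s * fock_fun n x)"
    using D s t by algebra
  then show ?case
    using s by (simp add: s_def del: fock_fun.simps of_nat_Suc)
qed

lemma fock_fun_times: "x * fock_fun n x =
    sqrt (real n / 2) * fock_fun (n - 1) x + sqrt (real (Suc n) / 2) * fock_fun (Suc n) x"
proof -
  have *: "sqrt (2 * r) = 2 * sqrt (r / 2)" for r
    by (simp add: real_sqrt_divide real_sqrt_mult real_div_sqrt field_simps)
  show ?thesis
    using fock_fun_raise[of x n] fock_fun_lower[of x n] unfolding * by linarith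
qed

lemma deriv_fock_fun: "deriv (fock_fun n) x =
    sqrt (real n / 2) * fock_fun (n - 1) x - sqrt (real (Suc n) / 2) * fock_fun (Suc n) x"
proof -
  have *: "sqrt (2 * r) = 2 * sqrt (r / 2)" for r
    by (simp add: real_sqrt_divide real_sqrt_mult real_div_sqrt field_simps)
  show ?thesis
    using fock_fun_raise[of x n] fock_fun_lower[of x n] unfolding * by linarith
qed

lemma fock_eq: "fock n = abs_wavefun (\<lambda>x. complex_of_real (fock_fun n x))"
  by (simp add: fock.abs_eq fock_def)

lemma cinner_fock:
  assumes "square_integrable f"
  shows "cinner (fock n) (abs_wavefun f) = (LINT x|lborel. complex_of_real (fock_fun n x) * f x)"
  unfolding fock_eq by (subst cinner_abs_wavefun) (simp_all add: assms square_integrable_fock_fun)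

lemma has_vector_derivative_of_real_fock_fun:
  "((\<lambda>x. complex_of_real (fock_fun n x)) has_vector_derivative complex_of_real (deriv (fock_fun n) x)) (at x)"
  using has_vector_derivative_of_real[OF fock_fun_has_real_derivative] .

lemma gauss_dominated_deriv_fock_fun: "gauss_dominated (\<lambda>x. complex_of_real (deriv (fock_fun n) x))"
  unfolding deriv_fock_fun of_real_diff of_real_mult
  by (intro gauss_dominated_diff gauss_dominated_cmult gauss_dominated_fock_fun)

lemma fock_parts:
  assumes f: "gauss_dominated f" "gauss_dominated f'" "\<And>x. (f has_vector_derivative f' x) (at x)"
  shows "(LINT x|lborel. complex_of_real (fock_fun n x) * f' x) =
    - (LINT x|lborel. complex_of_real (deriv (fock_fun n) x) * f x)"
proof -
  let ?h = "\<lambda>x. complex_of_real (fock_fun n x)" and ?h' = "\<lambda>x. complex_of_real (deriv (fock_fun n) x)"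
  have "(LINT x|lborel. ?h x * f' x + ?h' x * f x) = 0"
  proof (rule gauss_dominated_integral_deriv)
    show "((\<lambda>x. ?h x * f x) has_vector_derivative ?h x * f' x + ?h' x * f x) (at x)" for x
      by (intro has_vector_derivative_mult has_vector_derivative_of_real_fock_fun f)
  qed (intro gauss_dominated_add gauss_dominated_mult gauss_dominated_fock_fun f
      gauss_dominated_deriv_fock_fun)+
  moreover have "(LINT x|lborel. ?h x * f' x + ?h' x * f x) =
      (LINT x|lborel. ?h x * f' x) + (LINT x|lborel. ?h' x * f x)"
    by (intro Bochner_Integration.integral_add gauss_dominated_integrable gauss_dominated_mult
        gauss_dominated_fock_fun f gauss_dominated_deriv_fock_fun)
  ultimately show ?thesis
    by (simp add: eq_neg_iff_add_eq_0)
qed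

text \<open>The operators \<open>x + d/dx\<close> and \<open>x - d/dx\<close> are sqrt 2 times
  annihilation and creation. Integration by parts moves each onto the Fock function as the other
  one. The identities are stated for functions since these operators are unbounded and not defined
  on all of \<open>wavefun\<close>; they serve both for the Fock functions themselves and for the
  Gaussians below.\<close>

lemma cinner_fock_ladder:
  assumes f: "gauss_dominated f" "gauss_dominated f'" "\<And>x. (f has_vector_derivative f' x) (at x)"
  shows cinner_fock_lower: "cinner (fock n) (abs_wavefun (\<lambda>x. complex_of_real x * f x + f' x)) =
      complex_of_real (sqrt (2 * real (Suc n))) * cinner (fock (Suc n)) (abs_wavefun f)"
    and cinner_fock_raise: "cinner (fock n) (abs_wavefun (\<lambda>x. complex_of_real x * f x - f' x)) =
      complex_of_real (sqrt (2 * real n)) * cinner (fock (n - 1)) (abs_wavefun f)"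
proof -
  let ?h = "\<lambda>x. complex_of_real (fock_fun n x)" and ?h' = "\<lambda>x. complex_of_real (deriv (fock_fun n) x)"
  note dom = gauss_dominated_add gauss_dominated_diff gauss_dominated_mult gauss_dominated_of_real_mult
    gauss_dominated_fock_fun gauss_dominated_deriv_fock_fun f(1,2)
  have "cinner (fock n) (abs_wavefun (\<lambda>x. complex_of_real x * f x + f' x)) =
      (LINT x|lborel. ?h x * (of_real x * f x) + ?h x * f' x)"
    by (subst cinner_fock) (intro gauss_dominated_square_integrable dom, simp add: ring_distribs)
  also have "\<dots> = (LINT x|lborel. ?h x * (of_real x * f x)) - (LINT x|lborel. ?h' x * f x)"
    by (subst Bochner_Integration.integral_add) (intro gauss_dominated_integrable dom, intro gauss_dominated_integrable dom, simp add: fock_parts[OF f])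
  also have "\<dots> = (LINT x|lborel. ?h x * (of_real x * f x) - ?h' x * f x)"
    by (intro Bochner_Integration.integral_diff[symmetric] gauss_dominated_integrable dom)
  also have "(\<lambda>x. ?h x * (of_real x * f x) - ?h' x * f x) =
      (\<lambda>x. complex_of_real (sqrt (2 * real (Suc n))) * (complex_of_real (fock_fun (Suc n) x) * f x))"
  proof
    fix x
    have "?h x * (of_real x * f x) - ?h' x * f x = of_real (x * fock_fun n x - deriv (fock_fun n) x) * f x"
      by (simp add: algebra_simps)
    then show "?h x * (of_real x * f x) - ?h' x * f x =
       complex_of_real (sqrt (2 * real (Suc n))) * (complex_of_real (fock_fun (Suc n) x) * f x)"
      unfolding fock_fun_raise by simp
  qed
  finally show "cinner (fock n) (abs_wavefun (\<lambda>x. complex_of_real x * f x + f' x)) =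
      complex_of_real (sqrt (2 * real (Suc n))) * cinner (fock (Suc n)) (abs_wavefun f)"
    by (simp only: cinner_fock[OF gauss_dominated_square_integrable[OF f(1)]] integral_mult_right_zero)
  have "cinner (fock n) (abs_wavefun (\<lambda>x. complex_of_real x * f x - f' x)) =
      (LINT x|lborel. ?h x * (of_real x * f x) - ?h x * f' x)"
    by (subst cinner_fock) (intro gauss_dominated_square_integrable dom, simp add: ring_distribs)
  also have "\<dots> = (LINT x|lborel. ?h x * (of_real x * f x)) + (LINT x|lborel. ?h' x * f x)"
    by (subst Bochner_Integration.integral_diff) (intro gauss_dominated_integrable dom, intro gauss_dominated_integrable dom, simp add: fock_parts[OF f])
  also have "\<dots> = (LINT x|lborel. ?h x * (of_real x * f x) + ?h' x * f x)"
    by (intro Bochner_Integration.integral_add[symmetric] gauss_dominated_integrable dom)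
  also have "(\<lambda>x. ?h x * (of_real x * f x) + ?h' x * f x) =
      (\<lambda>x. complex_of_real (sqrt (2 * real n)) * (complex_of_real (fock_fun (n - 1) x) * f x))"
  proof
    fix x
    have "?h x * (of_real x * f x) + ?h' x * f x = of_real (x * fock_fun n x + deriv (fock_fun n) x) * f x"
      by (simp add: algebra_simps)
    then show "?h x * (of_real x * f x) + ?h' x * f x =
       complex_of_real (sqrt (2 * real n)) * (complex_of_real (fock_fun (n - 1) x) * f x)"
      unfolding fock_fun_lower by simp
  qed
  finally show "cinner (fock n) (abs_wavefun (\<lambda>x. complex_of_real x * f x - f' x)) =
      complex_of_real (sqrt (2 * real n)) * cinner (fock (n - 1)) (abs_wavefun f)"
    by (simp only: cinner_fock[OF gauss_dominated_square_integrable[OF f(1)]] integral_mult_right_zero)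
qed

lemma cinner_fock_zero_zero: "cinner (fock 0) (fock 0) = 1"
proof -
  have "normal_density 0 (1 / sqrt 2) x = fock_fun 0 x * fock_fun 0 x" for x
  proof -
    have "pi powr (- 1 / 4) * pi powr (- 1 / 4) = 1 / sqrt pi"
      by (simp add: powr_minus_divide powr_half_sqrt flip: powr_add)
    moreover have "exp (- (x\<^sup>2) / 2) * exp (- (x\<^sup>2) / 2) = exp (- (x\<^sup>2))"
      by (simp flip: exp_add)
    ultimately show ?thesis
      by (simp add: normal_density_def power_divide algebra_simps)
  qed
  moreover have "(LINT x|lborel. normal_density 0 (1 / sqrt 2) x) = 1"
    by (rule integral_normal_density) simp
  ultimately have "(LINT x|lborel. fock_fun 0 x * fock_fun 0 x) = 1"
    by simp
  then have "(LINT x|lborel. complex_of_real (fock_fun 0 x * fock_fun 0 x)) = 1"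
    by (simp only: integral_complex_of_real) simp
  then show ?thesis
    by (subst (2) fock_eq, subst cinner_fock) (simp_all add: square_integrable_fock_fun del: fock_fun.simps)
qed

text \<open>Annihilation applied to \<open>fock m\<close> can be evaluated on either side of the
  inner product; this lowers both indices at once and reduces orthonormality to the vacuum row and
  column.\<close>

lemma cinner_fock_Suc_fock:
  "complex_of_real (sqrt (real (Suc n))) * cinner (fock (Suc n)) (fock m) =
   complex_of_real (sqrt (real m)) * cinner (fock n) (fock (m - 1))"
proof -
  have "complex_of_real (sqrt (2 * real (Suc n))) * cinner (fock (Suc n)) (fock m) =
     cinner (fock n) (abs_wavefun (\<lambda>x. complex_of_real x * complex_of_real (fock_fun m x) +
       complex_of_real (deriv (fock_fun m) x)))"
    unfolding fock_eq[of m]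
    by (intro cinner_fock_lower[symmetric] gauss_dominated_fock_fun gauss_dominated_deriv_fock_fun
        has_vector_derivative_of_real_fock_fun)
  also have "(\<lambda>x. complex_of_real x * complex_of_real (fock_fun m x) + complex_of_real (deriv (fock_fun m) x)) =
     (\<lambda>x. complex_of_real (sqrt (2 * real m)) * complex_of_real (fock_fun (m - 1) x))"
    by (intro ext) (simp only: fock_fun_lower flip: of_real_mult of_real_add)
  also have "abs_wavefun \<dots> = complex_of_real (sqrt (2 * real m)) *\<^sub>C fock (m - 1)"
    by (simp only: fock_eq scaleC_abs_wavefun[OF square_integrable_fock_fun])
  finally show ?thesis
    by (simp add: cinner_scaleC_right real_sqrt_mult del: of_nat_Suc)
qed

lemma cinner_fock_fock: "cinner (fock n) (fock m) = (if n = m then 1 else 0)"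
proof (induction n arbitrary: m)
  case 0
  show ?case
  proof (cases m)
    case (Suc k)
    have "cinner (fock m) (fock 0) = 0"
      using cinner_fock_Suc_fock[of k 0] by (simp add: Suc del: of_nat_Suc)
    then show ?thesis
      using Suc by (subst cinner_commute) simp
  qed (simp add: cinner_fock_zero_zero)
next
  case (Suc n)
  show ?case
  proof (cases m)
    case 0
    then show ?thesis
      using cinner_fock_Suc_fock[of n 0] by (simp del: of_nat_Suc)
  next
    case (Suc k)
    then show ?thesis
      using cinner_fock_Suc_fock[of n m] Suc.IH[of k] by (auto simp del: of_nat_Suc split: if_splits)
  qed
qed

subsection \<open>Completeness of the Fock basis\<close>

lemma gauss_dominated_power_mult:
  assumes "gauss_dominated f"
  shows "gauss_dominated (\<lambda>x. complex_of_real (x ^ k) * f x)"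
proof (induction k)
  case (Suc k)
  from gauss_dominated_of_real_mult[OF this] show ?case
    by (simp add: mult.assoc)
qed (simp add: assms)

lemma integrable_gauss_dominated_mult:
  assumes "gauss_dominated f" "square_integrable g"
  shows "integrable lborel (\<lambda>x. f x * g x)"
  using square_integrable_mult[OF gauss_dominated_square_integrable[OF gauss_dominated_cnj[OF assms(1)]] assms(2)]
  by simp

text \<open>Multiplication by \<open>x\<close> turns a Fock function into a combination of its two
  neighbours, so a power of \<open>x\<close> is removed at the cost of shifting \<open>n\<close>.
  The induction on \<open>k\<close> therefore keeps \<open>n\<close> arbitrary.\<close>

lemma fock_moments_zero:
  assumes f: "square_integrable f" and "\<And>n. cinner (fock n) (abs_wavefun f) = 0"
  shows "(LINT x|lborel. complex_of_real (x ^ k) * complex_of_real (fock_fun n x) * f x) = 0"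
proof (induction k arbitrary: n)
  case 0
  then show ?case
    using assms(2)[of n] by (simp add: cinner_fock f)
next
  case (Suc k)
  let ?I = "\<lambda>n. LINT x|lborel. complex_of_real (x ^ k) * complex_of_real (fock_fun n x) * f x"
  let ?a = "complex_of_real (sqrt (real n / 2))" and ?b = "complex_of_real (sqrt (real (Suc n) / 2))"
  have int: "integrable lborel (\<lambda>x. complex_of_real (x ^ k) * complex_of_real (fock_fun n x) * f x)" for n
    by (intro integrable_gauss_dominated_mult gauss_dominated_power_mult gauss_dominated_fock_fun f)
  have "complex_of_real (x ^ Suc k) * complex_of_real (fock_fun n x) * f x =
      ?a * (complex_of_real (x ^ k) * complex_of_real (fock_fun (n - 1) x) * f x) +
      ?b * (complex_of_real (x ^ k) * complex_of_real (fock_fun (Suc n) x) * f x)" for x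
  proof -
    have "complex_of_real (x ^ Suc k) * complex_of_real (fock_fun n x) * f x =
        complex_of_real (x ^ k) * complex_of_real (x * fock_fun n x) * f x"
      by simp
    then show ?thesis
      unfolding fock_fun_times by (simp add: algebra_simps del: fock_fun.simps)
  qed
  then have "(LINT x|lborel. complex_of_real (x ^ Suc k) * complex_of_real (fock_fun n x) * f x) =
     (LINT x|lborel. ?a * (complex_of_real (x ^ k) * complex_of_real (fock_fun (n - 1) x) * f x) +
      ?b * (complex_of_real (x ^ k) * complex_of_real (fock_fun (Suc n) x) * f x))"
    by presburger
  also have "\<dots> = ?a * ?I (n - 1) + ?b * ?I (Suc n)"
    by (simp only: Bochner_Integration.integral_add integrable_mult_right[OF int] integral_mult_right_zero)
  finally show ?case
    by (simp only: Suc mult_zero_right add_0)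
qed

text \<open>The Fourier integral of \<open>fock_fun 0 * r\<close> is expanded into the exponential
  series, each term of which is a multiple of a vanishing moment. Sum and integral may be exchanged
  because \<open>exp (|t| * |x|) * fock_fun 0\<close> still decays like a Gaussian, so its product
  with the square integrable \<open>r\<close> is a dominating function.\<close>

lemma fourier_zero_if_moments_zero:
  fixes r :: "real \<Rightarrow> real"
  assumes r: "square_integrable (\<lambda>x. complex_of_real (r x))"
    and moments: "\<And>k. (LINT x|lborel. x ^ k * fock_fun 0 x * r x) = 0"
  shows "(CLINT x|lborel. complex_of_real (fock_fun 0 x * r x) * iexp (t * x)) = 0"
proof -
  define h where "h x = fock_fun 0 x * r x" for x
  have [measurable]: "(\<lambda>x. complex_of_real (r x)) \<in> borel_measurable lborel"
    using r by (simp add: square_integrable_def)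
  have "(\<lambda>x. Re (complex_of_real (r x))) \<in> borel_measurable lborel"
    by measurable
  then have [measurable]: "r \<in> borel_measurable lborel"
    by simp
  have [measurable]: "fock_fun 0 \<in> borel_measurable lborel"
    by simp
  have [measurable]: "h \<in> borel_measurable lborel"
    unfolding h_def by measurable
  define S where "S N x = (\<Sum>k<N. (\<i> * of_real (t * x)) ^ k /\<^sub>R fact k) * complex_of_real (h x)" for N x
  have int_real: "integrable lborel (\<lambda>x. x ^ k * fock_fun 0 x * r x)" for k
  proof -
    have "integrable lborel (\<lambda>x. Re (complex_of_real (x ^ k) * complex_of_real (fock_fun 0 x) * complex_of_real (r x)))"
      by (intro integrable_Re integrable_gauss_dominated_mult gauss_dominated_power_mult gauss_dominated_fock_fun r)
    then show ?thesis
      by (simp flip: of_real_mult of_real_power)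
  qed
  have term_eq: "(\<i> * of_real (t * x)) ^ k /\<^sub>R fact k * complex_of_real (h x) =
      ((\<i> * of_real t) ^ k /\<^sub>R fact k) * complex_of_real (x ^ k * fock_fun 0 x * r x)" for k x
    by (simp add: h_def power_mult_distrib del: fock_fun.simps)
  have int_term: "integrable lborel (\<lambda>x. (\<i> * of_real (t * x)) ^ k /\<^sub>R fact k * complex_of_real (h x))" for k
    unfolding term_eq by (intro integrable_mult_right integrable_of_real int_real)
  have zero_term: "(CLINT x|lborel. (\<i> * of_real (t * x)) ^ k /\<^sub>R fact k * complex_of_real (h x)) = 0" for k
    unfolding term_eq integral_mult_right_zero integral_complex_of_real moments by simp
  have "(CLINT x|lborel. S N x) = 0" for N
    unfolding S_def sum_distrib_right
    by (subst Bochner_Integration.integral_sum) (simp_all only: int_term zero_term sum.neutral_const)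
  moreover have "(\<lambda>N. CLINT x|lborel. S N x) \<longlonglongrightarrow> (CLINT x|lborel. iexp (t * x) * complex_of_real (h x))"
  proof (rule integral_dominated_convergence)
    have "gauss_dominated (\<lambda>x. complex_of_real (exp (\<bar>t\<bar> * \<bar>x\<bar>) * fock_fun 0 x))"
    proof (rule gauss_dominatedI)
      show "continuous_on UNIV (\<lambda>x. complex_of_real (exp (\<bar>t\<bar> * \<bar>x\<bar>) * fock_fun 0 x))"
        by (auto intro!: continuous_intros)
      show "(0::real) < 1 / 4"
        by simp
      fix x :: real
      have "\<bar>t\<bar> * \<bar>x\<bar> - x\<^sup>2 / 2 \<le> t\<^sup>2 - x\<^sup>2 / 4"
        using zero_le_power2[of "\<bar>t\<bar> - \<bar>x\<bar> / 2"] by (simp add: power2_diff power_divide)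
      then have "exp (\<bar>t\<bar> * \<bar>x\<bar>) * exp (- (x\<^sup>2) / 2) \<le> exp (t\<^sup>2) * exp (- (1 / 4 * x\<^sup>2))"
        by (simp flip: exp_add)
      then have "pi powr (- 1 / 4) * (exp (\<bar>t\<bar> * \<bar>x\<bar>) * exp (- (x\<^sup>2) / 2)) \<le> pi powr (- 1 / 4) * (exp (t\<^sup>2) * exp (- (1 / 4 * x\<^sup>2)))"
        by (intro mult_left_mono) auto
      then show "cmod (complex_of_real (exp (\<bar>t\<bar> * \<bar>x\<bar>) * fock_fun 0 x)) \<le> (pi powr (- 1 / 4) * exp (t\<^sup>2)) * exp (- (1 / 4 * x\<^sup>2))"
        by (simp add: norm_mult mult_ac)
    qed
    from integrable_gauss_dominated_mult[OF this r]
    have "integrable lborel (\<lambda>x. norm (complex_of_real (exp (\<bar>t\<bar> * \<bar>x\<bar>) * fock_fun 0 x) * complex_of_real (r x)))"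
      by (rule integrable_norm)
    then show "integrable lborel (\<lambda>x. exp (\<bar>t\<bar> * \<bar>x\<bar>) * \<bar>h x\<bar>)"
      by (simp add: h_def norm_mult abs_mult mult.assoc)
    show "AE x in lborel. (\<lambda>N. S N x) \<longlonglongrightarrow> iexp (t * x) * complex_of_real (h x)"
    proof (rule AE_I2)
      fix x
      have "(\<lambda>k. (\<i> * of_real (t * x)) ^ k /\<^sub>R fact k) sums iexp (t * x)"
        by (rule exp_converges)
      then show "(\<lambda>N. S N x) \<longlonglongrightarrow> iexp (t * x) * complex_of_real (h x)"
        unfolding S_def sums_def by (intro tendsto_intros)
    qed
    show "AE x in lborel. norm (S N x) \<le> exp (\<bar>t\<bar> * \<bar>x\<bar>) * \<bar>h x\<bar>" for N
    proof (rule AE_I2)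
      fix x
      have "norm (\<Sum>k<N. (\<i> * of_real (t * x)) ^ k /\<^sub>R fact k) \<le> (\<Sum>k<N. (\<bar>t\<bar> * \<bar>x\<bar>) ^ k /\<^sub>R fact k)"
        by (rule order_trans[OF norm_sum]) (simp add: norm_mult norm_power abs_mult)
      also have "\<dots> \<le> exp (\<bar>t\<bar> * \<bar>x\<bar>)"
        unfolding exp_def by (intro sum_le_suminf summable_exp_generic) auto
      finally show "norm (S N x) \<le> exp (\<bar>t\<bar> * \<bar>x\<bar>) * \<bar>h x\<bar>"
        unfolding S_def norm_mult by (auto intro: mult_right_mono)
    qed
    show "S N \<in> borel_measurable lborel" for N
      unfolding S_def by measurable
    show "(\<lambda>x. iexp (t * x) * complex_of_real (h x)) \<in> borel_measurable lborel"
      by measurable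
  qed
  ultimately have "(CLINT x|lborel. iexp (t * x) * complex_of_real (h x)) = 0"
    by (simp only: LIMSEQ_const_iff)
  then show ?thesis
    by (simp only: h_def mult.commute)
qed

lemma real_distribution_density:
  assumes [measurable]: "g \<in> borel_measurable lborel" and "\<And>x. 0 \<le> g x" "integrable lborel g" "(LINT x|lborel. g x) = 1"
  shows "real_distribution (density lborel (\<lambda>x. ennreal (g x)))"
proof -
  have "(\<integral>\<^sup>+x. ennreal (g x) \<partial>lborel) = 1"
    using assms by (subst nn_integral_eq_integral) auto
  then have "prob_space (density lborel (\<lambda>x. ennreal (g x)))"
    by (intro prob_spaceI) (simp add: emeasure_density)
  then show ?thesis
    by (simp add: real_distribution_def real_distribution_axioms_def)
qed

lemma char_density:
  assumes [measurable]: "g \<in> borel_measurable lborel" and "\<And>x. 0 \<le> g x"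
  shows "char (density lborel (\<lambda>x. ennreal (g x))) t = (CLINT x|lborel. complex_of_real (g x) * iexp (t * x))"
  unfolding char_def using assms by (subst integral_density) (auto simp: scaleR_conv_of_real)

text \<open>Levy's uniqueness theorem speaks of probability measures, so \<open>h\<close> is split
  into positive and negative part. The transform at 0 shows that both have the same mass; if it were
  positive, the normalized parts would be densities with the same characteristic function.\<close>

lemma AE_zero_if_fourier_zero:
  fixes h :: "real \<Rightarrow> real"
  assumes h: "integrable lborel h"
    and fourier: "\<And>t. (CLINT x|lborel. complex_of_real (h x) * iexp (t * x)) = 0"
  shows "AE x in lborel. h x = 0"
proof -
  note [measurable] = borel_measurable_integrable[OF h]
  define p n where "p x = max 0 (h x)" and "n x = max 0 (- h x)" for x
  have pn: "integrable lborel p" "integrable lborel n" "\<And>x. 0 \<le> p x" "\<And>x. 0 \<le> n x" "\<And>x. h x = p x - n x"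
    unfolding p_def n_def using h by auto
  note [measurable] = borel_measurable_integrable[OF pn(1)] borel_measurable_integrable[OF pn(2)]
  have int: "integrable lborel (\<lambda>x. complex_of_real (g x) * iexp (t * x))" if "integrable lborel g" for g t
  proof (rule Bochner_Integration.integrable_bound[OF that])
    show "(\<lambda>x. complex_of_real (g x) * iexp (t * x)) \<in> borel_measurable lborel"
      using borel_measurable_integrable[OF that] by measurable
  qed (simp add: norm_mult)
  have char_eq: "(CLINT x|lborel. complex_of_real (p x) * iexp (t * x)) = (CLINT x|lborel. complex_of_real (n x) * iexp (t * x))" for t
    using fourier[of t] unfolding pn(5) of_real_diff left_diff_distrib
      Bochner_Integration.integral_diff[OF int[OF pn(1)] int[OF pn(2)]]
    by (simp only: eq_iff_diff_eq_0[symmetric])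
  define m where "m = (LINT x|lborel. p x)"
  have m: "(LINT x|lborel. n x) = m"
    using char_eq[of 0] by (simp add: m_def)
  have "0 \<le> m"
    unfolding m_def by (intro Bochner_Integration.integral_nonneg pn)
  have "m = 0"
  proof (rule ccontr)
    assume "m \<noteq> 0"
    with \<open>0 \<le> m\<close> have "0 < m"
      by simp
    define P N where "P = density lborel (\<lambda>x. ennreal (p x / m))" and "N = density lborel (\<lambda>x. ennreal (n x / m))"
    have "P = N"
    proof (rule Levy_uniqueness)
      show "real_distribution P"
        unfolding P_def using pn \<open>0 < m\<close> by (intro real_distribution_density) (auto simp: m_def)
      show "real_distribution N"
        unfolding N_def using pn m \<open>0 < m\<close> by (intro real_distribution_density) auto
      show "char P = char N"
      proof
        fix t
        have "char P t = (CLINT x|lborel. complex_of_real (p x) * iexp (t * x) / complex_of_real m)"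
          unfolding P_def using pn \<open>0 < m\<close> by (subst char_density) auto
        also have "\<dots> = (CLINT x|lborel. complex_of_real (n x) * iexp (t * x) / complex_of_real m)"
          unfolding Bochner_Integration.integral_divide_zero char_eq ..
        also have "\<dots> = char N t"
          unfolding N_def using pn \<open>0 < m\<close> by (subst char_density) auto
        finally show "char P t = char N t" .
      qed
    qed
    \<comment> \<open>The two measures, now known to be equal, are told apart on the set where
      \<open>h\<close> is positive: it carries all of \<open>P\<close> and nothing of
      \<open>N\<close>.\<close>
    define A where "A = {x. 0 < h x}"
    have [measurable]: "A \<in> sets lborel"
      unfolding A_def by measurable
    have "emeasure P A = (\<integral>\<^sup>+x. ennreal (p x / m) \<partial>lborel)"
      unfolding P_def by (subst emeasure_density) (auto simp: A_def p_def intro!: nn_integral_cong split: split_indicator)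
    also have "\<dots> = ennreal (LINT x|lborel. p x / m)"
      using pn \<open>0 < m\<close> by (intro nn_integral_eq_integral) auto
    also have "\<dots> = 1"
      using \<open>0 < m\<close> by (simp add: m_def)
    finally have "emeasure P A = 1" .
    moreover have "emeasure N A = (\<integral>\<^sup>+x. ennreal (n x / m) * indicator A x \<partial>lborel)"
      unfolding N_def by (rule emeasure_density) measurable
    moreover have "(\<integral>\<^sup>+x. ennreal (n x / m) * indicator A x \<partial>lborel) = (\<integral>\<^sup>+x. 0 \<partial>(lborel :: real measure))"
      by (intro nn_integral_cong) (auto simp: A_def n_def split: split_indicator)
    ultimately show False
      using \<open>P = N\<close> by simp
  qed
  then have "AE x in lborel. p x = 0" "AE x in lborel. n x = 0"
    using integral_nonneg_eq_0_iff_AE[of lborel p] integral_nonneg_eq_0_iff_AE[of lborel n] pn m m_def by auto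
  then show ?thesis
    by eventually_elim (simp add: pn(5))
qed

lemma AE_zero_if_moments_zero:
  fixes r :: "real \<Rightarrow> real"
  assumes r: "square_integrable (\<lambda>x. complex_of_real (r x))"
    and moments: "\<And>k. (LINT x|lborel. x ^ k * fock_fun 0 x * r x) = 0"
  shows "AE x in lborel. r x = 0"
proof -
  have "integrable lborel (\<lambda>x. Re (complex_of_real (fock_fun 0 x) * complex_of_real (r x)))"
    by (intro integrable_Re integrable_gauss_dominated_mult gauss_dominated_fock_fun r)
  then have "integrable lborel (\<lambda>x. fock_fun 0 x * r x)"
    by (simp flip: of_real_mult)
  from AE_zero_if_fourier_zero[OF this fourier_zero_if_moments_zero[OF assms]]
  show ?thesis
    by eventually_elim simp
qed

text \<open>Vanishing Fock coefficients make all moments of \<open>fock_fun 0 * f\<close> vanish.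
  The Fock functions are real, so real and imaginary part of \<open>f\<close> can be treated
  separately, and the weight \<open>fock_fun 0\<close> has no zeros that could hide a part of
  \<open>f\<close>.\<close>

lemma fock_complete:
  assumes "\<And>n. cinner (fock n) \<psi> = 0"
  shows "\<psi> = 0"
proof -
  obtain f where f: "square_integrable f" and \<psi>: "\<psi> = abs_wavefun f"
    by (rule wavefun_cases)
  have [measurable]: "f \<in> borel_measurable lborel"
    using f by (simp add: square_integrable_def)
  have le: "(cmod (complex_of_real (Re (f x))))\<^sup>2 \<le> (cmod (f x))\<^sup>2"
    "(cmod (complex_of_real (Im (f x))))\<^sup>2 \<le> (cmod (f x))\<^sup>2" for x
    by (simp_all add: cmod_power2)
  have int: "integrable lborel (\<lambda>x. (cmod (f x))\<^sup>2)"
    using f by (simp add: square_integrable_def)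
  have moments: "(LINT x|lborel. complex_of_real (x ^ k * fock_fun 0 x) * f x) = 0" for k
    using fock_moments_zero[OF f, of k 0] assms \<psi> by (simp del: fock_fun.simps)
  have int': "integrable lborel (\<lambda>x. complex_of_real (x ^ k * fock_fun 0 x) * f x)" for k
    using integrable_gauss_dominated_mult[OF gauss_dominated_power_mult[OF gauss_dominated_fock_fun[of 0]] f, of k]
    by (simp del: fock_fun.simps)
  have "AE x in lborel. Re (f x) = 0"
  proof (rule AE_zero_if_moments_zero)
    show "square_integrable (\<lambda>x. complex_of_real (Re (f x)))"
      by (rule square_integrable_bound[OF _ int le(1)]) measurable
    show "(LINT x|lborel. x ^ k * fock_fun 0 x * Re (f x)) = 0" for k
      using integral_Re[OF int', of k] unfolding moments by (simp del: fock_fun.simps)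
  qed
  moreover have "AE x in lborel. Im (f x) = 0"
  proof (rule AE_zero_if_moments_zero)
    show "square_integrable (\<lambda>x. complex_of_real (Im (f x)))"
      by (rule square_integrable_bound[OF _ int le(2)]) measurable
    show "(LINT x|lborel. x ^ k * fock_fun 0 x * Im (f x)) = 0" for k
      using integral_Im[OF int', of k] unfolding moments by (simp del: fock_fun.simps)
  qed
  ultimately have "AE x in lborel. f x = 0"
    by eventually_elim (simp add: complex_eq_iff)
  then show ?thesis
    using f by (simp add: \<psi> zero_wavefun_def abs_wavefun_eq_iff square_integrable_zero)
qed

section \<open>Fock expansion and Parseval identities\<close>

lemma fock_eqI: "(\<And>n. cinner (fock n) f = cinner (fock n) g) \<Longrightarrow> f = g"
  using fock_complete[of "f - g"] by (simp add: cinner_diff_right)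

lemma cinner_fock_fock_sum: "cinner (fock k) (\<Sum>n\<in>A. c n *\<^sub>C fock n) = (if k \<in> A \<and> finite A then c k else 0)"
  by (cases "finite A") (simp_all add: cinner_sum_right cinner_scaleC_right cinner_fock_fock if_distrib[of "\<lambda>x. _ * x"] sum.delta' cong: if_cong)

text \<open>The injection \<open>g\<close> allows for shifted families such as
  \<open>fock (n - 1)\<close> and \<open>fock (Suc n)\<close>, which arise from the ladder
  operators.\<close>

lemma norm_fock_sum:
  assumes "finite A" "inj_on g A"
  shows "(norm (\<Sum>n\<in>A. c n *\<^sub>C fock (g n)))\<^sup>2 = (\<Sum>n\<in>A. (cmod (c n))\<^sup>2)"
proof -
  have *: "cinner (c n *\<^sub>C fock (g n)) (\<Sum>m\<in>A. c m *\<^sub>C fock (g m)) = complex_of_real ((cmod (c n))\<^sup>2)" if "n \<in> A" for n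
  proof -
    have "cinner (c n *\<^sub>C fock (g n)) (\<Sum>m\<in>A. c m *\<^sub>C fock (g m)) =
        (\<Sum>m\<in>A. if n = m then c m * cnj (c n) else 0)"
      unfolding cinner_sum_right
      using that assms by (intro sum.cong refl)
        (simp add: cinner_scaleC_right cinner_scaleC_left cinner_fock_fock inj_on_eq_iff)
    then show ?thesis
      using that assms by (simp add: sum.delta flip: complex_norm_square)
  qed
  have "complex_of_real ((norm (\<Sum>n\<in>A. c n *\<^sub>C fock (g n)))\<^sup>2) = (\<Sum>n\<in>A. complex_of_real ((cmod (c n))\<^sup>2))"
    unfolding cinner_self[symmetric] by (subst cinner_sum_left) (intro sum.cong refl *)
  then show ?thesis
    by (simp only: of_real_sum[symmetric] of_real_eq_iff)
qed

lemma summable_fock: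
  assumes "summable (\<lambda>n. (cmod (c n))\<^sup>2)"
  shows "summable (\<lambda>n. c n *\<^sub>C fock n)"
  unfolding summable_Cauchy
proof (intro allI impI)
  fix e :: real assume "0 < e"
  then obtain N where N: "\<And>m n. m \<ge> N \<Longrightarrow> norm (\<Sum>k=m..<n. (cmod (c k))\<^sup>2) < e\<^sup>2"
    using assms unfolding summable_Cauchy by (meson zero_less_power)
  have "norm (\<Sum>k=m..<n. c k *\<^sub>C fock k) < e" if "m \<ge> N" for m n
  proof -
    have "(norm (\<Sum>k=m..<n. c k *\<^sub>C fock k))\<^sup>2 = (\<Sum>k=m..<n. (cmod (c k))\<^sup>2)"
      using norm_fock_sum[of "{m..<n}" "\<lambda>x. x" c] by simp
    also have "\<dots> < e\<^sup>2"
      using N[OF that, of n] by (simp add: sum_nonneg)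
    finally show ?thesis
      using \<open>0 < e\<close> by (simp add: power2_less_imp_less)
  qed
  then show "\<exists>N. \<forall>m\<ge>N. \<forall>n. norm (\<Sum>k=m..<n. c k *\<^sub>C fock k) < e"
    by blast
qed

lemma cinner_fock_suminf:
  assumes "summable (\<lambda>n. (cmod (c n))\<^sup>2)"
  shows "cinner (fock k) (\<Sum>n. c n *\<^sub>C fock n) = c k"
proof -
  have "(\<lambda>N. \<Sum>n<N. c n *\<^sub>C fock n) \<longlonglongrightarrow> (\<Sum>n. c n *\<^sub>C fock n)"
    using summable_LIMSEQ[OF summable_fock[OF assms]] .
  then have "(\<lambda>N. cinner (fock k) (\<Sum>n<N. c n *\<^sub>C fock n)) \<longlonglongrightarrow> cinner (fock k) (\<Sum>n. c n *\<^sub>C fock n)"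
    by (rule tendsto_cinner_right)
  moreover have "(\<lambda>N. cinner (fock k) (\<Sum>n<N. c n *\<^sub>C fock n)) \<longlonglongrightarrow> c k"
    by (rule tendsto_eventually, rule eventually_sequentiallyI[of "Suc k"]) (simp add: cinner_fock_fock_sum)
  ultimately show ?thesis
    by (rule LIMSEQ_unique)
qed

lemma bessel: "(\<Sum>n<N. (cmod (cinner (fock n) \<psi>))\<^sup>2) \<le> (norm \<psi>)\<^sup>2"
proof -
  define g where "g = (\<Sum>n<N. cinner (fock n) \<psi> *\<^sub>C fock n)"
  have g: "(norm g)\<^sup>2 = (\<Sum>n<N. (cmod (cinner (fock n) \<psi>))\<^sup>2)"
    unfolding g_def using norm_fock_sum[of "{..<N}" "\<lambda>x. x"] by simp
  have "cinner g \<psi> = (\<Sum>n<N. complex_of_real ((cmod (cinner (fock n) \<psi>))\<^sup>2))"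
    unfolding g_def cinner_sum_left cinner_scaleC_left
    by (intro sum.cong refl) (simp only: complex_norm_square mult.commute)
  then have "g \<bullet> \<psi> = (norm g)\<^sup>2"
    by (simp add: inner_wavefun_def g)
  then have "(norm g)\<^sup>2 \<le> norm g * norm \<psi>"
    using norm_cauchy_schwarz[of g \<psi>] by simp
  then have "norm g \<le> norm \<psi>"
    by (cases "norm g = 0") (simp_all add: power2_eq_square)
  then show ?thesis
    using g power_mono[of "norm g" "norm \<psi>" 2] by simp
qed

lemma summable_fock_coeff: "summable (\<lambda>n. (cmod (cinner (fock n) \<psi>))\<^sup>2)"
  by (rule summableI_nonneg_bounded[OF _ bessel]) simp

lemma fock_expansion: "(\<lambda>n. cinner (fock n) \<psi> *\<^sub>C fock n) sums \<psi>"
proof -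
  have "(\<Sum>n. cinner (fock n) \<psi> *\<^sub>C fock n) = \<psi>"
    by (rule fock_eqI) (rule cinner_fock_suminf[OF summable_fock_coeff])
  then show ?thesis
    using summable_sums[OF summable_fock[OF summable_fock_coeff[of \<psi>]]] by simp
qed

lemma parseval: "(\<lambda>n. cinner f (fock n) * cinner (fock n) g) sums cinner f g"
proof -
  have "(\<lambda>N. cinner f (\<Sum>n<N. cinner (fock n) g *\<^sub>C fock n)) \<longlonglongrightarrow> cinner f g"
    using fock_expansion[of g] unfolding sums_def by (rule tendsto_cinner_right)
  then show ?thesis
    unfolding sums_def by (simp add: cinner_sum_right cinner_scaleC_right mult.commute)
qed

lemma parseval_norm: "(\<lambda>n. (cmod (cinner (fock n) f))\<^sup>2) sums (norm f)\<^sup>2"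
proof -
  have "cinner f (fock n) * cinner (fock n) f = complex_of_real ((cmod (cinner (fock n) f))\<^sup>2)" for n
    using cinner_commute[of f "fock n"] by (simp only: complex_norm_square mult.commute)
  then have "(\<lambda>n. complex_of_real ((cmod (cinner (fock n) f))\<^sup>2)) sums complex_of_real ((norm f)\<^sup>2)"
    using parseval[of f f] by (simp only: cinner_self)
  then show ?thesis
    by (simp only: sums_of_real_iff)
qed

section \<open>Quadrature projectors\<close>

lemma cinner_fock_phase_rotation:
  "cinner (fock n) (phase_rotation t \<psi>) = cis (t * real n) * cinner (fock n) \<psi>"
  unfolding phase_rotation_def
  by (rule cinner_fock_suminf) (simp add: norm_mult summable_fock_coeff)

lemma norm_phase_rotation: "norm (phase_rotation t \<psi>) = norm \<psi>"
proof -
  have "(norm (phase_rotation t \<psi>))\<^sup>2 = (norm \<psi>)\<^sup>2"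
    using parseval_norm[of "phase_rotation t \<psi>"] parseval_norm[of \<psi>]
    by (intro sums_unique2[of "\<lambda>n. (cmod (cinner (fock n) \<psi>))\<^sup>2"])
      (simp_all add: cinner_fock_phase_rotation norm_mult)
  then show ?thesis
    by simp
qed

lemma energy_phase_rotation: "energy (phase_rotation t \<psi>) = energy \<psi>"
  by (simp add: energy_def cinner_fock_phase_rotation norm_mult)

lemma cinner_phase_rotation: "cinner f (phase_rotation t g) = cinner (phase_rotation (- t) f) g"
proof (rule sums_unique2[OF _ parseval])
  have "cinner (phase_rotation (- t) f) (fock n) * cinner (fock n) g =
      cinner f (fock n) * cinner (fock n) (phase_rotation t g)" for n
    using cinner_commute[of "phase_rotation (- t) f" "fock n"] cinner_commute[of f "fock n"]
    by (simp add: cinner_fock_phase_rotation cis_cnj)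
  then show "(\<lambda>n. cinner (phase_rotation (- t) f) (fock n) * cinner (fock n) g) sums cinner f (phase_rotation t g)"
    using parseval[of f "phase_rotation t g"] by simp
qed

lemma position_projector_abs:
  assumes "B \<in> sets borel" "square_integrable f"
  shows "position_projector B (abs_wavefun f) = abs_wavefun (\<lambda>x. indicator B x * f x)"
  using assms by (simp add: position_projector.abs_eq l2_eq_refl)

lemma cinner_position_projector:
  assumes "B \<in> sets borel"
  shows "cinner f (position_projector B g) = cinner (position_projector B f) g"
proof -
  obtain f' where f: "square_integrable f'" "f = abs_wavefun f'"
    by (rule wavefun_cases)
  obtain g' where g: "square_integrable g'" "g = abs_wavefun g'"
    by (rule wavefun_cases)
  have *: "cnj (f' x) * (indicator B x * g' x) = cnj (indicator B x * f' x) * g' x" for x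
    by (simp add: indicator_def)
  show ?thesis
    by (simp only: f g assms position_projector_abs cinner_abs_wavefun square_integrable_indicator *)
qed

lemma position_projector_idem:
  assumes "B \<in> sets borel"
  shows "position_projector B (position_projector B g) = position_projector B g"
proof -
  obtain g' where g: "square_integrable g'" "g = abs_wavefun g'"
    by (rule wavefun_cases)
  have *: "(\<lambda>x. indicator B x * (indicator B x * g' x)) = (\<lambda>x. indicator B x * g' x)"
    by (auto simp: indicator_def)
  show ?thesis
    by (simp only: g assms position_projector_abs square_integrable_indicator *)
qed

lemma norm_position_projector_abs:
  assumes "B \<in> sets borel" "square_integrable f"
  shows "(norm (position_projector B (abs_wavefun f)))\<^sup>2 = (LINT x:B|lborel. (cmod (f x))\<^sup>2)"
proof -
  have "(cmod (indicator B x * f x))\<^sup>2 = indicator B x *\<^sub>R (cmod (f x))\<^sup>2" for x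
    by (simp add: indicator_def)
  then show ?thesis
    by (simp add: assms position_projector_abs norm_abs_wavefun square_integrable_indicator set_lebesgue_integral_def)
qed

lemma position_projector_diff:
  assumes "B \<in> sets borel"
  shows "position_projector B (f - g) = position_projector B f - position_projector B g"
proof -
  obtain f' where f: "square_integrable f'" "f = abs_wavefun f'"
    by (rule wavefun_cases)
  obtain g' where g: "square_integrable g'" "g = abs_wavefun g'"
    by (rule wavefun_cases)
  show ?thesis
    by (simp add: f g assms position_projector_abs minus_abs_wavefun square_integrable_diff square_integrable_indicator right_diff_distrib)
qed

lemma norm_position_projector_le:
  assumes "B \<in> sets borel"
  shows "norm (position_projector B f) \<le> norm f"
proof -
  have "complex_of_real ((norm (position_projector B f))\<^sup>2) = cinner f (position_projector B f)"
    using assms cinner_position_projector[of B f "position_projector B f"]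
    by (simp add: position_projector_idem cinner_self)
  then have "(norm (position_projector B f))\<^sup>2 = cmod (cinner f (position_projector B f))"
    by (metis abs_of_nonneg norm_of_real zero_le_power2)
  also have "\<dots> \<le> norm f * norm (position_projector B f)"
    by (rule cinner_Cauchy_Schwarz)
  finally show ?thesis
    by (cases "norm (position_projector B f) = 0") (simp_all add: power2_eq_square)
qed

lemma cinner_quadrature_projector:
  assumes "B \<in> sets borel"
  shows "cinner f (quadrature_projector \<theta> B g) = cinner (quadrature_projector \<theta> B f) g"
  using assms by (simp add: quadrature_projector_def cinner_phase_rotation cinner_position_projector)

lemma norm_quadrature_projector_le:
  assumes "B \<in> sets borel"
  shows "norm (quadrature_projector \<theta> B f) \<le> norm f"
  using norm_position_projector_le[OF assms, of "phase_rotation \<theta> f"]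
  by (simp add: quadrature_projector_def norm_phase_rotation)

lemma cinner_quadrature_projector_self:
  assumes "B \<in> sets borel"
  shows "cinner \<psi> (quadrature_projector \<theta> B \<psi>) =
    complex_of_real ((norm (position_projector B (phase_rotation \<theta> \<psi>)))\<^sup>2)"
  using assms cinner_position_projector[OF assms, of "phase_rotation \<theta> \<psi>" "position_projector B (phase_rotation \<theta> \<psi>)"]
  by (simp add: quadrature_projector_def cinner_phase_rotation position_projector_idem cinner_self)

text \<open>\<open>op_trace\<close> is a \<open>suminf\<close>, whose value means nothing for a
  divergent series. This relation asserts convergence along with the value, so it can be added and
  scaled; the passage to \<open>expval\<close> comes only with the trace norm limit.\<close>

definition has_trace :: "qop \<Rightarrow> (wavefun \<Rightarrow> wavefun) \<Rightarrow> real \<Rightarrow> bool" where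
  "has_trace A W v \<longleftrightarrow> (\<lambda>n. cinner (fock n) (blinfun_apply A (W (fock n)))) sums complex_of_real v"

text \<open>With \<open>W\<close> the projector, the terms of the trace are
  \<open><W \<psi>, n> <n, \<psi>>\<close>, which Parseval sums to
  \<open><W \<psi>, \<psi>>\<close>, the squared norm of the projected rotated vector.\<close>

lemma has_trace_pure_state:
  assumes "B \<in> sets borel"
  shows "has_trace (pure_state \<psi>) (quadrature_projector \<theta> B)
    ((norm (position_projector B (phase_rotation \<theta> \<psi>)))\<^sup>2)"
proof -
  have "cinner (fock n) (blinfun_apply (pure_state \<psi>) (quadrature_projector \<theta> B (fock n))) =
      cinner (quadrature_projector \<theta> B \<psi>) (fock n) * cinner (fock n) \<psi>" for n
    by (simp add: pure_state.rep_eq cinner_scaleC_right cinner_quadrature_projector assms)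
  then show ?thesis
    using parseval[of "quadrature_projector \<theta> B \<psi>" \<psi>]
    unfolding has_trace_def cinner_quadrature_projector[OF assms, symmetric] cinner_quadrature_projector_self[OF assms]
    by (simp add: cinner_quadrature_projector assms)
qed

section \<open>The trace norm bounds traces\<close>

text \<open>Stated for plain maps, so that the remainders of the Cholesky factorization qualify
  without being packaged as bounded operators. Additivity, which is built into \<open>qop\<close>,
  has to be demanded here.\<close>

definition psd :: "(wavefun \<Rightarrow> wavefun) \<Rightarrow> bool" where
  "psd Q \<longleftrightarrow> (\<forall>f g. Q (f + g) = Q f + Q g) \<and> (\<forall>c f. Q (c *\<^sub>C f) = c *\<^sub>C Q f) \<and>
     (\<forall>f. cinner f (Q f) \<in> \<real>\<^sub>\<ge>\<^sub>0)"

lemma psdD: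
  assumes "psd Q"
  shows psd_add: "Q (f + g) = Q f + Q g" and psd_scaleC: "Q (c *\<^sub>C f) = c *\<^sub>C Q f"
    and psd_Im: "Im (cinner f (Q f)) = 0" and psd_Re: "0 \<le> Re (cinner f (Q f))"
  using assms by (auto simp: psd_def complex_nonneg_Reals_iff)

lemma psd_diff: "psd Q \<Longrightarrow> Q (f - g) = Q f - Q g"
  using psd_add[of Q f "- g"] psd_scaleC[of Q "- 1" g] by (simp add: uminus_eq_scaleC[symmetric])

lemma psd_self: "psd Q \<Longrightarrow> cinner f (Q f) = complex_of_real (Re (cinner f (Q f)))"
  by (simp add: complex_eq_iff psd_Im)

text \<open>Polarization: the form is real at \<open>f + g\<close> and at \<open>f + i g\<close>,
  which gives the imaginary and the real part of the symmetry relation.\<close>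

lemma psd_hermitian:
  assumes "psd Q"
  shows "cinner f (Q g) = cinner (Q f) g"
proof -
  have "Im (cinner (f + g) (Q (f + g))) = 0" "Im (cinner (f + \<i> *\<^sub>C g) (Q (f + \<i> *\<^sub>C g))) = 0"
    by (rule psd_Im[OF assms])+
  then have "cinner f (Q g) = cnj (cinner g (Q f))"
    using psd_Im[OF assms, of f] psd_Im[OF assms, of g]
    by (simp add: psd_add[OF assms] psd_scaleC[OF assms] cinner_add_left cinner_add_right
        cinner_scaleC_left cinner_scaleC_right complex_eq_iff)
  then show ?thesis
    using cinner_commute[of "Q f" g] by simp
qed

text \<open>The form is nonnegative at \<open>f - c g\<close> with \<open>c = t * cnj z\<close>,
  where it is a real quadratic polynomial in \<open>t\<close>. Its minimizer
  \<open>t = 1 / b\<close> gives the claim when \<open>b\<close> is positive.\<close>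

lemma psd_Cauchy_Schwarz:
  assumes "psd Q"
  shows "(cmod (cinner f (Q g)))\<^sup>2 \<le> Re (cinner f (Q f)) * Re (cinner g (Q g))"
proof -
  define z where "z = cinner f (Q g)"
  define a b where "a = Re (cinner f (Q f))" and "b = Re (cinner g (Q g))"
  have ab: "cinner f (Q f) = of_real a" "cinner g (Q g) = of_real b" "0 \<le> a" "0 \<le> b"
    unfolding a_def b_def using assms by (rule psd_self psd_Re)+
  have z': "cinner g (Q f) = cnj z"
    unfolding z_def psd_hermitian[OF assms, of f g] by (rule cinner_commute)
  have nonneg: "0 \<le> a - 2 * t * (cmod z)\<^sup>2 + t\<^sup>2 * (cmod z)\<^sup>2 * b" for t
  proof -
    define c where "c = of_real t * cnj z"
    have "cinner (f - c *\<^sub>C g) (Q (f - c *\<^sub>C g)) = of_real a - c * z - cnj c * cnj z + cnj c * c * of_real b"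
      by (simp add: psd_diff[OF assms] psd_scaleC[OF assms] cinner_diff_left cinner_diff_right
        cinner_scaleC_left cinner_scaleC_right ab z' z_def[symmetric] algebra_simps)
    also have "\<dots> = of_real a - 2 * of_real t * (z * cnj z) + (of_real t)\<^sup>2 * (z * cnj z) * of_real b"
      by (simp add: c_def power2_eq_square)
    also have "\<dots> = of_real (a - 2 * t * (cmod z)\<^sup>2 + t\<^sup>2 * (cmod z)\<^sup>2 * b)"
      unfolding complex_norm_square[symmetric] by simp
    finally show ?thesis
      using psd_Re[OF assms, of "f - c *\<^sub>C g"] by (simp only: Re_complex_of_real)
  qed
  have "(cmod z)\<^sup>2 \<le> a * b"
  proof (cases "b = 0")
    case True
    have "z = 0"
    proof (rule ccontr)
      assume "z \<noteq> 0"
      \<comment> \<open>For \<open>b = 0\<close> the polynomial is linear in \<open>t\<close>, and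
        this choice of \<open>t\<close> gives it the value -1.\<close>
      then show False
        using nonneg[of "(a + 1) / (2 * (cmod z)\<^sup>2)"] ab by (simp add: True)
    qed
    then show ?thesis
      using ab by simp
  next
    case False
    then show ?thesis
      using nonneg[of "1 / b"] ab by (simp add: field_simps power2_eq_square)
  qed
  then show ?thesis
    by (simp add: z_def a_def b_def)
qed

lemma psd_null:
  assumes "psd Q" "Re (cinner h (Q h)) = 0"
  shows "Q h = 0"
  using psd_Cauchy_Schwarz[OF assms(1), of "Q h" h] by (simp add: assms(2) cinner_self)

text \<open>One Cholesky step. Cauchy-Schwarz for \<open>Q\<close> says exactly that
  \<open>|<v, g>|^2 <= <g, Q g>\<close>, so subtracting the rank-one operator of \<open>v\<close>
  preserves positivity. The remainder annihilates \<open>h\<close> and everything that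
  \<open>Q\<close> annihilates. If \<open><h, Q h> = 0\<close>, then \<open>Q h = 0\<close> and
  \<open>v = 0\<close>, in line with division by zero.\<close>

lemma psd_deflate:
  assumes Q: "psd Q" and v: "v = complex_of_real (1 / sqrt (Re (cinner h (Q h)))) *\<^sub>C Q h"
  shows "psd (\<lambda>g. Q g - cinner v g *\<^sub>C v)"
    and "Q h - cinner v h *\<^sub>C v = 0"
    and "Q g = 0 \<Longrightarrow> Q g - cinner v g *\<^sub>C v = 0"
proof -
  define s where "s = Re (cinner h (Q h))"
  have s: "0 \<le> s"
    unfolding s_def by (rule psd_Re[OF Q])
  have vg: "cinner v g = complex_of_real (1 / sqrt s) * cinner h (Q g)" for g
    unfolding v cinner_scaleC_left s_def psd_hermitian[OF Q] by simp
  have le: "(cmod (cinner v g))\<^sup>2 \<le> Re (cinner g (Q g))" for g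
  proof -
    have "(cmod (cinner v g))\<^sup>2 = (cmod (cinner h (Q g)))\<^sup>2 / s"
      unfolding vg norm_mult norm_of_real using s by (simp add: power_mult_distrib power_divide)
    also have "\<dots> \<le> s * Re (cinner g (Q g)) / s"
      using psd_Cauchy_Schwarz[OF Q, of h g] s unfolding s_def by (intro divide_right_mono)
    also have "\<dots> \<le> Re (cinner g (Q g))"
      using psd_Re[OF Q] by simp
    finally show ?thesis .
  qed
  show "psd (\<lambda>g. Q g - cinner v g *\<^sub>C v)"
    unfolding psd_def
  proof (intro conjI allI)
    fix f
    have "cinner f (Q f - cinner v f *\<^sub>C v) = cinner f (Q f) - cinner v f * cnj (cinner v f)"
      by (simp add: cinner_diff_right cinner_scaleC_right cinner_commute[of f v])
    also have "\<dots> = complex_of_real (Re (cinner f (Q f)) - (cmod (cinner v f))\<^sup>2)"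
      by (subst psd_self[OF Q]) (simp only: of_real_diff complex_norm_square)
    finally show "cinner f (Q f - cinner v f *\<^sub>C v) \<in> \<real>\<^sub>\<ge>\<^sub>0"
      using le[of f] by (simp only: nonneg_Reals_of_real_iff diff_ge_0_iff_ge)
  qed (simp_all add: psd_add[OF Q] psd_scaleC[OF Q] cinner_add_right cinner_scaleC_right
      scaleC_add_left scaleC_diff_right scaleC_scaleC)
  have "(cinner v h * complex_of_real (1 / sqrt s)) *\<^sub>C Q h = Q h"
  proof (cases "s = 0")
    case True
    then show ?thesis
      using psd_null[OF Q] by (simp add: s_def)
  next
    case False
    have "cinner v h = complex_of_real (1 / sqrt s * s)"
      unfolding vg by (subst psd_self[OF Q]) (simp only: s_def of_real_mult)
    then show ?thesis
      using False s by (simp flip: of_real_mult)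
  qed
  then show "Q h - cinner v h *\<^sub>C v = 0"
    by (subst (2) v) (simp add: scaleC_scaleC s_def)
  show "Q g - cinner v g *\<^sub>C v = 0" if "Q g = 0"
    by (simp add: vg that)
qed

text \<open>
  A Cholesky factorization of $P$ along the Fock basis replaces the square root of $P$:
  with \<open>u k = cholesky_vec P k\<close> and \<open>v k = P (u k)\<close> one has $P = \sum_k |v_k\rangle\langle v_k|$, and the
  remainder after \<open>k\<close> steps is \<open>P \<circ> deflation P k\<close>.
\<close>

primrec deflation :: "(wavefun \<Rightarrow> wavefun) \<Rightarrow> nat \<Rightarrow> wavefun \<Rightarrow> wavefun" where
  "deflation P 0 = (\<lambda>g. g)"
| "deflation P (Suc k) = (\<lambda>g.
     let h = deflation P k (fock k);
         u = complex_of_real (1 / sqrt (Re (cinner (fock k) (P h)))) *\<^sub>C h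
     in deflation P k g - cinner (P u) g *\<^sub>C u)"

definition cholesky_vec :: "(wavefun \<Rightarrow> wavefun) \<Rightarrow> nat \<Rightarrow> wavefun" where
  "cholesky_vec P k = complex_of_real (1 / sqrt (Re (cinner (fock k) (P (deflation P k (fock k)))))) *\<^sub>C
     deflation P k (fock k)"

lemma deflation_Suc:
  "deflation P (Suc k) g = deflation P k g - cinner (P (cholesky_vec P k)) g *\<^sub>C cholesky_vec P k"
  by (simp add: cholesky_vec_def Let_def)

lemma deflation_eq:
  "deflation P K g = g - (\<Sum>k<K. cinner (P (cholesky_vec P k)) g *\<^sub>C cholesky_vec P k)"
  by (induction K) (simp_all add: deflation_Suc del: deflation.simps(2))

context
  fixes P :: "wavefun \<Rightarrow> wavefun"
  assumes P: "psd P"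
begin

lemma psd_apply_deflation_Suc: "P (deflation P (Suc k) g) =
    P (deflation P k g) - cinner (P (cholesky_vec P k)) g *\<^sub>C P (cholesky_vec P k)"
  by (simp only: deflation_Suc psd_diff[OF P] psd_scaleC[OF P])

lemma psd_apply_deflation:
  "P (deflation P K g) = P g - (\<Sum>k<K. cinner (P (cholesky_vec P k)) g *\<^sub>C P (cholesky_vec P k))"
  by (induction K) (simp_all add: psd_apply_deflation_Suc del: deflation.simps(2))

lemma psd_deflation: "psd (\<lambda>g. P (deflation P k g))"
    and deflation_kills: "j < k \<Longrightarrow> P (deflation P k (fock j)) = 0"
proof (induction k)
  case (Suc k)
  have v: "P (cholesky_vec P k) =
      complex_of_real (1 / sqrt (Re (cinner (fock k) (P (deflation P k (fock k)))))) *\<^sub>C P (deflation P k (fock k))"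
    by (simp add: cholesky_vec_def psd_scaleC[OF P])
  { case 1
    show ?case
      unfolding psd_apply_deflation_Suc using psd_deflate(1)[OF Suc(1) v] . }
  { case 2
    then show ?case
      unfolding psd_apply_deflation_Suc using psd_deflate(2)[OF Suc(1) v] psd_deflate(3)[OF Suc(1) v Suc(2)]
      by (cases "j = k") auto }
qed (use P in simp_all)

lemma deflation_Re: "Re (cinner g (P (deflation P K g))) =
    Re (cinner g (P g)) - (\<Sum>k<K. (cmod (cinner (P (cholesky_vec P k)) g))\<^sup>2)"
proof -
  have "cinner g (P (deflation P K g)) = cinner g (P g) -
      (\<Sum>k<K. complex_of_real ((cmod (cinner (P (cholesky_vec P k)) g))\<^sup>2))"
    unfolding psd_apply_deflation cinner_diff_right cinner_sum_right cinner_scaleC_right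
      complex_norm_square
    by (simp add: cinner_commute[of g])
  then show ?thesis
    by simp
qed

lemma cholesky_sum_le: "(\<Sum>k<K. (cmod (cinner (P (cholesky_vec P k)) g))\<^sup>2) \<le> Re (cinner g (P g))"
  using psd_Re[OF psd_deflation, of g K] unfolding deflation_Re by simp

lemma deflation_Re_le: "Re (cinner g (P (deflation P K g))) \<le> Re (cinner g (P g))"
  unfolding deflation_Re by (simp add: sum_nonneg)

text \<open>Converts the bound on the quadratic form, which every remainder inherits from
  \<open>P\<close>, into a bound on the map itself, by Cauchy-Schwarz at \<open>Q g\<close> and
  \<open>g\<close>.\<close>

lemma psd_bound_norm:
  assumes "psd Q" "\<And>g. Re (cinner g (Q g)) \<le> C * (norm g)\<^sup>2"
  shows "(norm (Q g))\<^sup>2 \<le> C * Re (cinner g (Q g))"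
proof (cases "Q g = 0")
  case True
  then show ?thesis by simp
next
  case False
  have "((norm (Q g))\<^sup>2)\<^sup>2 = (cmod (cinner (Q g) (Q g)))\<^sup>2"
    by (simp add: cinner_self norm_power)
  also have "\<dots> \<le> Re (cinner (Q g) (Q (Q g))) * Re (cinner g (Q g))"
    by (rule psd_Cauchy_Schwarz[OF assms(1)])
  also have "\<dots> \<le> (C * (norm (Q g))\<^sup>2) * Re (cinner g (Q g))"
    by (intro mult_right_mono assms psd_Re)
  finally have "(norm (Q g))\<^sup>2 * (norm (Q g))\<^sup>2 \<le> (norm (Q g))\<^sup>2 * (C * Re (cinner g (Q g)))"
    by (simp add: power2_eq_square mult_ac)
  then show ?thesis
    by (rule mult_left_le_imp_le) (simp add: False)
qed

text \<open>After \<open>K\<close> steps the remainder annihilates the first \<open>K\<close> Fock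
  vectors, so it sees only the tail \<open>r K\<close> of \<open>g\<close>, while the bound
  \<open>C\<close> on it is uniform in \<open>K\<close>. The tail tends to zero.\<close>

lemma apply_deflation_tendsto_zero:
  assumes C: "\<And>g. Re (cinner g (P g)) \<le> C * (norm g)\<^sup>2"
  shows "(\<lambda>K. P (deflation P K g)) \<longlonglongrightarrow> 0"
proof -
  define r where "r K = g - (\<Sum>j<K. cinner (fock j) g *\<^sub>C fock j)" for K
  have Q: "psd (\<lambda>g. P (deflation P K g))" for K
    by (rule psd_deflation)
  have QC: "Re (cinner g (P (deflation P K g))) \<le> C * (norm g)\<^sup>2" for g K
    using deflation_Re_le[of g K] C[of g] by linarith
  have "0 \<le> C"
    using psd_Re[OF P, of "fock 0"] C[of "fock 0"] norm_fock_sum[of "{0}" "\<lambda>x. 0" "\<lambda>_. 1"] by simp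
  have kill: "P (deflation P K (r K)) = P (deflation P K g)" for K
  proof -
    have "P (deflation P K (\<Sum>j<M. cinner (fock j) g *\<^sub>C fock j)) = 0" if "M \<le> K" for M
      using that
      by (induction M) (simp_all add: psd_add[OF Q] psd_scaleC[OF Q] deflation_kills
          psd_scaleC[OF Q, of K 0, simplified])
    then show ?thesis
      by (simp add: r_def psd_diff[OF Q])
  qed
  have bound: "(norm (P (deflation P K g)))\<^sup>2 \<le> C * (C * (norm (r K))\<^sup>2)" for K
  proof -
    have "(norm (P (deflation P K g)))\<^sup>2 \<le> C * Re (cinner (r K) (P (deflation P K (r K))))"
      unfolding kill[symmetric] by (rule psd_bound_norm[OF Q QC])
    also have "\<dots> \<le> C * (C * (norm (r K))\<^sup>2)"
      using QC \<open>0 \<le> C\<close> by (rule mult_left_mono)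
    finally show ?thesis .
  qed
  have "r \<longlonglongrightarrow> g - g"
    unfolding r_def using fock_expansion[of g, unfolded sums_def] by (intro tendsto_intros)
  then have "(\<lambda>K. C * (C * (norm (r K))\<^sup>2)) \<longlonglongrightarrow> C * (C * (norm (g - g))\<^sup>2)"
    by (intro tendsto_intros)
  then have "(\<lambda>K. C * (C * (norm (r K))\<^sup>2)) \<longlonglongrightarrow> 0"
    by simp
  then have "(\<lambda>K. (norm (P (deflation P K g)))\<^sup>2) \<longlonglongrightarrow> 0"
    by (rule Lim_null_comparison[rotated]) (simp add: bound)
  then have "(\<lambda>K. norm (P (deflation P K g))) \<longlonglongrightarrow> 0"
    using tendsto_real_sqrt[of "\<lambda>K. (norm (P (deflation P K g)))\<^sup>2" 0 sequentially] by simp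
  then show ?thesis
    by (rule tendsto_norm_zero_cancel)
qed

end

text \<open>Since the square of \<open>P\<close> is the adjoint of \<open>A\<close> times
  \<open>A\<close>, the norms of \<open>A f\<close> and \<open>P f\<close> agree, which takes the
  place of a polar decomposition: the convergence to zero of \<open>P\<close> on the deflated
  vectors carries over to \<open>A\<close> and decomposes \<open>A g\<close> into the sum of
  \<open><v k, g> A (u k)\<close>, where \<open>A (u k)\<close> and \<open>v k\<close> have the same
  norm. With \<open>W\<close> moved to the other side as the contraction \<open>V\<close>, the
  arithmetic-geometric mean inequality and Bessel bound the contribution of each \<open>k\<close> by
  the squared norm of \<open>v k\<close>. Fixing finitely many \<open>n\<close> makes the limit over
  \<open>K\<close> harmless.\<close>

lemma abs_op_trace_bound:
  assumes A: "\<And>c f. blinfun_apply A (c *\<^sub>C f) = c *\<^sub>C blinfun_apply A f"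
    and P: "is_abs_op A P"
    and W: "\<And>f g. cinner f (W g) = cinner (V f) g" "\<And>f. norm (V f) \<le> norm f"
    and T: "summable (\<lambda>n. Re (cinner (fock n) (blinfun_apply P (fock n))))"
  shows "(\<Sum>n<N. cmod (cinner (fock n) (blinfun_apply A (W (fock n))))) \<le>
    (\<Sum>n. Re (cinner (fock n) (blinfun_apply P (fock n))))"
proof -
  let ?P = "blinfun_apply P"
  have psd: "psd ?P"
    using P by (auto simp: psd_def is_abs_op_def positive_op_def blinfun.add_right)
  have norm_eq: "norm (blinfun_apply A f) = norm (?P f)" for f
  proof -
    have "complex_of_real ((norm (blinfun_apply A f))\<^sup>2) = complex_of_real ((norm (?P f))\<^sup>2)"
      using P psd_hermitian[OF psd, of f "?P f"] by (simp only: is_abs_op_def cinner_self[symmetric])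
    then show ?thesis
      by (simp only: of_real_eq_iff) simp
  qed
  define u where "u k = cholesky_vec ?P k" for k
  define v where "v k = ?P (u k)" for k
  have lim: "(\<lambda>K. ?P (deflation ?P K g)) \<longlonglongrightarrow> 0" for g
  proof (rule apply_deflation_tendsto_zero[OF psd])
    fix g
    have "Re (cinner g (?P g)) \<le> norm g * norm (?P g)"
      using cinner_Cauchy_Schwarz[of g "?P g"] complex_Re_le_cmod[of "cinner g (?P g)"] by linarith
    also have "\<dots> \<le> norm g * (norm P * norm g)"
      by (intro mult_left_mono norm_blinfun) simp
    finally show "Re (cinner g (?P g)) \<le> norm P * (norm g)\<^sup>2"
      by (simp add: power2_eq_square mult_ac)
  qed
  have A_deflation: "blinfun_apply A (deflation ?P K g) =
      blinfun_apply A g - (\<Sum>k<K. cinner (v k) g *\<^sub>C blinfun_apply A (u k))" for K g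
    unfolding deflation_eq u_def v_def by (simp add: blinfun.diff_right blinfun.sum_right A)
  have A_sum: "(\<lambda>K. \<Sum>k<K. cinner (v k) g *\<^sub>C blinfun_apply A (u k)) \<longlonglongrightarrow> blinfun_apply A g" for g
  proof -
    have "(\<lambda>K. norm (blinfun_apply A (deflation ?P K g))) \<longlonglongrightarrow> 0"
      unfolding norm_eq by (rule tendsto_norm_zero[OF lim])
    then have "(\<lambda>K. blinfun_apply A (deflation ?P K g)) \<longlonglongrightarrow> 0"
      by (rule tendsto_norm_zero_cancel)
    from tendsto_diff[OF tendsto_const[of "blinfun_apply A g"] this] show ?thesis
      by (simp add: A_deflation)
  qed
  \<comment> \<open>Parseval writes the left side as a double sum over \<open>n\<close> and
    \<open>k\<close>; for fixed \<open>n\<close> the Cholesky vectors recover at most the diagonal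
    entry of \<open>P\<close>.\<close>
  have vsum: "(\<Sum>k<K. (norm (v k))\<^sup>2) \<le> (\<Sum>n. Re (cinner (fock n) (?P (fock n))))" for K
  proof (rule sums_le)
    show "(\<lambda>n. \<Sum>k<K. (cmod (cinner (fock n) (v k)))\<^sup>2) sums (\<Sum>k<K. (norm (v k))\<^sup>2)"
      by (intro sums_sum parseval_norm)
    show "(\<lambda>n. Re (cinner (fock n) (?P (fock n)))) sums (\<Sum>n. Re (cinner (fock n) (?P (fock n))))"
      using T by (rule summable_sums)
    have "cmod (cinner (fock n) (v k)) = cmod (cinner (v k) (fock n))" for n k
      by (subst cinner_commute) simp
    then show "(\<Sum>k<K. (cmod (cinner (fock n) (v k)))\<^sup>2) \<le> Re (cinner (fock n) (?P (fock n)))" for n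
      using cholesky_sum_le[OF psd, of "fock n" K] by (simp add: v_def u_def)
  qed
  have fin: "(\<Sum>n<N. cmod (cinner (fock n) (\<Sum>k<K. cinner (v k) (W (fock n)) *\<^sub>C blinfun_apply A (u k)))) \<le>
     (\<Sum>n. Re (cinner (fock n) (?P (fock n))))" for K
  proof -
    have "(\<Sum>n<N. cmod (cinner (fock n) (\<Sum>k<K. cinner (v k) (W (fock n)) *\<^sub>C blinfun_apply A (u k)))) \<le>
       (\<Sum>n<N. \<Sum>k<K. cmod (cinner (fock n) (V (v k))) * cmod (cinner (fock n) (blinfun_apply A (u k))))"
    proof (intro sum_mono)
      fix n
      have "cmod (cinner (v k) (W (fock n))) = cmod (cinner (fock n) (V (v k)))" for k
        unfolding W by (subst cinner_commute) simp
      then show "cmod (cinner (fock n) (\<Sum>k<K. cinner (v k) (W (fock n)) *\<^sub>C blinfun_apply A (u k))) \<le>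
         (\<Sum>k<K. cmod (cinner (fock n) (V (v k))) * cmod (cinner (fock n) (blinfun_apply A (u k))))"
        unfolding cinner_sum_right cinner_scaleC_right by (intro sum_norm_le) (simp add: norm_mult)
    qed
    also have "\<dots> = (\<Sum>k<K. \<Sum>n<N. cmod (cinner (fock n) (V (v k))) * cmod (cinner (fock n) (blinfun_apply A (u k))))"
      by (rule sum.swap)
    also have "\<dots> \<le> (\<Sum>k<K. (norm (v k))\<^sup>2)"
    proof (rule sum_mono)
      fix k
      have "(\<Sum>n<N. cmod (cinner (fock n) (V (v k))) * cmod (cinner (fock n) (blinfun_apply A (u k)))) \<le>
         (\<Sum>n<N. ((cmod (cinner (fock n) (V (v k))))\<^sup>2 + (cmod (cinner (fock n) (blinfun_apply A (u k))))\<^sup>2) / 2)"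
      proof (rule sum_mono)
        show "cmod (cinner (fock n) (V (v k))) * cmod (cinner (fock n) (blinfun_apply A (u k))) \<le>
          ((cmod (cinner (fock n) (V (v k))))\<^sup>2 + (cmod (cinner (fock n) (blinfun_apply A (u k))))\<^sup>2) / 2" for n
          using sum_squares_bound[of "cmod (cinner (fock n) (V (v k)))" "cmod (cinner (fock n) (blinfun_apply A (u k)))"]
          by (simp add: mult.assoc)
      qed
      also have "\<dots> = ((\<Sum>n<N. (cmod (cinner (fock n) (V (v k))))\<^sup>2) +
          (\<Sum>n<N. (cmod (cinner (fock n) (blinfun_apply A (u k))))\<^sup>2)) / 2"
        by (simp add: sum.distrib flip: sum_divide_distrib)
      also have "\<dots> \<le> ((norm (V (v k)))\<^sup>2 + (norm (blinfun_apply A (u k)))\<^sup>2) / 2"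
        by (intro divide_right_mono add_mono bessel) simp
      also have "\<dots> \<le> ((norm (v k))\<^sup>2 + (norm (v k))\<^sup>2) / 2"
        unfolding norm_eq v_def[symmetric]
        by (intro divide_right_mono add_mono power_mono W) auto
      finally show "(\<Sum>n<N. cmod (cinner (fock n) (V (v k))) * cmod (cinner (fock n) (blinfun_apply A (u k)))) \<le> (norm (v k))\<^sup>2"
        by simp
    qed
    also have "\<dots> \<le> (\<Sum>n. Re (cinner (fock n) (?P (fock n))))"
      by (rule vsum)
    finally show ?thesis .
  qed
  have "(\<lambda>K. \<Sum>n<N. cmod (cinner (fock n) (\<Sum>k<K. cinner (v k) (W (fock n)) *\<^sub>C blinfun_apply A (u k)))) \<longlonglongrightarrow>
     (\<Sum>n<N. cmod (cinner (fock n) (blinfun_apply A (W (fock n)))))"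
    by (intro tendsto_sum tendsto_norm tendsto_cinner_right A_sum)
  then show ?thesis
    by (rule LIMSEQ_le_const2) (use fin in blast)
qed

text \<open>The finite bound on the infimum also ensures that some \<open>P\<close> exists, since
  over the empty set the infimum would be infinite.\<close>

lemma trace_norm_bound:
  assumes A: "\<And>c f. blinfun_apply A (c *\<^sub>C f) = c *\<^sub>C blinfun_apply A f"
    and lt: "trace_norm A < ennreal e"
    and W: "\<And>f g. cinner f (W g) = cinner (V f) g" "\<And>f. norm (V f) \<le> norm f"
  shows "summable (\<lambda>n. cmod (cinner (fock n) (blinfun_apply A (W (fock n)))))"
    and "(\<Sum>n. cmod (cinner (fock n) (blinfun_apply A (W (fock n))))) \<le> e"
proof -
  obtain P where P: "is_abs_op A P"
    and less: "(\<Sum>n. ennreal (Re (cinner (fock n) (blinfun_apply P (fock n))))) < ennreal e"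
    using lt unfolding trace_norm_def INF_less_iff by blast
  define p where "p = (\<lambda>n. Re (cinner (fock n) (blinfun_apply P (fock n))))"
  have p: "0 \<le> p n" for n
    using P by (auto simp: p_def is_abs_op_def positive_op_def complex_nonneg_Reals_iff)
  have T: "summable p"
    using less p by (intro summable_suminf_not_top) (auto simp: p_def top_unique)
  have "ennreal (suminf p) < ennreal e"
    using less suminf_ennreal2[OF p T] by (simp only: p_def)
  then have le: "suminf p \<le> e"
    using suminf_nonneg[OF T p] by (simp add: ennreal_less_iff)
  note bound = abs_op_trace_bound[OF A P W T[unfolded p_def], folded p_def]
  show S: "summable (\<lambda>n. cmod (cinner (fock n) (blinfun_apply A (W (fock n)))))"
    using bound by (intro summableI_nonneg_bounded[of _ "suminf p"]) auto
  show "(\<Sum>n. cmod (cinner (fock n) (blinfun_apply A (W (fock n))))) \<le> e"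
    using suminf_le_const[OF S bound] le by linarith
qed

text \<open>Convergence of the trace series of \<sigma> is part of the proof: it is the sum of the
  absolutely convergent series of the difference and the convergent series of \<tau>.\<close>

lemma has_trace_close:
  assumes A: "\<And>c f. blinfun_apply \<sigma> (c *\<^sub>C f) = c *\<^sub>C blinfun_apply \<sigma> f"
      "\<And>c f. blinfun_apply \<tau> (c *\<^sub>C f) = c *\<^sub>C blinfun_apply \<tau> f"
    and lt: "trace_norm (\<sigma> - \<tau>) < ennreal e"
    and W: "\<And>f g. cinner f (W g) = cinner (V f) g" "\<And>f. norm (V f) \<le> norm f"
    and \<tau>: "has_trace \<tau> W v"
  shows "\<bar>expval \<sigma> W - v\<bar> \<le> e"
proof -
  let ?d = "\<lambda>n. cinner (fock n) (blinfun_apply (\<sigma> - \<tau>) (W (fock n)))"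
  have d: "cinner (fock n) (blinfun_apply \<sigma> (W (fock n))) = ?d n + cinner (fock n) (blinfun_apply \<tau> (W (fock n)))" for n
    by (simp add: blinfun.diff_left cinner_diff_right)
  have lin: "blinfun_apply (\<sigma> - \<tau>) (c *\<^sub>C f) = c *\<^sub>C blinfun_apply (\<sigma> - \<tau>) f" for c f
    by (simp add: blinfun.diff_left A scaleC_diff_right)
  note bound = trace_norm_bound[OF lin lt W]
  have sd: "summable ?d"
    using bound(1) by (rule summable_norm_cancel)
  have "(\<lambda>n. cinner (fock n) (blinfun_apply \<sigma> (W (fock n)))) sums (suminf ?d + complex_of_real v)"
    unfolding d using \<tau>[unfolded has_trace_def] by (intro sums_add summable_sums[OF sd])
  then have "expval \<sigma> W - v = Re (suminf ?d)"
    by (simp add: expval_def op_trace_def sums_iff)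
  also have "\<bar>\<dots>\<bar> \<le> cmod (suminf ?d)"
    by (rule abs_Re_le_cmod)
  also have "\<dots> \<le> e"
    using summable_norm[OF bound(1)] bound(2) by linarith
  finally show "\<bar>expval \<sigma> W - v\<bar> \<le> e" .
qed

section \<open>Quadrature densities of energy-bounded states\<close>

text \<open>The conditions are chosen to survive convex combinations and limits with the same
  \<open>K\<close>; the moment is a nonnegative integral so that Fatou applies to it. The Hoelder
  bound serves the limits and the upper estimate at the zero of \<open>p\<close>; supremum and
  moment serve the lower estimate for Gaussians.\<close>

definition regular_density :: "real \<Rightarrow> (real \<Rightarrow> real) \<Rightarrow> bool" where
  "regular_density K p \<longleftrightarrow>
     (\<forall>x. 0 \<le> p x \<and> p x \<le> K) \<and> (\<forall>x y. \<bar>p x - p y\<bar> \<le> K * sqrt \<bar>x - y\<bar>) \<and>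
     integrable lborel p \<and> (\<integral>\<^sup>+x. ennreal (x\<^sup>2 * p x) \<partial>lborel) \<le> ennreal K"

lemma regular_densityD:
  assumes "regular_density K p"
  shows "0 \<le> p x" "p x \<le> K" "\<bar>p x - p y\<bar> \<le> K * sqrt \<bar>x - y\<bar>" "integrable lborel p"
    "(\<integral>\<^sup>+x. ennreal (x\<^sup>2 * p x) \<partial>lborel) \<le> ennreal K" "0 \<le> K"
proof -
  show *: "0 \<le> p x" "p x \<le> K" "\<bar>p x - p y\<bar> \<le> K * sqrt \<bar>x - y\<bar>" "integrable lborel p"
    "(\<integral>\<^sup>+x. ennreal (x\<^sup>2 * p x) \<partial>lborel) \<le> ennreal K" for x y
    using assms by (auto simp: regular_density_def)
  show "0 \<le> K"
    using *(1,2)[of 0] by linarith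
qed

lemma hoelder_continuous:
  fixes p :: "real \<Rightarrow> real"
  assumes "\<And>x y. \<bar>p x - p y\<bar> \<le> K * sqrt \<bar>x - y\<bar>"
  shows "continuous_on UNIV p"
  unfolding continuous_on_def
proof
  fix x
  have "((\<lambda>y. K * sqrt \<bar>y - x\<bar>) \<longlongrightarrow> K * sqrt \<bar>x - x\<bar>) (at x)"
    by (intro tendsto_intros)
  then have "((\<lambda>y. p y - p x) \<longlongrightarrow> 0) (at x)"
    by (intro Lim_null_comparison[of "\<lambda>y. p y - p x" "\<lambda>y. K * sqrt \<bar>y - x\<bar>"]) (auto simp: assms)
  then show "(p \<longlongrightarrow> p x) (at x within UNIV)"
    by (simp add: LIM_zero_iff)
qed

lemma regular_density_continuous: "regular_density K p \<Longrightarrow> continuous_on UNIV p"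
  using hoelder_continuous regular_densityD(3) by blast

lemma regular_density_convex:
  assumes "regular_density K p" "regular_density K q" "0 \<le> u" "0 \<le> v" "u + v = 1"
  shows "regular_density K (\<lambda>x. u * p x + v * q x)"
proof -
  note p = regular_densityD[OF assms(1)] and q = regular_densityD[OF assms(2)]
  note [measurable] = borel_measurable_integrable[OF p(4)] borel_measurable_integrable[OF q(4)]
  have K: "u * b + v * b = b" for b :: real
    using assms(5) by (simp flip: distrib_right)
  have "(\<integral>\<^sup>+x. ennreal (x\<^sup>2 * (u * p x + v * q x)) \<partial>lborel) =
      (\<integral>\<^sup>+x. ennreal u * ennreal (x\<^sup>2 * p x) + ennreal v * ennreal (x\<^sup>2 * q x) \<partial>lborel)"
    using assms p q by (intro nn_integral_cong) (simp add: algebra_simps flip: ennreal_mult ennreal_plus)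
  also have "\<dots> = ennreal u * (\<integral>\<^sup>+x. ennreal (x\<^sup>2 * p x) \<partial>lborel) + ennreal v * (\<integral>\<^sup>+x. ennreal (x\<^sup>2 * q x) \<partial>lborel)"
    by (simp add: nn_integral_add nn_integral_cmult)
  also have "\<dots> \<le> ennreal u * ennreal K + ennreal v * ennreal K"
    using p q by (intro add_mono mult_left_mono) auto
  also have "\<dots> = ennreal K"
    using assms p(6) K[of K] by (simp flip: ennreal_mult ennreal_plus)
  finally have moment: "(\<integral>\<^sup>+x. ennreal (x\<^sup>2 * (u * p x + v * q x)) \<partial>lborel) \<le> ennreal K" .
  have hoelder: "\<bar>(u * p x + v * q x) - (u * p y + v * q y)\<bar> \<le> K * sqrt \<bar>x - y\<bar>" for x y
  proof -
    have "\<bar>(u * p x + v * q x) - (u * p y + v * q y)\<bar> = \<bar>u * (p x - p y) + v * (q x - q y)\<bar>"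
      by (simp add: algebra_simps)
    also have "\<dots> \<le> u * \<bar>p x - p y\<bar> + v * \<bar>q x - q y\<bar>"
      using abs_triangle_ineq[of "u * (p x - p y)" "v * (q x - q y)"] assms by (simp add: abs_mult)
    also have "\<dots> \<le> u * (K * sqrt \<bar>x - y\<bar>) + v * (K * sqrt \<bar>x - y\<bar>)"
      using p q assms by (intro add_mono mult_left_mono) auto
    finally show ?thesis
      by (simp only: K)
  qed
  have le: "u * p x + v * q x \<le> K" for x
    using p(2)[of x] q(2)[of x] assms K[of K] mult_left_mono[of "p x" K u] mult_left_mono[of "q x" K v] by linarith
  show ?thesis
    unfolding regular_density_def using moment hoelder le p q assms by auto
qed

text \<open>On an interval of length \<open>h\<close> next to \<open>x\<close> the function stays
  above \<open>|d x| - L * sqrt h\<close> in absolute value, and its integral there is at most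
  \<open>e\<close>.\<close>

lemma hoelder_bound_L1:
  fixes d :: "real \<Rightarrow> real"
  assumes hoelder: "\<And>x y. \<bar>d x - d y\<bar> \<le> L * sqrt \<bar>x - y\<bar>" and "0 \<le> L"
    and d: "integrable lborel d" "(LINT x|lborel. \<bar>d x\<bar>) \<le> e" and "0 < h"
  shows "\<bar>d x\<bar> \<le> e / h + L * sqrt h"
proof -
  let ?c = "\<bar>d x\<bar> - L * sqrt h"
  have "?c * h = (LINT y|lborel. ?c * indicator {x..x + h} y)"
    using \<open>0 < h\<close> by simp
  also have "\<dots> \<le> (LINT y|lborel. \<bar>d y\<bar>)"
  proof (rule integral_mono)
    show "integrable lborel (\<lambda>y. ?c * indicator {x..x + h} y)"
      by (intro integrable_mult_right integrable_real_indicator) (auto simp: emeasure_lborel_Icc_eq)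
    show "integrable lborel (\<lambda>y. \<bar>d y\<bar>)"
      using d by auto
    fix y
    show "?c * indicator {x..x + h} y \<le> \<bar>d y\<bar>"
    proof (cases "y \<in> {x..x + h}")
      case True
      have "\<bar>d x - d y\<bar> \<le> L * sqrt \<bar>x - y\<bar>"
        by (rule hoelder)
      also have "\<dots> \<le> L * sqrt h"
        using True \<open>0 \<le> L\<close> by (intro mult_left_mono) auto
      finally show ?thesis
        using True by simp
    qed simp
  qed
  also have "\<dots> \<le> e"
    by (rule d)
  finally have "?c \<le> e / h"
    using \<open>0 < h\<close> by (simp add: field_simps)
  then show ?thesis
    by simp
qed

text \<open>Testing with the set where \<open>q <= p\<close> and with its complement recovers both
  signs of the difference, hence the factor 2.\<close>

lemma L1_dist_le_of_measures:
  fixes p q :: "real \<Rightarrow> real"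
  assumes p: "integrable lborel p" and q: "integrable lborel q"
    and close: "\<And>B. B \<in> sets borel \<Longrightarrow> \<bar>(LINT x:B|lborel. p x) - (LINT x:B|lborel. q x)\<bar> \<le> e"
  shows "(LINT x|lborel. \<bar>p x - q x\<bar>) \<le> 2 * e"
proof -
  note [measurable] = borel_measurable_integrable[OF p] borel_measurable_integrable[OF q]
  define B where "B = {x. q x \<le> p x}"
  have B: "B \<in> sets borel"
    unfolding B_def by measurable
  have si: "set_integrable lborel A f" if "A \<in> sets borel" "integrable lborel f" for A and f :: "real \<Rightarrow> real"
    using that unfolding set_integrable_def by (intro integrable_mult_indicator) auto
  have d: "(LINT x:A|lborel. p x) - (LINT x:A|lborel. q x) = (LINT x:A|lborel. p x - q x)" if "A \<in> sets borel" for A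
    by (intro set_integral_diff(2)[symmetric] si that p q)
  have "(LINT x|lborel. \<bar>p x - q x\<bar>) =
      (LINT x|lborel. indicator B x *\<^sub>R (p x - q x) - indicator (- B) x *\<^sub>R (p x - q x))"
    by (intro Bochner_Integration.integral_cong) (auto simp: B_def split: split_indicator)
  also have "\<dots> = (LINT x:B|lborel. p x - q x) - (LINT x:- B|lborel. p x - q x)"
    unfolding set_lebesgue_integral_def
    by (intro Bochner_Integration.integral_diff integrable_mult_indicator Bochner_Integration.integrable_diff p q)
      (use B in auto)
  also have "\<dots> \<le> 2 * e"
    using close[of B] close[of "- B"] B d[of B] d[of "- B"] by (simp add: borel_comp)
  finally show ?thesis .
qed

text \<open>
  The common Hoelder bound upgrades the $L^1$ convergence of densities, which is equivalent to the
  uniform convergence of the measures, to pointwise convergence.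
\<close>

lemma regular_density_closed:
  fixes \<mu> :: "real set \<Rightarrow> real"
  assumes approx: "\<And>e. 0 < e \<Longrightarrow> \<exists>p. regular_density K p \<and>
      (\<forall>B\<in>sets borel. \<bar>\<mu> B - (LINT x:B|lborel. p x)\<bar> \<le> e)"
  shows "\<exists>p. regular_density K p \<and> (\<forall>B\<in>sets borel. \<mu> B = (LINT x:B|lborel. p x))"
proof -
  have "\<exists>p. regular_density K p \<and> (\<forall>B\<in>sets borel. \<bar>\<mu> B - (LINT x:B|lborel. p x)\<bar> \<le> 1 / real (Suc n))" for n
    by (rule approx) simp
  then obtain P where P: "\<And>n. regular_density K (P n)"
    "\<And>n B. B \<in> sets borel \<Longrightarrow> \<bar>\<mu> B - (LINT x:B|lborel. P n x)\<bar> \<le> 1 / real (Suc n)"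
    by metis
  note rd = regular_densityD[OF P(1)]
  note [measurable] = borel_measurable_integrable[OF rd(4)]
  have dist: "(LINT x|lborel. \<bar>P m x - P n x\<bar>) \<le> 4 / real (Suc n)" if "n \<le> m" for m n
  proof -
    have "(LINT x|lborel. \<bar>P m x - P n x\<bar>) \<le> 2 * (2 / real (Suc n))"
    proof (rule L1_dist_le_of_measures[OF rd(4) rd(4)])
      fix B :: "real set" assume B: "B \<in> sets borel"
      have "1 / real (Suc m) \<le> 1 / real (Suc n)"
        using that by (intro divide_left_mono) auto
      then have "\<bar>(LINT x:B|lborel. P m x) - (LINT x:B|lborel. P n x)\<bar> \<le> 1 / real (Suc n) + 1 / real (Suc n)"
        using P(2)[OF B, of m] P(2)[OF B, of n] by linarith
      then show "\<bar>(LINT x:B|lborel. P m x) - (LINT x:B|lborel. P n x)\<bar> \<le> 2 / real (Suc n)"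
        by simp
    qed
    then show ?thesis
      by simp
  qed
  have pointwise: "\<bar>P m x - P n x\<bar> \<le> 4 / real (Suc n) / h + 2 * K * sqrt h" if "n \<le> m" "0 < h" for m n x h
  proof (rule hoelder_bound_L1[OF _ _ _ dist])
    show "\<bar>(P m x - P n x) - (P m y - P n y)\<bar> \<le> 2 * K * sqrt \<bar>x - y\<bar>" for x y
      using rd(3)[of m x y] rd(3)[of n x y] by linarith
  qed (use that rd in auto)
  have "Cauchy (\<lambda>n. P n x)" for x
  proof (rule CauchyI')
    fix e :: real assume "0 < e"
    \<comment> \<open>The width \<open>h\<close> is fixed by the Hoelder term alone; only then is
      \<open>N\<close> taken large enough for the term with \<open>1 / h\<close>.\<close>
    have "((\<lambda>h. 2 * K * sqrt h) \<longlongrightarrow> 2 * K * sqrt 0) (at_right 0)"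
      by (intro tendsto_intros)
    then have "eventually (\<lambda>h. 2 * K * sqrt h < e / 2) (at_right 0)"
      by (rule order_tendstoD(2)) (use \<open>0 < e\<close> in simp)
    then obtain h where h: "0 < h" "2 * K * sqrt h < e / 2"
      unfolding eventually_at_right_field using dense by blast
    obtain N where N: "4 / h / (e / 2) < real N"
      using reals_Archimedean2 by blast
    have "dist (P n x) (P m x) < e" if "N \<le> n" "n < m" for m n
    proof -
      have "4 / h / (e / 2) < real (Suc n)"
        using N that by simp
      then have "4 / h < real (Suc n) * (e / 2)"
        using \<open>0 < e\<close> by (subst (asm) pos_divide_less_eq) auto
      then have "4 / h / real (Suc n) < e / 2"
        by (subst pos_divide_less_eq) (auto simp: mult.commute)
      then have "4 / real (Suc n) / h < e / 2"
        by (simp add: mult.commute)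
      then show ?thesis
        using pointwise[of n m h x] that h by (simp add: dist_real_def abs_minus_commute)
    qed
    then show "\<exists>M. \<forall>m\<ge>M. \<forall>n>m. dist (P m x) (P n x) < e"
      by blast
  qed
  then have "convergent (\<lambda>n. P n x)" for x
    by (simp add: Cauchy_convergent_iff)
  then obtain p where p: "\<And>x. (\<lambda>n. P n x) \<longlonglongrightarrow> p x"
    unfolding convergent_def by metis
  have [measurable]: "p \<in> borel_measurable lborel"
    by (rule borel_measurable_LIMSEQ_real[OF p]) measurable
  \<comment> \<open>Fatou in \<open>m\<close> turns the Cauchy estimate in mean into an estimate for
    the limit, which also yields integrability of \<open>p\<close>.\<close>
  have Ldist: "(\<integral>\<^sup>+x. ennreal \<bar>p x - P n x\<bar> \<partial>lborel) \<le> ennreal (4 / real (Suc n))" for n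
  proof -
    have "ennreal \<bar>p x - P n x\<bar> = liminf (\<lambda>m. ennreal \<bar>P m x - P n x\<bar>)" for x
      by (intro lim_imp_Liminf[symmetric] tendsto_intros p) simp
    then have "(\<integral>\<^sup>+x. ennreal \<bar>p x - P n x\<bar> \<partial>lborel) = (\<integral>\<^sup>+x. liminf (\<lambda>m. ennreal \<bar>P m x - P n x\<bar>) \<partial>lborel)"
      by simp
    also have "\<dots> \<le> liminf (\<lambda>m. \<integral>\<^sup>+x. ennreal \<bar>P m x - P n x\<bar> \<partial>lborel)"
      by (intro nn_integral_liminf) measurable
    also have "\<dots> \<le> liminf (\<lambda>m::nat. ennreal (4 / real (Suc n)))"
    proof (intro Liminf_mono eventually_sequentiallyI[of n])
      fix m assume "n \<le> m"
      have "(\<integral>\<^sup>+x. ennreal \<bar>P m x - P n x\<bar> \<partial>lborel) = ennreal (LINT x|lborel. \<bar>P m x - P n x\<bar>)"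
        using rd(4) by (intro nn_integral_eq_integral) auto
      then show "(\<integral>\<^sup>+x. ennreal \<bar>P m x - P n x\<bar> \<partial>lborel) \<le> ennreal (4 / real (Suc n))"
        using dist[OF \<open>n \<le> m\<close>] by (simp only: ennreal_leI)
    qed
    finally show ?thesis
      by (simp add: Liminf_const)
  qed
  have int_diff: "integrable lborel (\<lambda>x. p x - P n x)" for n
  proof (rule integrableI_bounded)
    have "(\<integral>\<^sup>+x. ennreal (norm (p x - P n x)) \<partial>lborel) \<le> ennreal (4 / real (Suc n))"
      using Ldist[of n] by simp
    also have "\<dots> < \<infinity>"
      by simp
    finally show "(\<integral>\<^sup>+x. ennreal (norm (p x - P n x)) \<partial>lborel) < \<infinity>" .
  qed measurable
  have int_p: "integrable lborel p"
    using Bochner_Integration.integrable_add[OF int_diff[of 0] rd(4)[of 0]] by simp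
  have bound: "(LINT x|lborel. \<bar>p x - P n x\<bar>) \<le> 4 / real (Suc n)" for n
  proof -
    have "ennreal (LINT x|lborel. \<bar>p x - P n x\<bar>) = (\<integral>\<^sup>+x. ennreal \<bar>p x - P n x\<bar> \<partial>lborel)"
      using int_diff by (intro nn_integral_eq_integral[symmetric]) auto
    then have "ennreal (LINT x|lborel. \<bar>p x - P n x\<bar>) \<le> ennreal (4 / real (Suc n))"
      using Ldist[of n] by (simp only:)
    then show ?thesis
      by (subst (asm) ennreal_le_iff) simp_all
  qed
  have "regular_density K p"
    unfolding regular_density_def
  proof (intro conjI allI)
    fix x y
    show "0 \<le> p x"
      by (rule LIMSEQ_le_const[OF p]) (simp add: rd)
    show "p x \<le> K"
      by (rule LIMSEQ_le_const2[OF p]) (simp add: rd)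
    have "(\<lambda>n. \<bar>P n x - P n y\<bar>) \<longlonglongrightarrow> \<bar>p x - p y\<bar>"
      by (intro tendsto_intros p)
    then show "\<bar>p x - p y\<bar> \<le> K * sqrt \<bar>x - y\<bar>"
      by (rule LIMSEQ_le_const2) (simp add: rd)
  next
    show "integrable lborel p"
      by (rule int_p)
    have "ennreal (x\<^sup>2 * p x) = liminf (\<lambda>n. ennreal (x\<^sup>2 * P n x))" for x
      by (intro lim_imp_Liminf[symmetric] tendsto_intros p) simp
    then have "(\<integral>\<^sup>+x. ennreal (x\<^sup>2 * p x) \<partial>lborel) = (\<integral>\<^sup>+x. liminf (\<lambda>n. ennreal (x\<^sup>2 * P n x)) \<partial>lborel)"
      by simp
    also have "\<dots> \<le> liminf (\<lambda>n. \<integral>\<^sup>+x. ennreal (x\<^sup>2 * P n x) \<partial>lborel)"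
      by (intro nn_integral_liminf) measurable
    also have "\<dots> \<le> liminf (\<lambda>n::nat. ennreal K)"
      by (intro Liminf_mono always_eventually allI rd)
    finally show "(\<integral>\<^sup>+x. ennreal (x\<^sup>2 * p x) \<partial>lborel) \<le> ennreal K"
      by (simp add: Liminf_const)
  qed
  moreover have "\<mu> B = (LINT x:B|lborel. p x)" if B: "B \<in> sets borel" for B
  proof -
    have "\<bar>\<mu> B - (LINT x:B|lborel. p x)\<bar> \<le> 5 / real (Suc n)" for n
    proof -
      have si: "integrable lborel (\<lambda>x. indicator B x *\<^sub>R f x)" if "integrable lborel f" for f :: "real \<Rightarrow> real"
        using that B by (intro integrable_mult_indicator) auto
      have "\<bar>(LINT x:B|lborel. p x) - (LINT x:B|lborel. P n x)\<bar> =
          \<bar>LINT x|lborel. indicator B x *\<^sub>R (p x - P n x)\<bar>"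
        unfolding set_lebesgue_integral_def scaleR_diff_right
        by (subst Bochner_Integration.integral_diff[OF si[OF int_p] si[OF rd(4)]]) simp
      also have "\<dots> \<le> (LINT x|lborel. \<bar>indicator B x *\<^sub>R (p x - P n x)\<bar>)"
        by (rule integral_abs_bound)
      also have "\<dots> \<le> (LINT x|lborel. \<bar>p x - P n x\<bar>)"
        using int_diff si[OF int_diff] by (intro integral_mono integrable_abs) (auto split: split_indicator)
      also have "\<dots> \<le> 4 / real (Suc n)"
        by (rule bound)
      finally have "\<bar>\<mu> B - (LINT x:B|lborel. p x)\<bar> \<le> 1 / real (Suc n) + 4 / real (Suc n)"
        using P(2)[OF B, of n] by linarith
      then show ?thesis
        by (simp flip: add_divide_distrib)
    qed
    moreover have "(\<lambda>n. 5 / real (Suc n)) \<longlonglongrightarrow> 0"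
      by real_asymp
    ultimately have "\<bar>\<mu> B - (LINT x:B|lborel. p x)\<bar> \<le> 0"
      by (intro LIMSEQ_le_const[of "\<lambda>n. 5 / real (Suc n)"]) auto
    then show ?thesis
      by simp
  qed
  ultimately show ?thesis
    by blast
qed

subsection \<open>Finite superpositions of Fock states\<close>

text \<open>With \<open>s = 1\<close> this is the position operator, with \<open>s = -1\<close> the
  derivative, applied to a finite superposition. The lowered and the raised part are each orthogonal
  families, and bounding the square of the sum by twice the squares gives the weight
  \<open>n + (n + 1)\<close>, hence twice the energy plus the squared norm.\<close>

lemma norm_fock_ladder_sum:
  assumes "cmod s = 1"
  shows "(norm (\<Sum>n<N. c n *\<^sub>C (complex_of_real (sqrt (real n / 2)) *\<^sub>C fock (n - 1) +
       (s * complex_of_real (sqrt (real (Suc n) / 2))) *\<^sub>C fock (Suc n))))\<^sup>2 \<le>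
     2 * (\<Sum>n<N. real n * (cmod (c n))\<^sup>2) + (\<Sum>n<N. (cmod (c n))\<^sup>2)"
proof -
  \<comment> \<open>The term \<open>n = 0\<close> has coefficient zero and is left out, because
    \<open>n - 1\<close> is injective only from 1 on.\<close>
  define A where "A = (\<Sum>n\<in>{1..<N}. (c n * complex_of_real (sqrt (real n / 2))) *\<^sub>C fock (n - 1))"
  define B where "B = (\<Sum>n<N. (c n * (s * complex_of_real (sqrt (real (Suc n) / 2)))) *\<^sub>C fock (Suc n))"
  have A: "(norm A)\<^sup>2 = (\<Sum>n\<in>{1..<N}. (cmod (c n))\<^sup>2 * (real n / 2))"
    unfolding A_def by (subst norm_fock_sum) (auto simp: inj_on_def norm_mult power_mult_distrib)
  also have "\<dots> = (\<Sum>n<N. (cmod (c n))\<^sup>2 * (real n / 2))"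
    by (intro sum.mono_neutral_left) auto
  finally have A': "(norm A)\<^sup>2 = (\<Sum>n<N. (cmod (c n))\<^sup>2 * (real n / 2))" .
  have B: "(norm B)\<^sup>2 = (\<Sum>n<N. (cmod (c n))\<^sup>2 * (real (Suc n) / 2))"
    unfolding B_def by (subst norm_fock_sum) (auto simp: inj_on_def norm_mult power_mult_distrib assms)
  have "(\<Sum>n<N. (c n * complex_of_real (sqrt (real n / 2))) *\<^sub>C fock (n - 1)) = A"
    unfolding A_def by (intro sum.mono_neutral_right) (auto simp: not_le)
  then have "(\<Sum>n<N. c n *\<^sub>C (complex_of_real (sqrt (real n / 2)) *\<^sub>C fock (n - 1) +
       (s * complex_of_real (sqrt (real (Suc n) / 2))) *\<^sub>C fock (Suc n))) = A + B"
    by (simp only: scaleC_add_right scaleC_scaleC sum.distrib B_def)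
  moreover have "(norm (A + B))\<^sup>2 \<le> 2 * (norm A)\<^sup>2 + 2 * (norm B)\<^sup>2"
  proof -
    have "(norm (A + B))\<^sup>2 \<le> (norm A + norm B)\<^sup>2"
      by (intro power_mono norm_triangle_ineq norm_ge_zero)
    also have "\<dots> \<le> 2 * (norm A)\<^sup>2 + 2 * (norm B)\<^sup>2"
      using sum_squares_bound[of "norm A" "norm B"] by (simp add: power2_sum)
    finally show ?thesis .
  qed
  moreover have "2 * (norm A)\<^sup>2 + 2 * (norm B)\<^sup>2 = 2 * (\<Sum>n<N. real n * (cmod (c n))\<^sup>2) + (\<Sum>n<N. (cmod (c n))\<^sup>2)"
    unfolding A' B sum_distrib_left sum.distrib[symmetric]
    by (intro sum.cong refl) (simp add: field_simps)
  ultimately show ?thesis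
    by simp
qed

lemma gauss_dominated_sum:
  assumes "\<And>i. i \<in> A \<Longrightarrow> gauss_dominated (f i)"
  shows "gauss_dominated (\<lambda>x. \<Sum>i\<in>A. f i x)"
proof -
  have "gauss_dominated (\<lambda>x. 0)"
    using gauss_dominated_cmult[OF gauss_dominated_gauss, of 0] by simp
  then show ?thesis
    using assms by (induction A rule: infinite_finite_induct) (simp_all add: gauss_dominated_add)
qed

lemma abs_wavefun_fock_sum:
  "abs_wavefun (\<lambda>x. \<Sum>n\<in>A. c n * complex_of_real (fock_fun n x)) = (\<Sum>n\<in>A. c n *\<^sub>C fock n)"
  by (simp only: fock_eq scaleC_abs_wavefun square_integrable_fock_fun sum_abs_wavefun(2)
      square_integrable_cmult)

lemma abs_wavefun_fock_ladder_sum: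
  "abs_wavefun (\<lambda>x. \<Sum>n<N. c n * (complex_of_real (sqrt (real n / 2)) * complex_of_real (fock_fun (n - 1) x) +
       (s * complex_of_real (sqrt (real (Suc n) / 2))) * complex_of_real (fock_fun (Suc n) x))) =
   (\<Sum>n<N. c n *\<^sub>C (complex_of_real (sqrt (real n / 2)) *\<^sub>C fock (n - 1) +
       (s * complex_of_real (sqrt (real (Suc n) / 2))) *\<^sub>C fock (Suc n)))"
  by (simp only: fock_eq scaleC_abs_wavefun square_integrable_fock_fun sum_abs_wavefun(2)
      plus_abs_wavefun square_integrable_add square_integrable_cmult)

text \<open>Sobolev embedding in one dimension: pairing \<open>g'\<close> with the indicator of an
  interval gives \<open>|g y - g x| <= sqrt M * sqrt |x - y|\<close>. A value above
  \<open>1 + M\<close> would keep \<open>|g|\<close> above 1 on a unit interval and contradict the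
  norm bound. The constant \<open>2 (1 + M)^2\<close> dominates the supremum
  \<open>(1 + M)^2\<close>, the Hoelder constant \<open>2 M (1 + M)\<close> and the moment bound
  \<open>M\<close>.\<close>

lemma regular_density_gauss_dominated:
  assumes g: "gauss_dominated g" "gauss_dominated g'" "\<And>x. (g has_vector_derivative g' x) (at x)"
    and M: "1 \<le> M" "norm (abs_wavefun g) \<le> 1" "(norm (abs_wavefun g'))\<^sup>2 \<le> M"
      "(norm (abs_wavefun (\<lambda>x. complex_of_real x * g x)))\<^sup>2 \<le> M"
  shows "regular_density (2 * (1 + M)\<^sup>2) (\<lambda>x. (cmod (g x))\<^sup>2)"
proof -
  note sq = gauss_dominated_square_integrable
  have "sqrt M \<le> sqrt (M * M)"
    using M(1) by (intro real_sqrt_le_mono) simp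
  then have sqrtM: "sqrt M \<le> M"
    using M(1) by simp
  have lip: "cmod (g y - g x) \<le> sqrt M * sqrt (y - x)" if "x \<le> y" for x y
  proof -
    have cont: "continuous_on {x..y} g'"
      using gauss_dominated_continuous[OF g(2)] by (rule continuous_on_subset) simp
    have "has_bochner_integral lborel (\<lambda>t. indicator {x..y} t *\<^sub>R g' t) (g y - g x)"
      by (rule has_bochner_integral_FTC_Icc[OF that has_vector_derivative_at_within[OF g(3)] cont])
    then have "(LINT t|lborel. indicator {x..y} t *\<^sub>R g' t) = g y - g x"
      by (rule has_bochner_integral_integral_eq)
    moreover have one: "square_integrable (indicator {x..y})"
      unfolding square_integrable_def
    proof
      have "integrable lborel (indicator {x..y} :: real \<Rightarrow> real)"
        by (intro integrable_real_indicator) (auto simp: emeasure_lborel_Icc_eq)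
      then show "integrable lborel (\<lambda>t. (cmod (indicator {x..y} t))\<^sup>2)"
        by (rule Bochner_Integration.integrable_cong[THEN iffD1, rotated 2]) (auto simp: indicator_def)
    qed (intro borel_measurable_indicator, simp)
    moreover have "(\<lambda>t. cnj (indicator {x..y} t) * g' t) = (\<lambda>t. indicator {x..y} t *\<^sub>R g' t)"
      by (auto simp: indicator_def)
    ultimately have eq: "cinner (abs_wavefun (indicator {x..y})) (abs_wavefun g') = g y - g x"
      by (simp only: cinner_abs_wavefun[OF one sq[OF g(2)]])
    have "(norm (abs_wavefun (indicator {x..y} :: real \<Rightarrow> complex)))\<^sup>2 = (LINT t|lborel. indicator {x..y} t)"
      unfolding norm_abs_wavefun[OF one]
      by (intro Bochner_Integration.integral_cong) (auto simp: indicator_def)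
    also have "\<dots> = y - x"
      using that by simp
    finally have n1: "norm (abs_wavefun (indicator {x..y} :: real \<Rightarrow> complex)) = sqrt (y - x)"
      by (metis norm_ge_zero real_sqrt_unique)
    have "norm (abs_wavefun g') \<le> sqrt M"
      using M(3) by (rule real_le_rsqrt)
    then have "cmod (g y - g x) \<le> sqrt (y - x) * sqrt M"
      using cinner_Cauchy_Schwarz[of "abs_wavefun (indicator {x..y})" "abs_wavefun g'"] that
      unfolding eq n1 by (meson mult_left_mono order_trans real_sqrt_ge_zero diff_ge_0_iff_ge)
    then show ?thesis
      by (simp add: mult.commute)
  qed
  have lip': "cmod (g y - g x) \<le> sqrt M * sqrt \<bar>x - y\<bar>" for x y
    using lip[of x y] lip[of y x] by (cases "x \<le> y") (simp_all add: norm_minus_commute)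
  have L2: "(LINT t|lborel. (cmod (g t))\<^sup>2) \<le> 1"
    unfolding norm_abs_wavefun[OF sq[OF g(1)], symmetric] using power_mono[OF M(2), of 2] by simp
  have int: "integrable lborel (\<lambda>t. (cmod (g t))\<^sup>2)"
    using sq[OF g(1)] by (simp add: square_integrable_def)
  have sup: "cmod (g x) \<le> 1 + M" for x
  proof (rule ccontr)
    assume "\<not> cmod (g x) \<le> 1 + M"
    then have s: "1 < cmod (g x) - sqrt M"
      using sqrtM by simp
    have "(cmod (g x) - sqrt M)\<^sup>2 = (LINT t|lborel. (cmod (g x) - sqrt M)\<^sup>2 * indicator {x..x + 1} t)"
      by simp
    also have "\<dots> \<le> (LINT t|lborel. (cmod (g t))\<^sup>2)"
    proof (rule integral_mono)
      show "integrable lborel (\<lambda>t. (cmod (g x) - sqrt M)\<^sup>2 * indicator {x..x + 1} t)"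
        by (intro integrable_mult_right integrable_real_indicator) (auto simp: emeasure_lborel_Icc_eq)
      fix t
      show "(cmod (g x) - sqrt M)\<^sup>2 * indicator {x..x + 1} t \<le> (cmod (g t))\<^sup>2"
      proof (cases "t \<in> {x..x + 1}")
        case True
        have "cmod (g t - g x) \<le> sqrt M * sqrt (t - x)"
          using True by (intro lip) simp
        also have "\<dots> \<le> sqrt M * 1"
          using True M(1) by (intro mult_left_mono) auto
        finally have "cmod (g x) - sqrt M \<le> cmod (g t)"
          using norm_triangle_ineq2[of "g x" "g t"] by (simp add: norm_minus_commute)
        then show ?thesis
          using True s by (auto intro!: power_mono)
      qed simp
    qed (rule int)
    also note L2
    finally have "(cmod (g x) - sqrt M)\<^sup>2 \<le> 1" .
    moreover have "1 < (cmod (g x) - sqrt M)\<^sup>2"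
      using s by (rule one_less_power) simp
    ultimately show False
      by linarith
  qed
  show ?thesis
    unfolding regular_density_def
  proof (intro conjI allI)
    fix x y
    have "(cmod (g x))\<^sup>2 \<le> (1 + M)\<^sup>2"
      by (intro power_mono sup) simp
    then show "(cmod (g x))\<^sup>2 \<le> 2 * (1 + M)\<^sup>2"
      using zero_le_power2[of "1 + M"] by linarith
    have "\<bar>(cmod (g x))\<^sup>2 - (cmod (g y))\<^sup>2\<bar> = \<bar>cmod (g x) - cmod (g y)\<bar> * (cmod (g x) + cmod (g y))"
      by (simp add: power2_eq_square square_diff_square_factored abs_mult mult.commute)
    also have "\<dots> \<le> (M * sqrt \<bar>x - y\<bar>) * ((1 + M) + (1 + M))"
    proof (intro mult_mono add_mono sup)
      have "\<bar>cmod (g x) - cmod (g y)\<bar> \<le> sqrt M * sqrt \<bar>x - y\<bar>"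
        using norm_triangle_ineq3[of "g x" "g y"] lip'[of x y] unfolding abs_minus_commute[of y x]
        by (simp add: norm_minus_commute[of "g y"])
      also have "\<dots> \<le> M * sqrt \<bar>x - y\<bar>"
        using sqrtM by (intro mult_right_mono) auto
      finally show "\<bar>cmod (g x) - cmod (g y)\<bar> \<le> M * sqrt \<bar>x - y\<bar>" .
    qed (use M(1) in auto)
    also have "\<dots> = (2 * (M * (1 + M))) * sqrt \<bar>x - y\<bar>"
      by (simp add: algebra_simps)
    also have "\<dots> \<le> (2 * (1 + M)\<^sup>2) * sqrt \<bar>x - y\<bar>"
      using M(1) by (intro mult_right_mono) (auto simp: power2_eq_square)
    finally show "\<bar>(cmod (g x))\<^sup>2 - (cmod (g y))\<^sup>2\<bar> \<le> 2 * (1 + M)\<^sup>2 * sqrt \<bar>x - y\<bar>" .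
  next
    have "(\<integral>\<^sup>+x. ennreal (x\<^sup>2 * (cmod (g x))\<^sup>2) \<partial>lborel) = ennreal ((norm (abs_wavefun (\<lambda>x. complex_of_real x * g x)))\<^sup>2)"
      using square_integrable_nn_integral[OF sq[OF gauss_dominated_of_real_mult[OF g(1)]]]
      by (simp add: norm_mult power_mult_distrib)
    also have "\<dots> \<le> ennreal (2 * (1 + M)\<^sup>2)"
    proof (rule ennreal_leI)
      have "M \<le> 2 * (1 + M)\<^sup>2"
        using M(1) zero_le_power2[of M] by (simp add: power2_sum)
      then show "(norm (abs_wavefun (\<lambda>x. complex_of_real x * g x)))\<^sup>2 \<le> 2 * (1 + M)\<^sup>2"
        using M(4) by linarith
    qed
    finally show "(\<integral>\<^sup>+x. ennreal (x\<^sup>2 * (cmod (g x))\<^sup>2) \<partial>lborel) \<le> ennreal (2 * (1 + M)\<^sup>2)" .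
  qed (use int in auto)
qed

text \<open>The bound \<open>M = 2 E + 1\<close> for position and derivative, inserted into the
  constant of \<open>regular_density_gauss_dominated\<close>.\<close>

definition density_const :: "real \<Rightarrow> real" where
  "density_const E = 2 * (1 + (2 * E + 1))\<^sup>2"

text \<open>A finite superposition is Gauss dominated together with its derivative, so the Sobolev
  estimates apply. The norm is allowed to be below 1, since the vectors of interest are truncations
  of unit vectors.\<close>

lemma fock_sum_regular_density:
  assumes "0 \<le> E" "(\<Sum>n<N. (cmod (c n))\<^sup>2) \<le> 1" "(\<Sum>n<N. real n * (cmod (c n))\<^sup>2) \<le> E"
  shows "\<exists>p. regular_density (density_const E) p \<and>
    (\<forall>B\<in>sets borel. (norm (position_projector B (\<Sum>n<N. c n *\<^sub>C fock n)))\<^sup>2 = (LINT x:B|lborel. p x))"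
proof -
  define g where "g x = (\<Sum>n<N. c n * complex_of_real (fock_fun n x))" for x
  define g' where "g' x = (\<Sum>n<N. c n * complex_of_real (deriv (fock_fun n) x))" for x
  have g: "gauss_dominated g"
    unfolding g_def by (intro gauss_dominated_sum gauss_dominated_cmult gauss_dominated_fock_fun)
  have g': "gauss_dominated g'"
    unfolding g'_def by (intro gauss_dominated_sum gauss_dominated_cmult gauss_dominated_deriv_fock_fun)
  have der: "(g has_vector_derivative g' x) (at x)" for x
    unfolding g_def g'_def
    by (intro has_vector_derivative_sum has_vector_derivative_mult_right has_vector_derivative_of_real_fock_fun)
  have abs_g: "abs_wavefun g = (\<Sum>n<N. c n *\<^sub>C fock n)"
    unfolding g_def by (rule abs_wavefun_fock_sum)
  have "(norm (abs_wavefun g))\<^sup>2 \<le> 1"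
    unfolding abs_g using norm_fock_sum[of "{..<N}" "\<lambda>x. x" c] assms(2) by simp
  then have n1: "norm (abs_wavefun g) \<le> 1"
    by (simp add: power2_le_iff_abs_le abs_square_le_1)
  have x_eq: "(\<lambda>x. complex_of_real x * g x) =
     (\<lambda>x. \<Sum>n<N. c n * (complex_of_real (sqrt (real n / 2)) * complex_of_real (fock_fun (n - 1) x) +
       (1 * complex_of_real (sqrt (real (Suc n) / 2))) * complex_of_real (fock_fun (Suc n) x)))"
  proof
    fix x
    have "complex_of_real x * g x = (\<Sum>n<N. c n * complex_of_real (x * fock_fun n x))"
      unfolding g_def sum_distrib_left by (intro sum.cong refl) simp
    then show "complex_of_real x * g x = (\<Sum>n<N. c n * (complex_of_real (sqrt (real n / 2)) * complex_of_real (fock_fun (n - 1) x) +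
       (1 * complex_of_real (sqrt (real (Suc n) / 2))) * complex_of_real (fock_fun (Suc n) x)))"
      unfolding fock_fun_times of_real_add of_real_mult mult_1 .
  qed
  have d_eq: "g' =
     (\<lambda>x. \<Sum>n<N. c n * (complex_of_real (sqrt (real n / 2)) * complex_of_real (fock_fun (n - 1) x) +
       (- 1 * complex_of_real (sqrt (real (Suc n) / 2))) * complex_of_real (fock_fun (Suc n) x)))"
    unfolding g'_def deriv_fock_fun of_real_diff of_real_mult by simp
  have "(norm (abs_wavefun (\<lambda>x. complex_of_real x * g x)))\<^sup>2 \<le> 2 * E + 1"
    unfolding x_eq abs_wavefun_fock_ladder_sum
    by (rule order_trans[OF norm_fock_ladder_sum]) (use assms in auto)
  moreover have "(norm (abs_wavefun g'))\<^sup>2 \<le> 2 * E + 1"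
    unfolding d_eq abs_wavefun_fock_ladder_sum
    by (rule order_trans[OF norm_fock_ladder_sum]) (use assms in auto)
  ultimately have "regular_density (density_const E) (\<lambda>x. (cmod (g x))\<^sup>2)"
    unfolding density_const_def using assms(1) by (intro regular_density_gauss_dominated[OF g g' der] n1) auto
  moreover have "(norm (position_projector B (\<Sum>n<N. c n *\<^sub>C fock n)))\<^sup>2 = (LINT x:B|lborel. (cmod (g x))\<^sup>2)"
    if "B \<in> sets borel" for B
    unfolding abs_g[symmetric]
    by (rule norm_position_projector_abs[OF that gauss_dominated_square_integrable[OF g]])
  ultimately show ?thesis
    by blast
qed

text \<open>Truncating the Fock expansion does not increase norm or energy, so the bounds hold for
  the truncations with the same constant. Their measures converge uniformly in \<open>B\<close>, and
  closedness of the class provides a density for the limit. Domain questions about position and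
  derivative thus arise only for finite superpositions.\<close>

lemma pure_regular_density:
  assumes "0 \<le> E" "norm \<phi> = 1" "energy \<phi> \<le> ennreal E"
  shows "\<exists>p. regular_density (density_const E) p \<and>
    (\<forall>B\<in>sets borel. (norm (position_projector B \<phi>))\<^sup>2 = (LINT x:B|lborel. p x))"
proof (rule regular_density_closed)
  fix e :: real assume "0 < e"
  define s where "s = (\<lambda>N. \<Sum>n<N. cinner (fock n) \<phi> *\<^sub>C fock n)"
  have "s \<longlonglongrightarrow> \<phi>"
    using fock_expansion[of \<phi>] by (simp add: sums_def s_def)
  then obtain N where N: "norm (s N - \<phi>) < e / 2"
    using LIMSEQ_D[of s \<phi> "e / 2"] \<open>0 < e\<close> by auto
  have le1: "(\<Sum>n<N. (cmod (cinner (fock n) \<phi>))\<^sup>2) \<le> 1"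
    using bessel[of \<phi> N] assms(2) by simp
  then have "(norm (s N))\<^sup>2 \<le> 1"
    unfolding s_def using norm_fock_sum[of "{..<N}" "\<lambda>x. x" "\<lambda>n. cinner (fock n) \<phi>"] by simp
  then have sN: "norm (s N) \<le> 1"
    by (simp add: power2_le_iff_abs_le abs_square_le_1)
  have "(\<Sum>n<N. ennreal (real n * (cmod (cinner (fock n) \<phi>))\<^sup>2)) \<le> energy \<phi>"
    unfolding energy_def by (intro sum_le_suminf) auto
  then have "ennreal (\<Sum>n<N. real n * (cmod (cinner (fock n) \<phi>))\<^sup>2) \<le> ennreal E"
    using assms(3) by (simp add: sum_ennreal)
  then have "(\<Sum>n<N. real n * (cmod (cinner (fock n) \<phi>))\<^sup>2) \<le> E"
    using assms(1) by simp
  from fock_sum_regular_density[OF assms(1) le1 this]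
  obtain p where p: "regular_density (density_const E) p"
    "\<And>B. B \<in> sets borel \<Longrightarrow> (norm (position_projector B (s N)))\<^sup>2 = (LINT x:B|lborel. p x)"
    unfolding s_def by blast
  have "\<bar>(norm (position_projector B \<phi>))\<^sup>2 - (LINT x:B|lborel. p x)\<bar> \<le> e" if B: "B \<in> sets borel" for B
  proof -
    let ?a = "norm (position_projector B \<phi>)" and ?b = "norm (position_projector B (s N))"
    have "\<bar>?a - ?b\<bar> \<le> norm (position_projector B (\<phi> - s N))"
      unfolding position_projector_diff[OF B] by (rule norm_triangle_ineq3)
    also have "\<dots> \<le> norm (\<phi> - s N)"
      by (rule norm_position_projector_le[OF B])
    finally have d: "\<bar>?a - ?b\<bar> \<le> e / 2"
      using N by (simp add: norm_minus_commute)
    have ab: "?a \<le> 1" "?b \<le> 1"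
      using norm_position_projector_le[OF B, of \<phi>] norm_position_projector_le[OF B, of "s N"] assms(2) sN by simp_all
    have "\<bar>?a\<^sup>2 - ?b\<^sup>2\<bar> = \<bar>?a - ?b\<bar> * (?a + ?b)"
      by (simp add: power2_eq_square square_diff_square_factored abs_mult mult.commute)
    also have "\<dots> \<le> e / 2 * 2"
      using ab d \<open>0 < e\<close> by (intro mult_mono) auto
    finally show ?thesis
      using p(2)[OF B] by simp
  qed
  then show "\<exists>p. regular_density (density_const E) p \<and>
      (\<forall>B\<in>sets borel. \<bar>(norm (position_projector B \<phi>))\<^sup>2 - (LINT x:B|lborel. p x)\<bar> \<le> e)"
    using p by blast
qed

subsection \<open>Mixtures\<close>

lemma pure_state_scaleC: "blinfun_apply (pure_state \<psi>) (c *\<^sub>C f) = c *\<^sub>C blinfun_apply (pure_state \<psi>) f"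
  by (simp add: pure_state.rep_eq cinner_scaleC_right scaleC_scaleC)

lemma has_trace_convex:
  assumes "has_trace A W a" "has_trace B W b"
  shows "has_trace (u *\<^sub>R A + v *\<^sub>R B) W (u * a + v * b)"
  using sums_add[OF sums_mult[OF assms(1)[unfolded has_trace_def], of "complex_of_real u"]
      sums_mult[OF assms(2)[unfolded has_trace_def], of "complex_of_real v"]]
  by (simp add: has_trace_def blinfun.add_left blinfun.scaleR_left cinner_add_right cinner_scaleR_right)

lemma hull_scaleC:
  assumes "\<tau> \<in> convex hull {pure_state \<psi> | \<psi>. Q \<psi>}"
  shows "blinfun_apply \<tau> (c *\<^sub>C f) = c *\<^sub>C blinfun_apply \<tau> f"
proof -
  have "convex hull {pure_state \<psi> | \<psi>. Q \<psi>} \<subseteq> {\<tau>. \<forall>c f. blinfun_apply \<tau> (c *\<^sub>C f) = c *\<^sub>C blinfun_apply \<tau> f}"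
    by (intro hull_minimal convexI)
      (auto simp: pure_state_scaleC blinfun.add_left blinfun.scaleR_left scaleC_add_right scaleR_eq_scaleC scaleC_scaleC mult.commute)
  with assms show ?thesis
    by blast
qed

lemma density_operator_scaleC:
  "density_operator \<sigma> \<Longrightarrow> blinfun_apply \<sigma> (c *\<^sub>C f) = c *\<^sub>C blinfun_apply \<sigma> f"
  by (simp add: density_operator_def positive_op_def)

text \<open>The approximating mixture does not depend on \<theta> or \<open>B\<close>; uniformity in
  \<open>B\<close> is what \<open>regular_density_closed\<close> asks for.\<close>

lemma cch_approx:
  assumes "\<sigma> \<in> cch {pure_state \<psi> | \<psi>. Q \<psi>}" "0 < e"
  obtains \<tau> where "\<tau> \<in> convex hull {pure_state \<psi> | \<psi>. Q \<psi>}"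
    "\<And>\<theta> B v. B \<in> sets borel \<Longrightarrow> has_trace \<tau> (quadrature_projector \<theta> B) v \<Longrightarrow>
      \<bar>expval \<sigma> (quadrature_projector \<theta> B) - v\<bar> \<le> e"
proof -
  obtain \<tau> where \<tau>: "\<tau> \<in> convex hull {pure_state \<psi> | \<psi>. Q \<psi>}" "trace_norm (\<sigma> - \<tau>) < ennreal e"
    using assms by (auto simp: cch_def)
  have \<sigma>: "density_operator \<sigma>"
    using assms(1) by (simp add: cch_def)
  show thesis
  proof (rule that[OF \<tau>(1)])
    fix \<theta> B v assume B: "B \<in> sets borel" and v: "has_trace \<tau> (quadrature_projector \<theta> B) v"
    show "\<bar>expval \<sigma> (quadrature_projector \<theta> B) - v\<bar> \<le> e"
      by (rule has_trace_close[OF density_operator_scaleC[OF \<sigma>] hull_scaleC[OF \<tau>(1)] \<tau>(2)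
            cinner_quadrature_projector[OF B] norm_quadrature_projector_le[OF B] v])
  qed
qed

lemma hull_regular_density:
  assumes "0 \<le> E" "\<tau> \<in> convex hull {pure_state \<psi> | \<psi>. norm \<psi> = 1 \<and> energy \<psi> \<le> ennreal E}"
  shows "\<exists>p. regular_density (density_const E) p \<and>
    (\<forall>B\<in>sets borel. has_trace \<tau> (quadrature_projector \<theta> B) (LINT x:B|lborel. p x))"
proof -
  let ?T = "{\<tau>. \<exists>p. regular_density (density_const E) p \<and>
    (\<forall>B\<in>sets borel. has_trace \<tau> (quadrature_projector \<theta> B) (LINT x:B|lborel. p x))}"
  have "convex hull {pure_state \<psi> | \<psi>. norm \<psi> = 1 \<and> energy \<psi> \<le> ennreal E} \<subseteq> ?T"
  proof (rule hull_minimal)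
    show "{pure_state \<psi> | \<psi>. norm \<psi> = 1 \<and> energy \<psi> \<le> ennreal E} \<subseteq> ?T"
    proof clarify
      fix \<psi> assume "norm \<psi> = 1" "energy \<psi> \<le> ennreal E"
      then have "\<exists>p. regular_density (density_const E) p \<and>
         (\<forall>B\<in>sets borel. (norm (position_projector B (phase_rotation \<theta> \<psi>)))\<^sup>2 = (LINT x:B|lborel. p x))"
        using assms(1) by (intro pure_regular_density) (simp_all add: norm_phase_rotation energy_phase_rotation)
      then show "\<exists>p. regular_density (density_const E) p \<and>
         (\<forall>B\<in>sets borel. has_trace (pure_state \<psi>) (quadrature_projector \<theta> B) (LINT x:B|lborel. p x))"
        by (metis has_trace_pure_state)
    qed
    show "convex ?T"
    proof (rule convexI)
      fix \<sigma> \<tau> and u v :: real assume "\<sigma> \<in> ?T" "\<tau> \<in> ?T" and uv: "0 \<le> u" "0 \<le> v" "u + v = 1"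
      then obtain p q where p: "regular_density (density_const E) p"
          "\<And>B. B\<in>sets borel \<Longrightarrow> has_trace \<sigma> (quadrature_projector \<theta> B) (LINT x:B|lborel. p x)"
        and q: "regular_density (density_const E) q"
          "\<And>B. B\<in>sets borel \<Longrightarrow> has_trace \<tau> (quadrature_projector \<theta> B) (LINT x:B|lborel. q x)"
        by blast
      have "(LINT x:B|lborel. u * p x + v * q x) = u * (LINT x:B|lborel. p x) + v * (LINT x:B|lborel. q x)"
        if B: "B \<in> sets borel" for B
      proof -
        have si: "set_integrable lborel B f" if "integrable lborel f" for f :: "real \<Rightarrow> real"
          using that B unfolding set_integrable_def by (intro integrable_mult_indicator) auto
        show ?thesis
          using si[OF regular_densityD(4)[OF p(1)]] si[OF regular_densityD(4)[OF q(1)]]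
          by (subst set_integral_add(2)) auto
      qed
      then have "has_trace (u *\<^sub>R \<sigma> + v *\<^sub>R \<tau>) (quadrature_projector \<theta> B) (LINT x:B|lborel. u * p x + v * q x)"
        if "B \<in> sets borel" for B
        using has_trace_convex[OF p(2)[OF that] q(2)[OF that], of u v] that by simp
      then show "u *\<^sub>R \<sigma> + v *\<^sub>R \<tau> \<in> ?T"
        using regular_density_convex[OF p(1) q(1) uv] by blast
    qed
  qed
  with assms(2) show ?thesis
    by blast
qed

lemma energy_bounded_regular_density:
  assumes "0 \<le> E" "\<rho> \<in> energy_bounded_states E"
  shows "\<exists>p. regular_density (density_const E) p \<and>
    (\<forall>B\<in>sets borel. expval \<rho> (quadrature_projector \<theta> B) = (LINT x:B|lborel. p x))"
proof (rule regular_density_closed)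
  fix e :: real assume "0 < e"
  obtain \<tau> where \<tau>: "\<tau> \<in> convex hull {pure_state \<psi> | \<psi>. norm \<psi> = 1 \<and> energy \<psi> \<le> ennreal E}"
    "\<And>\<theta> B v. B \<in> sets borel \<Longrightarrow> has_trace \<tau> (quadrature_projector \<theta> B) v \<Longrightarrow>
      \<bar>expval \<rho> (quadrature_projector \<theta> B) - v\<bar> \<le> e"
    using cch_approx[OF assms(2)[unfolded energy_bounded_states_def] \<open>0 < e\<close>] by blast
  show "\<exists>p. regular_density (density_const E) p \<and>
      (\<forall>B\<in>sets borel. \<bar>expval \<rho> (quadrature_projector \<theta> B) - (LINT x:B|lborel. p x)\<bar> \<le> e)"
    using hull_regular_density[OF assms(1) \<tau>(1), of \<theta>] \<tau>(2) by blast
qed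

text \<open>Uniqueness of the continuous representative. It makes the description in
  \<open>quadrature_density\<close> definite and later identifies the density of a Gaussian state
  with the regular one.\<close>

lemma continuous_eq_if_set_integrals_eq:
  fixes p q :: "real \<Rightarrow> real"
  assumes p: "continuous_on UNIV p" "integrable lborel p" and q: "continuous_on UNIV q" "integrable lborel q"
    and eq: "\<And>B. B \<in> sets borel \<Longrightarrow> (LINT x:B|lborel. p x) = (LINT x:B|lborel. q x)"
  shows "p = q"
proof -
  have "(LINT x|lborel. \<bar>p x - q x\<bar>) \<le> 2 * 0"
    by (rule L1_dist_le_of_measures[OF p(2) q(2)]) (simp add: eq)
  moreover have "0 \<le> (LINT x|lborel. \<bar>p x - q x\<bar>)"
    by (rule Bochner_Integration.integral_nonneg) simp
  ultimately have "(LINT x|lborel. \<bar>p x - q x\<bar>) = 0"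
    by simp
  then have "AE x in lborel. \<bar>p x - q x\<bar> = 0"
    using p(2) q(2) by (subst (asm) integral_nonneg_eq_0_iff_AE) auto
  then have "AE x in lborel. x \<in> {x. p x = q x}"
    by eventually_elim simp
  have "closed {x. p x = q x}"
    by (intro closed_Collect_eq p q)
  have "{x. p x = q x} = UNIV"
  proof (rule ccontr)
    assume "{x. p x = q x} \<noteq> UNIV"
    then obtain x where x: "x \<in> - {x. p x = q x}"
      by blast
    have "open (- {x. p x = q x})"
      using \<open>closed {x. p x = q x}\<close> by (simp add: open_Compl)
    moreover have "- {x. p x = q x} \<in> null_sets lborel"
      using \<open>AE x in lborel. x \<in> {x. p x = q x}\<close> \<open>closed {x. p x = q x}\<close>
      by (subst AE_iff_null_sets) auto
    ultimately have "negligible (- {x. p x = q x})"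
      by (simp add: negligible_iff_null_sets null_sets_completionI)
    then show False
      using open_not_negligible[OF \<open>open (- {x. p x = q x})\<close>] x by blast
  qed
  then show ?thesis
    by auto
qed

lemma quadrature_density_eq:
  assumes "regular_density K p"
    and "\<And>B. B \<in> sets borel \<Longrightarrow> expval \<rho> (quadrature_projector \<theta> B) = (LINT x:B|lborel. p x)"
  shows "quadrature_density \<rho> \<theta> = p"
  unfolding quadrature_density_def
proof (rule the_equality)
  show "is_quadrature_density \<rho> \<theta> p"
    using regular_densityD[OF assms(1)] regular_density_continuous[OF assms(1)] assms(2)
    by (simp add: is_quadrature_density_def)
next
  fix q assume "is_quadrature_density \<rho> \<theta> q"
  then show "q = p"
    using regular_densityD[OF assms(1)] regular_density_continuous[OF assms(1)] assms(2)
    by (intro continuous_eq_if_set_integrals_eq) (auto simp: is_quadrature_density_def)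
qed

section \<open>Zero-free entire functions of quadratic growth\<close>

text \<open>
  The Schwarz lemma for $w \mapsto w / (2M - w)$, which maps the half plane $\mathrm{Re}\,w < M$
  into the unit disc, bounds $|G|$ by its real part on a disc of twice the radius.
\<close>

lemma entire_quadratic_if_Re_le:
  fixes G :: "complex \<Rightarrow> complex"
  assumes hol: "G holomorphic_on UNIV" and "0 \<le> B"
    and Re_le: "\<And>z. Re (G z) \<le> B * (cmod z)\<^sup>2"
  obtains a b c where "\<And>z. G z = c + b * z + a * z\<^sup>2"
proof -
  let ?C = "8 * B + 3 * cmod (G 0) + 2"
  have bound: "cmod (G z) \<le> ?C * cmod z ^ 2" if z: "1 \<le> cmod z" for z
  proof -
    define R where "R = 2 * cmod z"
    \<comment> \<open>\<open>M\<close> bounds \<open>Re w\<close> strictly on the unit disc: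
      \<open>B * R^2\<close> bounds the real part of \<open>G\<close>, the norm of
      \<open>G 0\<close> absorbs the subtraction of \<open>G 0\<close>, and the 1 keeps the
      inequality strict.\<close>
    define M where "M = B * R\<^sup>2 + cmod (G 0) + 1"
    have "0 < R"
      using z unfolding R_def by linarith
    define w where "w \<zeta> = G (of_real R * \<zeta>) - G 0" for \<zeta>
    have Re_w: "Re (w \<zeta>) < M" if "cmod \<zeta> < 1" for \<zeta>
    proof -
      have "Re (G (of_real R * \<zeta>)) \<le> B * (cmod (of_real R * \<zeta>))\<^sup>2"
        by (rule Re_le)
      also have "\<dots> \<le> B * R\<^sup>2"
        using that \<open>0 < R\<close> \<open>0 \<le> B\<close>
        by (intro mult_left_mono power_mono) (auto simp: norm_mult)
      finally show ?thesis
        using abs_Re_le_cmod[of "G 0"] by (simp add: w_def M_def)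
    qed
    have "0 < M"
      using Re_w[of 0] by (simp add: w_def)
    have lt: "cmod (w \<zeta>) < cmod (2 * of_real M - w \<zeta>)" if "cmod \<zeta> < 1" for \<zeta>
    proof -
      have "(cmod (2 * of_real M - w \<zeta>))\<^sup>2 - (cmod (w \<zeta>))\<^sup>2 = 4 * M * (M - Re (w \<zeta>))"
        unfolding cmod_power2 by (simp add: power2_eq_square algebra_simps)
      also have "\<dots> > 0"
        using \<open>0 < M\<close> Re_w[OF that] by simp
      finally have "(cmod (w \<zeta>))\<^sup>2 < (cmod (2 * of_real M - w \<zeta>))\<^sup>2"
        by simp
      then show ?thesis
        by (rule power2_less_imp_less) simp
    qed
    have ne: "2 * of_real M - w \<zeta> \<noteq> 0" if "cmod \<zeta> < 1" for \<zeta>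
      using lt[OF that] norm_ge_zero[of "w \<zeta>"] by (metis norm_zero not_less)
    have hol_w: "w holomorphic_on ball 0 1"
      unfolding w_def
      by (intro holomorphic_intros holomorphic_on_compose_gen[OF _ hol, unfolded o_def]) auto
    have half: "cmod (z / of_real R) = 1 / 2"
      using \<open>0 < R\<close> by (simp add: R_def norm_divide)
    have "cmod (w (z / of_real R) / (2 * of_real M - w (z / of_real R))) \<le> cmod (z / of_real R)"
    proof (rule Schwarz_Lemma(1)[where f = "\<lambda>\<zeta>. w \<zeta> / (2 * of_real M - w \<zeta>)"])
      show "(\<lambda>\<zeta>. w \<zeta> / (2 * of_real M - w \<zeta>)) holomorphic_on ball 0 1"
        using ne by (intro holomorphic_intros hol_w) auto
      show "cmod (w \<zeta> / (2 * of_real M - w \<zeta>)) < 1" if "cmod \<zeta> < 1" for \<zeta>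
        using lt[OF that] ne[OF that] by (simp add: norm_divide)
      show "cmod (z / of_real R) < 1"
        unfolding half by simp
    qed (simp add: w_def)
    moreover have "0 < cmod (2 * of_real M - w (z / of_real R))"
      using ne[of "z / of_real R"] half by simp
    ultimately have "cmod (w (z / of_real R)) \<le> 1 / 2 * cmod (2 * of_real M - w (z / of_real R))"
      unfolding norm_divide[of "w _"] half by (simp only: pos_divide_le_eq)
    also have "cmod (2 * of_real M - w (z / of_real R)) \<le> 2 * M + cmod (w (z / of_real R))"
      using norm_triangle_ineq4[of "2 * of_real M" "w (z / of_real R)"] \<open>0 < M\<close> by (simp add: norm_mult)
    finally have "cmod (w (z / of_real R)) \<le> 2 * M"
      by simp
    moreover have "w (z / of_real R) = G z - G 0"
      using \<open>0 < R\<close> by (simp add: w_def)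
    ultimately have "cmod (G z) \<le> 2 * M + cmod (G 0)"
      using norm_triangle_ineq2[of "G z" "G 0"] by simp
    also have "\<dots> = 8 * B * (cmod z)\<^sup>2 + (3 * cmod (G 0) + 2)"
      by (simp add: M_def R_def power_mult_distrib)
    also have "\<dots> \<le> 8 * B * (cmod z)\<^sup>2 + (3 * cmod (G 0) + 2) * (cmod z)\<^sup>2"
      using z by (intro add_left_mono mult_left_mono[of 1 _ "3 * cmod (G 0) + 2", simplified]) (auto simp: one_le_power)
    finally show ?thesis
      by (simp add: algebra_simps)
  qed
  have taylor: "G z = (\<Sum>k\<le>2. (deriv ^^ k) G 0 / fact k * z ^ k)" for z
    using bound by (rule Liouville_polynomial[OF hol])
  have "G z = G 0 + deriv G 0 * z + (deriv ^^ 2) G 0 / 2 * z\<^sup>2" for z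
    using taylor[of z] by (simp add: numeral_2_eq_2 atMost_Suc algebra_simps)
  then show thesis
    using that by blast
qed

section \<open>The stellar function\<close>

text \<open>The coherent state at \<open>cnj z\<close>, without its factor
  \<open>exp (- |z|^2 / 2)\<close>. Its inner product with \<psi> evaluates the stellar function at
  \<open>z\<close>; the conjugate compensates for \<open>cinner\<close> being antilinear on the
  left.\<close>

definition coherent_vec :: "complex \<Rightarrow> wavefun" where
  "coherent_vec z = (\<Sum>n. (cnj z ^ n / complex_of_real (sqrt (fact n))) *\<^sub>C fock n)"

lemma coherent_coeff_sums:
  "(\<lambda>n. (cmod (cnj z ^ n / complex_of_real (sqrt (fact n))))\<^sup>2) sums exp ((cmod z)\<^sup>2)"
proof -
  have "(cmod (cnj z ^ n / complex_of_real (sqrt (fact n))))\<^sup>2 = ((cmod z)\<^sup>2) ^ n /\<^sub>R fact n" for n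
    unfolding norm_divide norm_power complex_mod_cnj norm_of_real
    by (simp add: power_divide divide_inverse power_inverse power_mult_distrib mult.commute flip: power_mult)
  then show ?thesis
    using exp_converges[of "(cmod z)\<^sup>2"] by simp
qed

lemma cinner_fock_coherent_vec:
  "cinner (fock n) (coherent_vec z) = cnj z ^ n / complex_of_real (sqrt (fact n))"
  unfolding coherent_vec_def by (rule cinner_fock_suminf[OF sums_summable[OF coherent_coeff_sums]])

lemma norm_coherent_vec: "norm (coherent_vec z) = exp ((cmod z)\<^sup>2 / 2)"
proof -
  have "(norm (coherent_vec z))\<^sup>2 = exp ((cmod z)\<^sup>2)"
    using parseval_norm[of "coherent_vec z"] coherent_coeff_sums[of z]
    unfolding cinner_fock_coherent_vec by (rule sums_unique2)
  also have "\<dots> = (exp ((cmod z)\<^sup>2 / 2))\<^sup>2"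
    by (simp flip: exp_double)
  finally show ?thesis
    by (rule power2_eq_imp_eq) auto
qed

lemma cinner_coherent_vec_fock:
  "cinner (coherent_vec z) (fock n) = z ^ n / complex_of_real (sqrt (fact n))"
  by (subst cinner_commute) (simp add: cinner_fock_coherent_vec)

lemma stellar_function_sums:
  "(\<lambda>n. cinner (fock n) \<psi> * z ^ n / complex_of_real (sqrt (fact n))) sums cinner (coherent_vec z) \<psi>"
  using parseval[of "coherent_vec z" \<psi>] by (simp add: cinner_coherent_vec_fock mult.commute)

lemma stellar_function_eq_cinner: "stellar_function \<psi> z = cinner (coherent_vec z) \<psi>"
  unfolding stellar_function_def using stellar_function_sums by (rule sums_unique[symmetric])

lemma stellar_function_bound: "cmod (stellar_function \<psi> z) \<le> norm \<psi> * exp ((cmod z)\<^sup>2 / 2)"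
  using cinner_Cauchy_Schwarz[of "coherent_vec z" \<psi>]
  by (simp add: stellar_function_eq_cinner norm_coherent_vec mult.commute)

lemma stellar_function_powser:
  "(\<lambda>n. (cinner (fock n) \<psi> / complex_of_real (sqrt (fact n))) * z ^ n) sums stellar_function \<psi> z"
  using stellar_function_sums[of \<psi> z] by (simp add: stellar_function_eq_cinner)

lemma stellar_function_holomorphic: "stellar_function \<psi> holomorphic_on UNIV"
proof -
  have "stellar_function \<psi> holomorphic_on ball 0 r" for r
    by (rule power_series_holomorphic[where a = "\<lambda>n. cinner (fock n) \<psi> / complex_of_real (sqrt (fact n))"])
      (use stellar_function_powser[of \<psi>] in simp)
  then have "stellar_function \<psi> field_differentiable at z" for z
    by (rule holomorphic_on_imp_differentiable_at[of _ "ball 0 (cmod z + 1)"]) auto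
  then show ?thesis
    by (auto simp: holomorphic_on_def intro: field_differentiable_at_within)
qed

text \<open>The rank sums the orders \<open>zorder\<close> after \<open>nat\<close>, so a zero
  contributes only once its order is known to be positive. That is shown from the function being
  nonzero nearby, which finiteness of the zero set supplies; an infinite zero set has infinite
  rank.\<close>

lemma stellar_function_ne_zero:
  assumes "stellar_rank \<psi> \<le> enat 0"
  shows "stellar_function \<psi> z \<noteq> 0"
proof
  define Z where "Z = {\<alpha>. stellar_function \<psi> \<alpha> = 0}"
  assume "stellar_function \<psi> z = 0"
  then have z: "z \<in> Z"
    by (simp add: Z_def)
  have fin: "finite Z"
  proof (rule ccontr)
    assume "infinite Z"
    then have "stellar_rank \<psi> = \<infinity>"
      by (simp add: stellar_rank_def Z_def)
    then show False
      using assms by simp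
  qed
  then have "stellar_rank \<psi> = enat (\<Sum>\<alpha>\<in>Z. nat (zorder (stellar_function \<psi>) \<alpha>))"
    by (simp add: stellar_rank_def Z_def)
  then have sum: "(\<Sum>\<alpha>\<in>Z. nat (zorder (stellar_function \<psi>) \<alpha>)) = 0"
    using assms by (simp only: enat_ord_simps le_zero_eq)
  have "open (- (Z - {z}))"
    using fin by (intro open_Compl finite_imp_closed) auto
  then have "eventually (\<lambda>w. w \<in> - (Z - {z})) (nhds z)"
    by (rule eventually_nhds_in_open) simp
  then have "eventually (\<lambda>w. stellar_function \<psi> w \<noteq> 0) (at z)"
    unfolding eventually_at_filter by eventually_elim (auto simp: Z_def)
  then have "frequently (\<lambda>w. stellar_function \<psi> w \<noteq> 0) (at z)"
    by (intro eventually_frequently) auto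
  then have "0 < zorder (stellar_function \<psi>) z"
    using zorder_pos_iff[OF stellar_function_holomorphic open_UNIV UNIV_I] \<open>stellar_function \<psi> z = 0\<close> by blast
  moreover have "nat (zorder (stellar_function \<psi>) z) = 0"
    using sum fin z by simp
  ultimately show False
    by simp
qed

text \<open>Cauchy-Schwarz only bounds this product. Decay follows by approximation: for a finite
  superposition the stellar function is a polynomial, and the error is at most the norm of the
  remainder, uniformly in \<open>t\<close>. Decay is what excludes the borderline
  \<open>|a| = 1/2\<close> later.\<close>

lemma stellar_function_decay:
  assumes "cmod u = 1"
  shows "((\<lambda>t. stellar_function \<psi> (complex_of_real t * u) * complex_of_real (exp (- (t\<^sup>2) / 2))) \<longlongrightarrow> 0) at_top"
proof (rule tendstoI)
  fix e :: real assume "0 < e"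
  define s where "s = (\<lambda>N. \<Sum>n<N. cinner (fock n) \<psi> *\<^sub>C fock n)"
  have "s \<longlonglongrightarrow> \<psi>"
    using fock_expansion[of \<psi>] by (simp add: sums_def s_def)
  then obtain N where N: "norm (s N - \<psi>) < e / 2"
    using LIMSEQ_D[of s \<psi> "e / 2"] \<open>0 < e\<close> by auto
  let ?w = "\<lambda>t. complex_of_real (exp (- (t\<^sup>2) / 2))"
  define A where "A t = (\<Sum>n<N. (cinner (fock n) \<psi> * u ^ n / complex_of_real (sqrt (fact n))) * (complex_of_real (t ^ n) * ?w t))" for t :: real
  have "(A \<longlongrightarrow> 0) at_top"
    unfolding A_def
    by (intro tendsto_null_sum tendsto_mult_right_zero gauss_dominated_tendsto_zero(1)
        gauss_dominated_power_mult gauss_dominated_gauss)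
  then have "eventually (\<lambda>t. dist (A t) 0 < e / 2) at_top"
    using \<open>0 < e\<close> by (intro tendstoD) auto
  then show "eventually (\<lambda>t. dist (stellar_function \<psi> (complex_of_real t * u) * ?w t) 0 < e) at_top"
  proof eventually_elim
    fix t assume *: "dist (A t) 0 < e / 2"
    let ?k = "coherent_vec (complex_of_real t * u)"
    have "cinner ?k (s N) * ?w t = A t"
      unfolding s_def A_def sum_distrib_right cinner_sum_right cinner_scaleC_right cinner_coherent_vec_fock
      by (intro sum.cong refl) (simp add: power_mult_distrib)
    then have "stellar_function \<psi> (complex_of_real t * u) * ?w t = A t + cinner ?k (\<psi> - s N) * ?w t"
      by (simp add: stellar_function_eq_cinner cinner_diff_right left_diff_distrib)
    moreover have "cmod (cinner ?k (\<psi> - s N) * ?w t) \<le> norm (\<psi> - s N)"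
    proof -
      have "cmod (cinner ?k (\<psi> - s N) * ?w t) \<le> (exp (t\<^sup>2 / 2) * norm (\<psi> - s N)) * exp (- (t\<^sup>2) / 2)"
        using cinner_Cauchy_Schwarz[of ?k "\<psi> - s N"] assms
        unfolding norm_mult norm_coherent_vec by (intro mult_mono) (simp_all add: norm_mult)
      also have "\<dots> = norm (\<psi> - s N) * (exp (t\<^sup>2 / 2) * exp (- (t\<^sup>2) / 2))"
        by simp
      also have "\<dots> = norm (\<psi> - s N)"
        by (simp flip: exp_add)
      finally show ?thesis .
    qed
    ultimately show "dist (stellar_function \<psi> (complex_of_real t * u) * ?w t) 0 < e"
      using N * norm_triangle_ineq[of "A t" "cinner ?k (\<psi> - s N) * ?w t"]
      by (simp add: norm_minus_commute)
  qed
qed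

lemma Re_of_real_mult: "Re (complex_of_real s * w) = s * Re w"
  by simp

text \<open>A zero-free entire function has a holomorphic logarithm \<open>G\<close>, and the
  coherent state bound gives \<open>Re (G z) <= |z|^2 / 2\<close>. If \<open>|a|\<close> were at
  least 1/2, the quadratic term would compensate the weight \<open>exp (- t^2 / 2)\<close> along a
  suitable ray, against \<open>stellar_function_decay\<close>.\<close>

lemma stellar_function_exp_quadratic:
  assumes "norm \<psi> = 1" and ne: "\<And>z. stellar_function \<psi> z \<noteq> 0"
  shows "\<exists>a b c. cmod a < 1 / 2 \<and> (\<forall>z. stellar_function \<psi> z = exp (c + b * z + a * z\<^sup>2))"
proof -
  obtain G where G: "G holomorphic_on UNIV" "\<And>z. stellar_function \<psi> z = exp (G z)"
    using contractible_imp_holomorphic_log[OF stellar_function_holomorphic contractible_UNIV] ne by (metis UNIV_I)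
  have "Re (G z) \<le> 1 / 2 * (cmod z)\<^sup>2" for z
  proof -
    have "exp (Re (G z)) \<le> exp ((cmod z)\<^sup>2 / 2)"
      using stellar_function_bound[of \<psi> z] assms(1) by (simp add: G(2))
    then show ?thesis
      by simp
  qed
  then obtain a b c where quad: "\<And>z. G z = c + b * z + a * z\<^sup>2"
    using entire_quadratic_if_Re_le[OF G(1), of "1 / 2"] by (metis divide_nonneg_nonneg zero_le_numeral zero_le_one)
  have "cmod a < 1 / 2"
  proof (rule ccontr)
    assume "\<not> cmod a < 1 / 2"
    then have a: "1 / 2 \<le> cmod a" "a \<noteq> 0"
      by auto
    \<comment> \<open>The direction makes \<open>a u^2 = |a|\<close>; the remaining sign is used to
      make the real part of the linear term nonnegative along the ray.\<close>
    define v where "v = csqrt (cnj (sgn a))"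
    define u where "u = (if 0 \<le> Re (b * v) then v else - v)"
    have "cmod v = 1"
      using a by (simp add: v_def norm_sgn)
    then have u: "cmod u = 1"
      by (simp add: u_def)
    have "u\<^sup>2 = cnj (sgn a)"
      by (simp add: u_def v_def)
    then have "a * u\<^sup>2 = a * cnj a / complex_of_real (cmod a)"
      by (simp add: sgn_eq)
    also have "a * cnj a = complex_of_real (cmod a) * complex_of_real (cmod a)"
      unfolding complex_norm_square[symmetric] by (simp add: power2_eq_square)
    finally have au: "a * u\<^sup>2 = complex_of_real (cmod a)"
      using a by simp
    have bu: "0 \<le> Re (b * u)"
      by (simp add: u_def)
    have "exp (Re c) \<le> cmod (stellar_function \<psi> (complex_of_real t * u) * complex_of_real (exp (- (t\<^sup>2) / 2)))"
      if "0 \<le> t" for t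
    proof -
      have "G (complex_of_real t * u) = c + complex_of_real t * (b * u) + complex_of_real (t\<^sup>2) * (a * u\<^sup>2)"
        unfolding quad by (simp add: power_mult_distrib algebra_simps)
      then have "Re (G (complex_of_real t * u)) = Re c + t * Re (b * u) + t\<^sup>2 * cmod a"
        unfolding au plus_complex.sel Re_of_real_mult by simp
      moreover have "0 \<le> t * Re (b * u)"
        using that bu by (rule mult_nonneg_nonneg)
      moreover have "t\<^sup>2 * (1 / 2) \<le> t\<^sup>2 * cmod a"
        using a by (intro mult_left_mono) auto
      ultimately have "Re c \<le> Re (G (complex_of_real t * u)) + - (t\<^sup>2) / 2"
        by simp
      then have "exp (Re c) \<le> exp (Re (G (complex_of_real t * u))) * exp (- (t\<^sup>2) / 2)"
        by (simp only: exp_add[symmetric] exp_le_cancel_iff)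
      then show ?thesis
        by (simp add: norm_mult G(2))
    qed
    then have "eventually (\<lambda>t. exp (Re c) \<le> cmod (stellar_function \<psi> (complex_of_real t * u) * complex_of_real (exp (- (t\<^sup>2) / 2)))) at_top"
      by (intro eventually_at_top_linorderI[of 0])
    from tendsto_lowerbound[OF tendsto_norm[OF stellar_function_decay[OF u]] this]
    show False
      by simp
  qed
  moreover have "\<forall>z. stellar_function \<psi> z = exp (c + b * z + a * z\<^sup>2)"
    by (simp add: G(2) quad)
  ultimately show ?thesis
    by blast
qed

section \<open>Pure states of stellar rank zero are Gaussian\<close>

text \<open>The recurrence has order two, but its solutions are determined by \<open>e 0\<close>
  alone, since the second coefficient vanishes at \<open>n = 0\<close>.\<close>

lemma three_term_zero:
  fixes e :: "nat \<Rightarrow> complex"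
  assumes "e 0 = 0"
    and rec: "\<And>n. complex_of_real (sqrt (real (Suc n))) * e (Suc n) =
      b * e n + 2 * a * complex_of_real (sqrt (real n)) * e (n - 1)"
  shows "e n = 0"
proof (induction n rule: less_induct)
  case (less n)
  show ?case
  proof (cases n)
    case (Suc m)
    have "e m = 0"
      using less Suc by simp
    moreover have "complex_of_real (sqrt (real m)) * e (m - 1) = 0"
      using less[of "m - 1"] Suc by (cases m) auto
    ultimately have "complex_of_real (sqrt (real (Suc m))) * e (Suc m) = 0"
      using rec[of m] by (simp only: mult.assoc mult_zero_right add_0)
    then show ?thesis
      using Suc by (simp del: of_nat_Suc)
  qed (simp add: assms)
qed

text \<open>Comparison of the power series coefficients \<open><n, \<psi>> / sqrt (n!)\<close> on
  both sides of \<open>F' = (b + 2 a z) F\<close>, followed by multiplication with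
  \<open>sqrt (n!)\<close>.\<close>

lemma stellar_recurrence:
  assumes F: "\<And>z. stellar_function \<psi> z = exp (c + b * z + a * z\<^sup>2)"
  shows "complex_of_real (sqrt (real (Suc n))) * cinner (fock (Suc n)) \<psi> =
      b * cinner (fock n) \<psi> + 2 * a * complex_of_real (sqrt (real n)) * cinner (fock (n - 1)) \<psi>"
proof -
  define A where "A = Abs_fps (\<lambda>n. cinner (fock n) \<psi> / complex_of_real (sqrt (fact n)))"
  have A: "stellar_function \<psi> has_fps_expansion A"
    unfolding has_fps_expansion_def
  proof
    have "summable (\<lambda>n. fps_nth A n * 1 ^ n)"
      using sums_summable[OF stellar_function_powser[of \<psi> 1]] by (simp add: A_def)
    then have "norm (1 :: complex) \<le> fps_conv_radius A"
      unfolding fps_conv_radius_def by (rule conv_radius_geI)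
    then show "0 < fps_conv_radius A"
      by (simp add: less_le_trans[of 0 "1 :: ereal"] one_ereal_def[symmetric])
    show "\<forall>\<^sub>F z in nhds 0. eval_fps A z = stellar_function \<psi> z"
      using sums_unique[OF stellar_function_powser[of \<psi>]] by (simp add: eval_fps_def A_def)
  qed
  have "deriv (stellar_function \<psi>) z = (b + (2 * a) * z) * stellar_function \<psi> z" for z
  proof (rule DERIV_imp_deriv)
    have "((\<lambda>z. exp (c + b * z + a * z\<^sup>2)) has_field_derivative (b + (2 * a) * z) * exp (c + b * z + a * z\<^sup>2)) (at z)"
      by (auto intro!: derivative_eq_intros simp: algebra_simps)
    then show "(stellar_function \<psi> has_field_derivative (b + (2 * a) * z) * stellar_function \<psi> z) (at z)"
      using F by (simp add: fun_eq_iff[symmetric] ext[of "stellar_function \<psi>" "\<lambda>z. exp (c + b * z + a * z\<^sup>2)"])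
  qed
  then have "deriv (stellar_function \<psi>) = (\<lambda>z. (b + (2 * a) * z) * stellar_function \<psi> z)"
    by blast
  moreover have "(\<lambda>z. (b + (2 * a) * z) * stellar_function \<psi> z) has_fps_expansion
      (fps_const b + fps_const (2 * a) * fps_X) * A"
    by (intro has_fps_expansion_mult has_fps_expansion_add has_fps_expansion_cmult_left
        has_fps_expansion_const has_fps_expansion_fps_X A)
  ultimately have "fps_deriv A = (fps_const b + fps_const (2 * a) * fps_X) * A"
    using has_fps_expansion_deriv[OF A] by (auto intro: fps_expansion_unique_complex)
  then have "fps_nth (fps_deriv A) n = fps_nth (fps_const b * A + fps_const (2 * a) * (fps_X * A)) n"
    by (simp add: distrib_right mult.assoc)
  then have rec: "of_nat (Suc n) * fps_nth A (Suc n) = b * fps_nth A n + 2 * a * (if n = 0 then 0 else fps_nth A (n - 1))"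
    by (simp del: of_nat_Suc)
  have sq: "complex_of_real (sqrt r) * complex_of_real (sqrt r) = complex_of_real r" if "0 \<le> r" for r
    using that by (simp flip: of_real_mult)
  define f where "f = complex_of_real (sqrt (fact n))"
  define r where "r = complex_of_real (sqrt (real (Suc n)))"
  have nz: "f \<noteq> 0" "r \<noteq> 0"
    by (simp_all add: f_def r_def del: of_nat_Suc)
  have "f * (of_nat (Suc n) * fps_nth A (Suc n)) = r * cinner (fock (Suc n)) \<psi>"
  proof -
    have "complex_of_real (sqrt (fact (Suc n))) = r * f"
      by (simp add: r_def f_def real_sqrt_mult del: of_nat_Suc)
    moreover have "of_nat (Suc n) = r * r"
      unfolding r_def by (subst sq) simp_all
    ultimately show ?thesis
      using nz by (simp add: A_def)
  qed
  moreover have "f * (b * fps_nth A n) = b * cinner (fock n) \<psi>"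
    using nz by (simp add: A_def f_def)
  moreover have "f * (2 * a * (if n = 0 then 0 else fps_nth A (n - 1))) =
      2 * a * complex_of_real (sqrt (real n)) * cinner (fock (n - 1)) \<psi>"
    by (cases n) (simp_all add: A_def f_def real_sqrt_mult del: of_nat_Suc)
  ultimately show ?thesis
    using rec unfolding r_def[symmetric] by (metis distrib_left)
qed

text \<open>
  The equation $F' = (b + 2 a \alpha) F$ says that $(\hat a - b - 2 a \hat a^\dagger)\psi = 0$; the
  Gaussian below is the solution of the corresponding first-order differential equation.
\<close>

definition gaussian :: "complex \<Rightarrow> complex \<Rightarrow> real \<Rightarrow> complex" where
  "gaussian k r x = exp (- k * (complex_of_real x)\<^sup>2 / 2 + r * complex_of_real x)"

lemma gauss_dominated_gaussian:
  assumes "0 < Re k"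
  shows "gauss_dominated (gaussian k r)"
proof (rule gauss_dominatedI)
  show "continuous_on UNIV (gaussian k r)"
    unfolding gaussian_def by (intro continuous_intros) auto
  show "0 < Re k / 4"
    using assms by simp
  fix x
  have "Re (- k * (complex_of_real x)\<^sup>2 / 2 + r * complex_of_real x) = - Re k * x\<^sup>2 / 2 + Re r * x"
    by (simp flip: of_real_power)
  moreover have "Re r * x \<le> (Re r)\<^sup>2 / Re k + Re k * x\<^sup>2 / 4"
  proof -
    have "0 \<le> (Re r - Re k * x / 2)\<^sup>2 / Re k"
      using assms by simp
    also have "\<dots> = (Re r)\<^sup>2 / Re k + Re k * x\<^sup>2 / 4 - Re r * x"
      using assms by (simp add: power2_eq_square field_simps)
    finally show ?thesis
      by simp
  qed
  ultimately have "Re (- k * (complex_of_real x)\<^sup>2 / 2 + r * complex_of_real x) \<le> (Re r)\<^sup>2 / Re k + - (Re k / 4 * x\<^sup>2)"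
    by simp
  then show "cmod (gaussian k r x) \<le> exp ((Re r)\<^sup>2 / Re k) * exp (- (Re k / 4 * x\<^sup>2))"
    unfolding gaussian_def norm_exp_eq_Re by (simp only: exp_add[symmetric] exp_le_cancel_iff)
qed

lemma gaussian_has_vector_derivative:
  "(gaussian k r has_vector_derivative (- k * complex_of_real x + r) * gaussian k r x) (at x)"
proof -
  have "((\<lambda>z. exp (- k * z\<^sup>2 / 2 + r * z)) has_field_derivative
      (- k * complex_of_real x + r) * gaussian k r x) (at (complex_of_real x))"
    unfolding gaussian_def by (auto intro!: derivative_eq_intros simp: algebra_simps)
  then have "((\<lambda>x. exp (- k * (complex_of_real x)\<^sup>2 / 2 + r * complex_of_real x)) has_vector_derivative
      (- k * complex_of_real x + r) * gaussian k r x) (at x)"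
    by (rule has_vector_derivative_real_field)
  then show ?thesis
    by (simp add: gaussian_def[abs_def])
qed

text \<open>In position space the equation reads
  \<open>(x + d/dx) f = sqrt 2 b f + 2 a (x - d/dx) f\<close>, that is
  \<open>(1 + 2 a) f' = (sqrt 2 b - (1 - 2 a) x) f\<close>. Hence \<open>f' / f = - k x + r\<close>
  with the given \<open>k\<close> and \<open>r\<close>. The ladder lemmas translate it into Fock
  coefficients.\<close>

lemma gaussian_recurrence:
  assumes a: "cmod a < 1 / 2" and k: "k = (1 - 2 * a) / (1 + 2 * a)"
    and r: "r = complex_of_real (sqrt 2) * b / (1 + 2 * a)" and pos: "0 < Re k"
  shows "complex_of_real (sqrt (real (Suc n))) * cinner (fock (Suc n)) (abs_wavefun (gaussian k r)) =
      b * cinner (fock n) (abs_wavefun (gaussian k r)) +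
      2 * a * complex_of_real (sqrt (real n)) * cinner (fock (n - 1)) (abs_wavefun (gaussian k r))"
proof -
  define f where "f = gaussian k r"
  define f' where "f' x = (- k * complex_of_real x + r) * f x" for x
  have dom_f: "gauss_dominated f"
    unfolding f_def by (rule gauss_dominated_gaussian[OF pos])
  have "f' = (\<lambda>x. - k * (complex_of_real x * f x) + r * f x)"
    by (simp add: f'_def fun_eq_iff algebra_simps)
  then have dom_f': "gauss_dominated f'"
    by (simp only:) (intro gauss_dominated_add gauss_dominated_cmult gauss_dominated_of_real_mult dom_f)
  have der: "(f has_vector_derivative f' x) (at x)" for x
    unfolding f_def f'_def by (rule gaussian_has_vector_derivative)
  have sq: "square_integrable f" "square_integrable (\<lambda>x. complex_of_real x * f x + f' x)"
    "square_integrable (\<lambda>x. complex_of_real x * f x - f' x)"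
    by (intro gauss_dominated_square_integrable gauss_dominated_add gauss_dominated_diff
        gauss_dominated_of_real_mult dom_f dom_f')+
  have "1 + 2 * a \<noteq> 0"
  proof
    assume "1 + 2 * a = 0"
    then have "a = - 1 / 2"
      by (simp add: field_simps add_eq_0_iff)
    then show False
      using a by simp
  qed
  then have "(1 + 2 * a) * k = 1 - 2 * a" "(1 + 2 * a) * r = complex_of_real (sqrt 2) * b"
    by (simp_all add: k r)
  then have ode: "complex_of_real x * f x + f' x =
      (complex_of_real (sqrt 2) * b) * f x + (2 * a) * (complex_of_real x * f x - f' x)" for x
    unfolding f'_def by algebra
  have "abs_wavefun (\<lambda>x. complex_of_real x * f x + f' x) =
      (complex_of_real (sqrt 2) * b) *\<^sub>C abs_wavefun f + (2 * a) *\<^sub>C abs_wavefun (\<lambda>x. complex_of_real x * f x - f' x)"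
    unfolding scaleC_abs_wavefun[OF sq(1)] scaleC_abs_wavefun[OF sq(3)]
      plus_abs_wavefun[OF square_integrable_cmult[OF sq(1)] square_integrable_cmult[OF sq(3)]]
    by (simp only: ode[symmetric])
  then have "cinner (fock n) (abs_wavefun (\<lambda>x. complex_of_real x * f x + f' x)) =
      complex_of_real (sqrt 2) * b * cinner (fock n) (abs_wavefun f) +
      2 * a * cinner (fock n) (abs_wavefun (\<lambda>x. complex_of_real x * f x - f' x))"
    by (simp add: cinner_add_right cinner_scaleC_right)
  then have "complex_of_real (sqrt 2) * (complex_of_real (sqrt (real (Suc n))) * cinner (fock (Suc n)) (abs_wavefun f)) =
      complex_of_real (sqrt 2) * (b * cinner (fock n) (abs_wavefun f) +
        2 * a * complex_of_real (sqrt (real n)) * cinner (fock (n - 1)) (abs_wavefun f))"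
    unfolding cinner_fock_lower[OF dom_f dom_f' der] cinner_fock_raise[OF dom_f dom_f' der]
      real_sqrt_mult of_real_mult by (simp only: distrib_left mult.assoc mult.left_commute)
  then show ?thesis
    by (simp add: f_def del: of_nat_Suc)
qed

text \<open>The coefficients of \<psi> and of the Gaussian solve the same recurrence, so the
  combination \<open>p n * d 0 - d n * p 0\<close>, zero at \<open>n = 0\<close>, vanishes
  identically. The coefficient \<open>d 0\<close> is nonzero, since otherwise all \<open>d n\<close>
  and with them the Gaussian would vanish.\<close>

lemma zero_free_stellar_function_gaussian:
  assumes "norm \<psi> = 1" and ne: "\<And>z. stellar_function \<psi> z \<noteq> 0"
  obtains k r C where "0 < Re k" "\<psi> = C *\<^sub>C abs_wavefun (gaussian k r)"
proof -
  obtain a b c where a: "cmod a < 1 / 2" and F: "\<And>z. stellar_function \<psi> z = exp (c + b * z + a * z\<^sup>2)"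
    using stellar_function_exp_quadratic[OF assms] by blast
  define k where "k = (1 - 2 * a) / (1 + 2 * a)"
  define r where "r = complex_of_real (sqrt 2) * b / (1 + 2 * a)"
  \<comment> \<open>\<open>k\<close> is a Cayley transform of \<open>2 a\<close>: its real part is
    \<open>(1 - 4 |a|^2) / |1 + 2 a|^2\<close>, positive exactly for
    \<open>|a| < 1/2\<close>.\<close>
  have "0 < Re k"
  proof -
    have "(cmod a)\<^sup>2 < (1 / 2)\<^sup>2"
      using a by (intro power_strict_mono) auto
    then have n: "4 * ((Re a)\<^sup>2 + (Im a)\<^sup>2) < 1"
      by (simp add: cmod_power2 power_divide)
    have "\<bar>Re a\<bar> < 1 / 2"
      using abs_Re_le_cmod[of a] a by linarith
    then have "0 < 1 + 2 * Re a"
      by linarith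
    then have "0 < (1 + 2 * Re a)\<^sup>2 + (2 * Im a)\<^sup>2"
      by (intro add_pos_nonneg) auto
    moreover have "Re k = ((1 - 2 * Re a) * (1 + 2 * Re a) - 2 * Im a * (2 * Im a)) / ((1 + 2 * Re a)\<^sup>2 + (2 * Im a)\<^sup>2)"
      by (simp add: k_def Re_divide)
    moreover have "0 < (1 - 2 * Re a) * (1 + 2 * Re a) - 2 * Im a * (2 * Im a)"
      using n by (simp add: power2_eq_square algebra_simps)
    ultimately show ?thesis
      by simp
  qed
  define g where "g = abs_wavefun (gaussian k r)"
  define p d where "p n = cinner (fock n) \<psi>" and "d n = cinner (fock n) g" for n
  have p: "complex_of_real (sqrt (real (Suc n))) * p (Suc n) =
      b * p n + 2 * a * complex_of_real (sqrt (real n)) * p (n - 1)" for n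
    unfolding p_def by (rule stellar_recurrence[OF F])
  have d: "complex_of_real (sqrt (real (Suc n))) * d (Suc n) =
      b * d n + 2 * a * complex_of_real (sqrt (real n)) * d (n - 1)" for n
    unfolding d_def g_def by (rule gaussian_recurrence[OF a k_def r_def \<open>0 < Re k\<close>])
  have "p n * d 0 - d n * p 0 = 0" for n
  proof (rule three_term_zero[where e = "\<lambda>n. p n * d 0 - d n * p 0" and a = a and b = b])
    show "complex_of_real (sqrt (real (Suc n))) * (p (Suc n) * d 0 - d (Suc n) * p 0) =
        b * (p n * d 0 - d n * p 0) + 2 * a * complex_of_real (sqrt (real n)) * (p (n - 1) * d 0 - d (n - 1) * p 0)" for n
      using p[of n] d[of n] by algebra
  qed simp
  moreover have "d 0 \<noteq> 0"
  proof
    assume "d 0 = 0"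
    then have "d n = 0" for n
      using d by (rule three_term_zero)
    then have "g = 0"
      unfolding d_def by (rule fock_complete)
    then have "AE x in lborel. gaussian k r x = 0"
      using gauss_dominated_square_integrable[OF gauss_dominated_gaussian[OF \<open>0 < Re k\<close>]]
      by (simp add: g_def zero_wavefun_def abs_wavefun_eq_iff square_integrable_zero)
    then have "AE x in (lborel :: real measure). False"
      by eventually_elim (simp add: gaussian_def)
    then show False
      by (simp add: eventually_False ae_filter_eq_bot_iff)
  qed
  ultimately have eq: "p n = p 0 / d 0 * d n" for n
    by (simp add: field_simps)
  have "\<psi> = (p 0 / d 0) *\<^sub>C g"
  proof (rule fock_eqI)
    show "cinner (fock n) \<psi> = cinner (fock n) ((p 0 / d 0) *\<^sub>C g)" for n
      unfolding cinner_scaleC_right p_def[symmetric] d_def[symmetric] by (rule eq)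
  qed
  then show thesis
    using that \<open>0 < Re k\<close> by (simp add: g_def)
qed

section \<open>Normal densities and their uniform lower bound\<close>

lemma gaussian_normal_density:
  assumes "0 < Re k" "norm (C *\<^sub>C abs_wavefun (gaussian k r)) = 1"
  obtains \<mu> \<sigma> where "0 < \<sigma>" "\<And>x. (cmod (C * gaussian k r x))\<^sup>2 = normal_density \<mu> \<sigma> x"
proof -
  \<comment> \<open>Completing the square in twice the real part of the exponent gives variance and
    mean; the unit norm forces the remaining factor \<open>A\<close> to be 1.\<close>
  define \<sigma> where "\<sigma> = 1 / sqrt (2 * Re k)"
  define \<mu> where "\<mu> = Re r / Re k"
  have \<sigma>: "0 < \<sigma>" "\<sigma>\<^sup>2 = 1 / (2 * Re k)"
    using assms(1) by (simp_all add: \<sigma>_def power_divide)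
  define A where "A = (cmod C)\<^sup>2 * exp ((Re r)\<^sup>2 / Re k) * sqrt (2 * pi * \<sigma>\<^sup>2)"
  have eq: "(cmod (C * gaussian k r x))\<^sup>2 = A * normal_density \<mu> \<sigma> x" for x
  proof -
    have "Re (- k * (complex_of_real x)\<^sup>2 / 2 + r * complex_of_real x) = - Re k * x\<^sup>2 / 2 + Re r * x"
      by (simp flip: of_real_power)
    then have "(cmod (C * gaussian k r x))\<^sup>2 = (cmod C)\<^sup>2 * exp (2 * (- Re k * x\<^sup>2 / 2 + Re r * x))"
      unfolding norm_mult gaussian_def norm_exp_eq_Re by (simp only: power_mult_distrib exp_double)
    also have "2 * (- Re k * x\<^sup>2 / 2 + Re r * x) = (Re r)\<^sup>2 / Re k + - (x - \<mu>)\<^sup>2 / (2 * \<sigma>\<^sup>2)"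
      unfolding \<sigma>(2) \<mu>_def using assms(1) by (simp add: power2_eq_square field_simps)
    also have "(cmod C)\<^sup>2 * exp ((Re r)\<^sup>2 / Re k + - (x - \<mu>)\<^sup>2 / (2 * \<sigma>\<^sup>2)) = A * normal_density \<mu> \<sigma> x"
      unfolding exp_add A_def normal_density_def using \<sigma>(1) by simp
    finally show ?thesis .
  qed
  have sq: "square_integrable (gaussian k r)"
    by (rule gauss_dominated_square_integrable[OF gauss_dominated_gaussian[OF assms(1)]])
  have "1 = (LINT x|lborel. (cmod (C * gaussian k r x))\<^sup>2)"
    using assms(2) norm_abs_wavefun[OF square_integrable_cmult[OF sq, of C]] by (simp add: scaleC_abs_wavefun[OF sq])
  also have "\<dots> = A"
    unfolding eq integral_mult_right_zero using \<sigma>(1) by simp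
  finally show thesis
    using that \<sigma>(1) eq by simp
qed

text \<open>Mean and variance are replaced by their worst values: the second moment bounds
  \<open>|\<mu>|\<close> by \<open>sqrt K\<close> and the variance by \<open>K\<close>, and the
  supremum bounds \<open>1 / (2 \<sigma>^2)\<close> by \<open>pi K^2\<close>. The 1/2 is the largest
  distance from \<open>x\<close> within a window of width at most 1.\<close>

definition gaussian_lower_bound :: "real \<Rightarrow> real \<Rightarrow> real" where
  "gaussian_lower_bound K x = 1 / sqrt (2 * pi * K) * exp (- ((\<bar>x\<bar> + 1 / 2 + sqrt K)\<^sup>2 * (pi * K\<^sup>2)))"

lemma normal_density_lower_bound:
  assumes "0 < \<sigma>" and reg: "regular_density K (normal_density \<mu> \<sigma>)" and q: "\<bar>q - x\<bar> \<le> 1 / 2"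
  shows "gaussian_lower_bound K x \<le> normal_density \<mu> \<sigma> q"
proof -
  note rd = regular_densityD[OF reg]
  \<comment> \<open>Since \<open>x^2 = (x - \<mu>)^2 + 2 \<mu> x - \<mu>^2\<close>, the second
    moment is assembled from the central one and the mean, with value
    \<open>\<sigma>^2 + \<mu>^2\<close>.\<close>
  have "has_bochner_integral lborel (\<lambda>x. normal_density \<mu> \<sigma> x * (x - \<mu>) ^ (2 * 1) +
      ((2 * \<mu>) * (normal_density \<mu> \<sigma> x * x) - \<mu>\<^sup>2 * normal_density \<mu> \<sigma> x))
      (fact (2 * 1) / ((2 / \<sigma>\<^sup>2) ^ 1 * fact 1) + ((2 * \<mu>) * \<mu> - \<mu>\<^sup>2 * 1))"
    using assms(1) by (intro has_bochner_integral_add has_bochner_integral_diff has_bochner_integral_mult_right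
        normal_moment_even normal_moment_nz_1)
      (auto simp: has_bochner_integral_iff integrable_normal_density integral_normal_density)
  moreover have "(\<lambda>x. normal_density \<mu> \<sigma> x * (x - \<mu>) ^ (2 * 1) +
      ((2 * \<mu>) * (normal_density \<mu> \<sigma> x * x) - \<mu>\<^sup>2 * normal_density \<mu> \<sigma> x)) = (\<lambda>x. x\<^sup>2 * normal_density \<mu> \<sigma> x)"
    by (auto simp: power2_eq_square algebra_simps)
  moreover have "fact (2 * 1) / ((2 / \<sigma>\<^sup>2) ^ 1 * fact 1) + ((2 * \<mu>) * \<mu> - \<mu>\<^sup>2 * 1) = \<sigma>\<^sup>2 + \<mu>\<^sup>2"
    by (simp add: power2_eq_square)
  ultimately have "has_bochner_integral lborel (\<lambda>x. x\<^sup>2 * normal_density \<mu> \<sigma> x) (\<sigma>\<^sup>2 + \<mu>\<^sup>2)"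
    by (simp only:)
  then have "(\<integral>\<^sup>+x. ennreal (x\<^sup>2 * normal_density \<mu> \<sigma> x) \<partial>lborel) = ennreal (\<sigma>\<^sup>2 + \<mu>\<^sup>2)"
    by (intro nn_integral_eq_integral[THEN trans]) (auto simp: has_bochner_integral_iff)
  then have "ennreal (\<sigma>\<^sup>2 + \<mu>\<^sup>2) \<le> ennreal K"
    using rd(5) by (simp only:)
  then have moment: "\<sigma>\<^sup>2 + \<mu>\<^sup>2 \<le> K"
    by (subst (asm) ennreal_le_iff) (use rd(6) in auto)
  have "0 < \<sigma>\<^sup>2"
    using assms(1) by simp
  then have K: "0 < K" "\<sigma>\<^sup>2 \<le> K" "\<mu>\<^sup>2 \<le> K"
    using moment zero_le_power2[of \<mu>] by linarith+
  \<comment> \<open>The left side is the value of the density at its mean.\<close>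
  have "1 / sqrt (2 * pi * \<sigma>\<^sup>2) \<le> K"
    using rd(2)[of \<mu>] by (simp add: normal_density_def)
  then have "(1 / sqrt (2 * pi * \<sigma>\<^sup>2))\<^sup>2 \<le> K\<^sup>2"
    using assms(1) by (intro power_mono) auto
  then have "1 / (2 * pi * \<sigma>\<^sup>2) \<le> K\<^sup>2"
    using assms(1) by (simp add: power_divide)
  then have inv: "1 / (2 * \<sigma>\<^sup>2) \<le> pi * K\<^sup>2"
    using assms(1) pi_gt_zero by (simp add: field_simps)
  have "\<bar>\<mu>\<bar> \<le> sqrt K"
    using K(3) by (intro real_le_rsqrt) simp
  then have "\<bar>q - \<mu>\<bar> \<le> \<bar>x\<bar> + 1 / 2 + sqrt K"
    using q by linarith
  then have "(q - \<mu>)\<^sup>2 \<le> (\<bar>x\<bar> + 1 / 2 + sqrt K)\<^sup>2"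
    using power_mono[of "\<bar>q - \<mu>\<bar>" "\<bar>x\<bar> + 1 / 2 + sqrt K" 2] by simp
  then have "(q - \<mu>)\<^sup>2 * (1 / (2 * \<sigma>\<^sup>2)) \<le> (\<bar>x\<bar> + 1 / 2 + sqrt K)\<^sup>2 * (pi * K\<^sup>2)"
    using inv by (intro mult_mono) auto
  then have "exp (- ((\<bar>x\<bar> + 1 / 2 + sqrt K)\<^sup>2 * (pi * K\<^sup>2))) \<le> exp (- (q - \<mu>)\<^sup>2 / (2 * \<sigma>\<^sup>2))"
    by simp
  moreover have "1 / sqrt (2 * pi * K) \<le> 1 / sqrt (2 * pi * \<sigma>\<^sup>2)"
    using K \<open>0 < \<sigma>\<^sup>2\<close> by (intro frac_le) auto
  ultimately show ?thesis
    unfolding gaussian_lower_bound_def normal_density_def using K(1) by (intro mult_mono) auto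
qed

lemma gaussian_lower_bound_pos: "0 < K \<Longrightarrow> 0 < gaussian_lower_bound K x"
  by (simp add: gaussian_lower_bound_def)

section \<open>The witness threshold\<close>

text \<open>Rotating the state rotates the argument, so zero-freeness is preserved. This reduces
  every quadrature to the position measurement.\<close>

lemma stellar_function_phase_rotation:
  "stellar_function (phase_rotation t \<psi>) z = stellar_function \<psi> (cis t * z)"
proof -
  have "cis (t * real n) = cis t ^ n" for n
    by (simp only: Complex.DeMoivre mult.commute)
  then show ?thesis
    by (simp add: stellar_function_def cinner_fock_phase_rotation power_mult_distrib mult_ac)
qed

text \<open>The function may have either sign: the lemma is applied to Gaussian densities and, for
  the upper estimate, to \<open>- p\<close>.\<close>

lemma set_integral_interval_lower_bound:
  fixes p :: "real \<Rightarrow> real"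
  assumes p: "integrable lborel p" and "0 < \<eta>" and low: "\<And>q. \<bar>q - x\<bar> \<le> \<eta> / 2 \<Longrightarrow> c \<le> p q"
  shows "c * \<eta> \<le> (LINT q:{x - \<eta> / 2..x + \<eta> / 2}|lborel. p q)"
proof -
  have "c * \<eta> = (LINT q|lborel. indicator {x - \<eta> / 2..x + \<eta> / 2} q *\<^sub>R c)"
    using \<open>0 < \<eta>\<close> by (simp add: mult.commute)
  also have "\<dots> \<le> (LINT q|lborel. indicator {x - \<eta> / 2..x + \<eta> / 2} q *\<^sub>R p q)"
  proof (rule integral_mono)
    show "integrable lborel (\<lambda>q. indicator {x - \<eta> / 2..x + \<eta> / 2} q *\<^sub>R c)"
      by (intro integrable_scaleR_left) (simp add: emeasure_lborel_Icc_eq)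
    show "integrable lborel (\<lambda>q. indicator {x - \<eta> / 2..x + \<eta> / 2} q *\<^sub>R p q)"
      using p by (intro integrable_mult_indicator) auto
    fix q
    show "indicator {x - \<eta> / 2..x + \<eta> / 2} q *\<^sub>R c \<le> indicator {x - \<eta> / 2..x + \<eta> / 2} q *\<^sub>R p q"
    proof (cases "q \<in> {x - \<eta> / 2..x + \<eta> / 2}")
      case True
      then have "\<bar>q - x\<bar> \<le> \<eta> / 2"
        unfolding abs_le_iff by auto
      with True low show ?thesis
        by simp
    qed simp
  qed
  finally show ?thesis
    by (simp add: set_lebesgue_integral_def)
qed

text \<open>The density is known in two ways: as an explicit normal density and, by the energy
  bound, as a regular density. Their identification transfers the moment and supremum bounds to mean
  and variance of the Gaussian.\<close>

lemma rank_zero_pure_lower_bound: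
  assumes "0 \<le> E" "norm \<psi> = 1" "energy \<psi> \<le> ennreal E" "stellar_rank \<psi> \<le> enat 0" "0 < \<eta>" "\<eta> \<le> 1"
  shows "\<exists>v. has_trace (pure_state \<psi>) (witness \<theta> x \<eta>) v \<and> gaussian_lower_bound (density_const E) x * \<eta> \<le> v"
proof -
  define \<phi> where "\<phi> = phase_rotation \<theta> \<psi>"
  have \<phi>: "norm \<phi> = 1" "energy \<phi> \<le> ennreal E" "\<And>z. stellar_function \<phi> z \<noteq> 0"
    using assms by (simp_all add: \<phi>_def norm_phase_rotation energy_phase_rotation
        stellar_function_phase_rotation stellar_function_ne_zero)
  obtain k r C where k: "0 < Re k" "\<phi> = C *\<^sub>C abs_wavefun (gaussian k r)"
    using zero_free_stellar_function_gaussian[OF \<phi>(1,3)] by blast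
  obtain \<mu> \<sigma> where \<sigma>: "0 < \<sigma>" "\<And>x. (cmod (C * gaussian k r x))\<^sup>2 = normal_density \<mu> \<sigma> x"
    using gaussian_normal_density[OF k(1)] k(2) \<phi>(1) by metis
  have dom: "gauss_dominated (gaussian k r)"
    by (rule gauss_dominated_gaussian[OF k(1)])
  have \<phi>_abs: "\<phi> = abs_wavefun (\<lambda>x. C * gaussian k r x)"
    by (simp add: k(2) scaleC_abs_wavefun gauss_dominated_square_integrable dom)
  have meas: "(norm (position_projector B \<phi>))\<^sup>2 = (LINT x:B|lborel. normal_density \<mu> \<sigma> x)" if "B \<in> sets borel" for B
    unfolding \<phi>_abs norm_position_projector_abs[OF that gauss_dominated_square_integrable[OF gauss_dominated_cmult[OF dom]]] \<sigma>(2) ..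
  obtain p where p: "regular_density (density_const E) p"
    "\<And>B. B \<in> sets borel \<Longrightarrow> (norm (position_projector B \<phi>))\<^sup>2 = (LINT x:B|lborel. p x)"
    using pure_regular_density[OF assms(1) \<phi>(1,2)] by blast
  have "p = normal_density \<mu> \<sigma>"
  proof (rule continuous_eq_if_set_integrals_eq)
    show "continuous_on UNIV (normal_density \<mu> \<sigma>)"
      unfolding normal_density_def using \<sigma>(1) by (intro continuous_intros) auto
    show "integrable lborel (normal_density \<mu> \<sigma>)"
      using \<sigma>(1) by (rule integrable_normal_density)
  qed (use p regular_densityD[OF p(1)] regular_density_continuous[OF p(1)] meas in auto)
  then have reg: "regular_density (density_const E) (normal_density \<mu> \<sigma>)"
    using p(1) by simp
  let ?B = "{x - \<eta> / 2..x + \<eta> / 2}"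
  have "has_trace (pure_state \<psi>) (witness \<theta> x \<eta>) (LINT q:?B|lborel. normal_density \<mu> \<sigma> q)"
    unfolding witness_def meas[symmetric, OF borel_closed[OF closed_atLeastAtMost]] \<phi>_def
    by (rule has_trace_pure_state) simp
  moreover have "gaussian_lower_bound (density_const E) x * \<eta> \<le> (LINT q:?B|lborel. normal_density \<mu> \<sigma> q)"
  proof (rule set_integral_interval_lower_bound)
    show "gaussian_lower_bound (density_const E) x \<le> normal_density \<mu> \<sigma> q" if "\<bar>q - x\<bar> \<le> \<eta> / 2" for q
      using that assms(6) by (intro normal_density_lower_bound[OF \<sigma>(1) reg]) simp
  qed (use assms \<sigma>(1) in \<open>auto intro: integrable_normal_density\<close>)
  ultimately show ?thesis
    by blast
qed

text \<open>Having a convergent trace of at least \<open>?c\<close> is a convex condition, so it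
  passes from the pure states to their hull; the closure costs an arbitrary
  \<open>e\<close>.\<close>

lemma rank_zero_lower_bound:
  assumes "0 \<le> E" "\<sigma> \<in> rank_bounded_states 0 E" "0 < \<eta>" "\<eta> \<le> 1"
  shows "gaussian_lower_bound (density_const E) x * \<eta> \<le> expval \<sigma> (witness \<theta> x \<eta>)"
proof (rule field_le_epsilon)
  let ?c = "gaussian_lower_bound (density_const E) x * \<eta>"
  let ?S = "{pure_state \<psi> | \<psi>. norm \<psi> = 1 \<and> energy \<psi> \<le> ennreal E \<and> stellar_rank \<psi> \<le> enat 0}"
  let ?T = "{\<tau>. \<exists>v. has_trace \<tau> (witness \<theta> x \<eta>) v \<and> ?c \<le> v}"
  fix e :: real assume "0 < e"
  obtain \<tau> where \<tau>: "\<tau> \<in> convex hull ?S"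
    "\<And>\<theta> B v. B \<in> sets borel \<Longrightarrow> has_trace \<tau> (quadrature_projector \<theta> B) v \<Longrightarrow>
      \<bar>expval \<sigma> (quadrature_projector \<theta> B) - v\<bar> \<le> e"
    using cch_approx[OF assms(2)[unfolded rank_bounded_states_def] \<open>0 < e\<close>] by blast
  have "convex hull ?S \<subseteq> ?T"
  proof (rule hull_minimal)
    show "?S \<subseteq> ?T"
      using rank_zero_pure_lower_bound[OF assms(1)] assms(3,4) by blast
    show "convex ?T"
    proof (rule convexI)
      fix \<sigma> \<tau> and u v :: real assume "\<sigma> \<in> ?T" "\<tau> \<in> ?T" and uv: "0 \<le> u" "0 \<le> v" "u + v = 1"
      then obtain y z where yz: "has_trace \<sigma> (witness \<theta> x \<eta>) y" "?c \<le> y"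
        "has_trace \<tau> (witness \<theta> x \<eta>) z" "?c \<le> z"
        by blast
      have "?c = u * ?c + v * ?c"
        using uv by (simp flip: distrib_right)
      also have "\<dots> \<le> u * y + v * z"
        using uv yz by (intro add_mono mult_left_mono) auto
      finally show "u *\<^sub>R \<sigma> + v *\<^sub>R \<tau> \<in> ?T"
        using has_trace_convex[OF yz(1,3), of u v] by blast
    qed
  qed
  with \<tau>(1) obtain v where v: "has_trace \<tau> (witness \<theta> x \<eta>) v" "?c \<le> v"
    by blast
  have "\<bar>expval \<sigma> (witness \<theta> x \<eta>) - v\<bar> \<le> e"
    unfolding witness_def by (rule \<tau>(2)) (use v(1) in \<open>simp_all add: witness_def\<close>)
  then show "?c \<le> expval \<sigma> (witness \<theta> x \<eta>) + e"
    using v(2) by linarith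
qed

text \<open>Places a density operator of the hull in \<open>cch\<close>: it approximates itself at
  distance zero.\<close>

lemma trace_norm_zero: "trace_norm 0 = 0"
proof -
  have "is_abs_op 0 0"
    by (simp add: is_abs_op_def positive_op_def)
  then have "trace_norm 0 \<le> (\<Sum>n. ennreal (Re (cinner (fock n) (blinfun_apply 0 (fock n)))))"
    unfolding trace_norm_def by (intro INF_lower) simp
  then show ?thesis
    by simp
qed

lemma density_operator_pure_state:
  assumes "norm \<psi> = 1"
  shows "density_operator (pure_state \<psi>)"
proof -
  have "cinner f (blinfun_apply (pure_state \<psi>) f) = complex_of_real ((cmod (cinner \<psi> f))\<^sup>2)" for f
    by (simp only: pure_state.rep_eq cinner_scaleC_right cinner_commute[of f \<psi>] complex_norm_square)
  then have "positive_op (pure_state \<psi>)"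
    by (simp add: positive_op_def pure_state_scaleC complex_nonneg_Reals_iff)
  moreover have "(\<lambda>n. cinner (fock n) (blinfun_apply (pure_state \<psi>) (fock n))) sums 1"
    using parseval[of \<psi> \<psi>] assms by (simp add: pure_state.rep_eq cinner_scaleC_right cinner_self)
  ultimately show ?thesis
    by (simp add: density_operator_def)
qed

text \<open>A lower bound for all elements bounds a real infimum only over a nonempty set. The
  vacuum is the witness, with energy 0 and constant stellar function 1.\<close>

lemma rank_bounded_states_nonempty:
  assumes "0 \<le> E"
  shows "pure_state (fock 0) \<in> rank_bounded_states 0 E"
proof -
  have "(norm (fock 0))\<^sup>2 = 1"
    using cinner_self[of "fock 0"] by (simp add: cinner_fock_fock flip: of_real_power)
  then have n: "norm (fock 0) = 1"
    by (simp add: power2_eq_iff_nonneg[of _ 1, simplified])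
  have "energy (fock 0) = (\<Sum>n. 0)"
    unfolding energy_def by (intro suminf_cong) (simp add: cinner_fock_fock)
  then have en: "energy (fock 0) \<le> ennreal E"
    by simp
  have "stellar_function (fock 0) z = 1" for z
  proof -
    have "stellar_function (fock 0) z = (\<Sum>n\<in>{0}. cinner (fock n) (fock 0) * z ^ n / complex_of_real (sqrt (fact n)))"
      unfolding stellar_function_def by (intro suminf_finite) (auto simp: cinner_fock_fock)
    then show ?thesis
      by (simp add: cinner_fock_fock)
  qed
  then have "stellar_rank (fock 0) \<le> enat 0"
    by (simp add: stellar_rank_def Let_def)
  with n en have "pure_state (fock 0) \<in> convex hull {pure_state \<psi> | \<psi>. norm \<psi> = 1 \<and> energy \<psi> \<le> ennreal E \<and> stellar_rank \<psi> \<le> enat 0}"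
    by (intro hull_inc) blast
  then show ?thesis
    unfolding rank_bounded_states_def cch_def
    using density_operator_pure_state[OF n] by (auto intro!: bexI[of _ "pure_state (fock 0)"] simp: trace_norm_zero)
qed

lemma witness_threshold_ge:
  assumes "0 \<le> E" "0 < \<eta>" "\<eta> \<le> 1"
  shows "gaussian_lower_bound (density_const E) x * \<eta> \<le> witness_threshold E \<theta> x \<eta>"
  unfolding witness_threshold_def
  using rank_bounded_states_nonempty[OF assms(1)] rank_zero_lower_bound[OF assms(1) _ assms(2,3)]
  by (intro cINF_greatest) auto

lemma witness_expval_le:
  assumes reg: "regular_density K p" and zero: "p x = 0" and "0 < \<eta>"
    and p: "\<And>B. B \<in> sets borel \<Longrightarrow> expval \<rho> (quadrature_projector \<theta> B) = (LINT q:B|lborel. p q)"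
  shows "expval \<rho> (witness \<theta> x \<eta>) \<le> K * sqrt \<eta> * \<eta>"
proof -
  note rd = regular_densityD[OF reg]
  \<comment> \<open>On the window \<open>p <= K * sqrt \<eta>\<close> by the Hoelder bound at the
    zero \<open>x\<close>; passing to \<open>- p\<close> turns the lower bound lemma into an upper
    bound.\<close>
  have "- (K * sqrt \<eta>) * \<eta> \<le> (LINT q:{x - \<eta> / 2..x + \<eta> / 2}|lborel. - p q)"
  proof (rule set_integral_interval_lower_bound)
    fix q assume q: "\<bar>q - x\<bar> \<le> \<eta> / 2"
    have "p q \<le> K * sqrt \<bar>q - x\<bar>"
      using rd(3)[of q x] zero rd(1)[of q] by simp
    also have "\<dots> \<le> K * sqrt \<eta>"
      using q \<open>0 < \<eta>\<close> rd(6) by (intro mult_left_mono) auto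
    finally show "- (K * sqrt \<eta>) \<le> - p q"
      by simp
  qed (use rd \<open>0 < \<eta>\<close> in auto)
  then show ?thesis
    unfolding witness_def by (simp add: p set_lebesgue_integral_def)
qed

theorem theorem5:
  fixes x E \<theta> :: real and \<rho> :: qop
  assumes "0 \<le> E"
    and "0 \<le> \<theta>" and "\<theta> < 2 * pi"
    and "\<rho> \<in> energy_bounded_states E"
    and "quadrature_density \<rho> \<theta> x = 0"
  shows "\<exists>\<delta>>0. \<forall>\<eta>. 0 < \<eta> \<and> \<eta> \<le> \<delta> \<longrightarrow>
           expval \<rho> (witness \<theta> x \<eta>) < witness_threshold E \<theta> x \<eta>"
proof -
  obtain p where p: "regular_density (density_const E) p"
    "\<And>B. B \<in> sets borel \<Longrightarrow> expval \<rho> (quadrature_projector \<theta> B) = (LINT x:B|lborel. p x)"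
    using energy_bounded_regular_density[OF assms(1,4)] by blast
  have zero: "p x = 0"
    using assms(5) quadrature_density_eq[OF p] by simp
  define K where "K = density_const E"
  define c where "c = gaussian_lower_bound K x"
  have K: "0 < K"
    using assms(1) by (simp add: K_def density_const_def)
  then have c: "0 < c"
    unfolding c_def by (rule gaussian_lower_bound_pos)
  \<comment> \<open>The 1 is required by the lower bound on the threshold; the square makes
    \<open>K * sqrt \<eta>\<close> at most \<open>c / 2\<close>, strictly below
    \<open>c\<close>.\<close>
  define \<delta> where "\<delta> = min 1 ((c / (2 * K))\<^sup>2)"
  have "expval \<rho> (witness \<theta> x \<eta>) < witness_threshold E \<theta> x \<eta>" if \<eta>: "0 < \<eta>" "\<eta> \<le> \<delta>" for \<eta>
  proof -
    have "sqrt \<eta> \<le> c / (2 * K)"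
      using \<eta> K c by (intro real_le_lsqrt) (auto simp: \<delta>_def)
    then have "K * sqrt \<eta> \<le> K * (c / (2 * K))"
      using K by (intro mult_left_mono) auto
    also have "\<dots> < c"
      using K c by simp
    finally have "K * sqrt \<eta> * \<eta> < c * \<eta>"
      using \<eta>(1) by simp
    moreover have "expval \<rho> (witness \<theta> x \<eta>) \<le> K * sqrt \<eta> * \<eta>"
      unfolding K_def by (rule witness_expval_le[OF p(1) zero \<eta>(1) p(2)])
    moreover have "c * \<eta> \<le> witness_threshold E \<theta> x \<eta>"
      unfolding c_def K_def using \<eta> by (intro witness_threshold_ge assms) (auto simp: \<delta>_def)
    ultimately show ?thesis
      by linarith
  qed
  moreover have "0 < \<delta>"
    using K c by (simp add: \<delta>_def)
  ultimately show ?thesis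
    by blast
qed

end
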